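(* Let $G$ be a finite group acting linearly on a complex vector space $V$ with basis $v_1,\ldots,v_n$, let $\mathbf{q}=(q_{ij})$ be nonzero complex scalars with $q_{ii}=1$ and $q_{ji}=q_{ij}^{-1}$, and assume that the action of $G$ on $V$ induces an action on $S_{\mathbf{q}}(V)$ by algebra automorphisms. Assume moreover that the action of $G$ on $V$ extends to an action on $\bigwedge_{\mathbf{q}}(V)$ by algebra automorphisms. Then each constant Hochschild 2-cocycle on $S_{\mathbf{q}}(V)\rtimes G$ lifts to a deformation of $S_{\mathbf{q}}(V)\rtimes G$ over $\mathbb{C}[t]$; that is, it occurs as the first-order term $\mu_1$ of some deformation of $S_{\mathbf{q}}(V)\rtimes G$ over $\mathbb{C}[t]$.
   Context: All tensor products are over $\mathbb{C}$. $S_{\mathbf{q}}(V)=\mathbb{C}\langle v_1,\ldots,v_n\mid v_iv_j=q_{ij}v_jv_i\ \forall i,j\rangle$ and $\bigwedge_{\mathbf{q}}(V)=\mathbb{C}\langle v_1,\ldots,v_n\mid v_iv_j=-q_{ij}v_jv_i\ \forall i,j\rangle$ are the quantum symmetric and quantum exterior algebras. For an algebra $A$ with an action of $G$ by automorphisms $a\mapsto{}^g a$, the skew group algebra $A\rtimes G$ is the free left $A$-module with basis $G$ and multiplication $(ag)(bh)=a({}^g b)\,gh$. $S_{\mathbf{q}}(V)\rtimes G$ is graded with $\deg v_i=1$, $\deg g=0$. A Hochschild 2-cocycle on an algebra $R$ is a linear map $\mu:R\otimes R\to R$ with $\mu(r\otimes s)u+\mu(rs\otimes u)=\mu(r\otimes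 su)+r\mu(s\otimes u)$ for all $r,s,u\in R$. A constant Hochschild 2-cocycle on $R=S_{\mathbf{q}}(V)\rtimes G$ is a Hochschild 2-cocycle that is homogeneous of degree $-2$ as a map from the graded space $R\otimes R$ to $R$. A deformation of a $\mathbb{C}$-algebra $R$ over $\mathbb{C}[t]$ is an associative $\mathbb{C}[t]$-algebra whose underlying vector space is $R[t]=\mathbb{C}[t]\otimes R$ and whose multiplication is $r*s=rs+\mu_1(r\otimes s)t+\mu_2(r\otimes s)t^2+\cdots$ for $r,s\in R$, where $rs$ is the product in $R$, the $\mu_i:R\otimes R\to R$ are $\mathbb{C}$-linear maps extended to be linear over $\mathbb{C}[t]$, and for each $r,s$ the sum is finite. *)

theory Defs
  imports Complex_Main "HOL-Algebra.Group_Action" "HOL-Algebra.QuotRing" "HOL-Algebra.UnivPoly"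
begin

text \<open>
  A \<open>\<complex>\<close>-algebra is given by a record of type \<open>(complex, 'a) module\<close>: a (not necessarily
  commutative) ring together with a scalar multiplication.
\<close>

section \<open>Algebras given by generators and relations\<close>

text \<open>
  The free algebra on \<open>v\<^sub>1, \<dots>, v\<^sub>n\<close> has the words over \<open>{1..n}\<close> as a basis, so an element is a
  finitely supported coefficient function on words.  The product of two elements
  has as its coefficient at \<open>w\<close> the sum over all factorisations \<open>w = w' @ w''\<close>.
\<close>

definition free_algebra :: "nat \<Rightarrow> (complex, nat list \<Rightarrow> complex) module" where
  "free_algebra n =
    \<lparr>carrier = {f. finite {w. f w \<noteq> 0} \<and> (\<forall>w. f w \<noteq> 0 \<longrightarrow> set w \<subseteq> {1..n})},
     mult = (\<lambda>f g w. \<Sum>k\<le>length w. f (take k w) * g (drop k w)),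
     one = (\<lambda>w. if w = [] then 1 else 0),
     zero = (\<lambda>w. 0),
     add = (\<lambda>f g w. f w + g w),
     smult = (\<lambda>c f w. c * f w)\<rparr>"

definition free_gen :: "nat \<Rightarrow> nat list \<Rightarrow> complex" where
  "free_gen i = (\<lambda>w. if w = [i] then 1 else 0)"

definition quotient_algebra :: "(complex, 'a) module \<Rightarrow> 'a set \<Rightarrow> (complex, 'a set) module" where
  "quotient_algebra A I =
    \<lparr>carrier = carrier (A Quot I), mult = mult (A Quot I), one = one (A Quot I),
     zero = zero (A Quot I), add = add (A Quot I),
     smult = (\<lambda>c X. \<Union>x\<in>X. I +>\<^bsub>A\<^esub> (c \<odot>\<^bsub>A\<^esub> x))\<rparr>"

text \<open>The two-sided ideal generated by all \<open>v\<^sub>i v\<^sub>j - p\<^sub>i\<^sub>j v\<^sub>j v\<^sub>i\<close>.\<close>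

definition commutation_ideal :: "nat \<Rightarrow> (nat \<Rightarrow> nat \<Rightarrow> complex) \<Rightarrow> (nat list \<Rightarrow> complex) set" where
  "commutation_ideal n p =
    (let F = free_algebra n in
     Idl\<^bsub>F\<^esub> {(free_gen i \<otimes>\<^bsub>F\<^esub> free_gen j) \<ominus>\<^bsub>F\<^esub> (p i j \<odot>\<^bsub>F\<^esub> (free_gen j \<otimes>\<^bsub>F\<^esub> free_gen i)) | i j.
           i \<in> {1..n} \<and> j \<in> {1..n}})"

definition commutation_algebra ::
    "nat \<Rightarrow> (nat \<Rightarrow> nat \<Rightarrow> complex) \<Rightarrow> (complex, (nat list \<Rightarrow> complex) set) module" where
  "commutation_algebra n p = quotient_algebra (free_algebra n) (commutation_ideal n p)"

definition algebra_gen :: "nat \<Rightarrow> (nat \<Rightarrow> nat \<Rightarrow> complex) \<Rightarrow> nat \<Rightarrow> (nat list \<Rightarrow> complex) set" where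
  "algebra_gen n p i = commutation_ideal n p +>\<^bsub>free_algebra n\<^esub> free_gen i"

definition quantum_symmetric_algebra ::
    "nat \<Rightarrow> (nat \<Rightarrow> nat \<Rightarrow> complex) \<Rightarrow> (complex, (nat list \<Rightarrow> complex) set) module" where
  "quantum_symmetric_algebra n q = commutation_algebra n q"

definition quantum_exterior_algebra ::
    "nat \<Rightarrow> (nat \<Rightarrow> nat \<Rightarrow> complex) \<Rightarrow> (complex, (nat list \<Rightarrow> complex) set) module" where
  "quantum_exterior_algebra n q = commutation_algebra n (\<lambda>i j. - q i j)"

text \<open>
  Homogeneous components, indexed by the integers: the component of degree \<open>d\<close> consists of the
  classes of linear combinations of words of length \<open>d\<close>, so it is zero for negative \<open>d\<close>.
\<close>

definition sym_component ::
    "nat \<Rightarrow> (nat \<Rightarrow> nat \<Rightarrow> complex) \<Rightarrow> int \<Rightarrow> (nat list \<Rightarrow> complex) set set" where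
  "sym_component n q d =
    {commutation_ideal n q +>\<^bsub>free_algebra n\<^esub> f | f.
       f \<in> carrier (free_algebra n) \<and> (\<forall>w. f w \<noteq> 0 \<longrightarrow> int (length w) = d)}"

section \<open>Group actions\<close>

definition acts_by_automorphisms ::
    "('g, 'm) monoid_scheme \<Rightarrow> (complex, 'a) module \<Rightarrow> ('g \<Rightarrow> 'a \<Rightarrow> 'a) \<Rightarrow> bool" where
  "acts_by_automorphisms G A \<alpha> \<longleftrightarrow>
    group_action G (carrier A) \<alpha> \<and>
    (\<forall>g\<in>carrier G. \<alpha> g \<in> ring_hom A A \<and>
       (\<forall>c. \<forall>x\<in>carrier A. \<alpha> g (c \<odot>\<^bsub>A\<^esub> x) = c \<odot>\<^bsub>A\<^esub> \<alpha> g x))"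

text \<open>
  \<open>generator_map scale n v p\<close> is the linear map from \<open>V\<close>, with basis \<open>v 1, \<dots>, v n\<close>, to the algebra with
  relations \<open>v\<^sub>i v\<^sub>j = p\<^sub>i\<^sub>j v\<^sub>j v\<^sub>i\<close> that sends each \<open>v i\<close> to the \<open>i\<close>-th generator.
\<close>

definition generator_map ::
    "(complex \<Rightarrow> 'v \<Rightarrow> 'v) \<Rightarrow> nat \<Rightarrow> (nat \<Rightarrow> 'v::ab_group_add) \<Rightarrow> (nat \<Rightarrow> nat \<Rightarrow> complex) \<Rightarrow>
     'v \<Rightarrow> (nat list \<Rightarrow> complex) set" where
  "generator_map scale n v p x =
    (\<Oplus>\<^bsub>commutation_algebra n p\<^esub> i\<in>{1..n}.
       Modules.module.representation scale (v ` {1..n}) x (v i)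
         \<odot>\<^bsub>commutation_algebra n p\<^esub> algebra_gen n p i)"

definition extends_to_sym ::
    "('g, 'm) monoid_scheme \<Rightarrow> (complex \<Rightarrow> 'v \<Rightarrow> 'v) \<Rightarrow> nat \<Rightarrow> (nat \<Rightarrow> 'v::ab_group_add) \<Rightarrow>
     ('g \<Rightarrow> 'v \<Rightarrow> 'v) \<Rightarrow> (nat \<Rightarrow> nat \<Rightarrow> complex) \<Rightarrow>
     ('g \<Rightarrow> (nat list \<Rightarrow> complex) set \<Rightarrow> (nat list \<Rightarrow> complex) set) \<Rightarrow> bool" where
  "extends_to_sym G scale n v \<rho> q \<alpha> \<longleftrightarrow>
    acts_by_automorphisms G (quantum_symmetric_algebra n q) \<alpha> \<and>
    (\<forall>g\<in>carrier G. \<forall>x.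
       \<alpha> g (generator_map scale n v q x) = generator_map scale n v q (\<rho> g x))"

definition extends_to_ext ::
    "('g, 'm) monoid_scheme \<Rightarrow> (complex \<Rightarrow> 'v \<Rightarrow> 'v) \<Rightarrow> nat \<Rightarrow> (nat \<Rightarrow> 'v::ab_group_add) \<Rightarrow>
     ('g \<Rightarrow> 'v \<Rightarrow> 'v) \<Rightarrow> (nat \<Rightarrow> nat \<Rightarrow> complex) \<Rightarrow>
     ('g \<Rightarrow> (nat list \<Rightarrow> complex) set \<Rightarrow> (nat list \<Rightarrow> complex) set) \<Rightarrow> bool" where
  "extends_to_ext G scale n v \<rho> q \<beta> \<longleftrightarrow>
    acts_by_automorphisms G (quantum_exterior_algebra n q) \<beta> \<and>
    (\<forall>g\<in>carrier G. \<forall>x.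
       \<beta> g (generator_map scale n v (\<lambda>i j. - q i j) x)
         = generator_map scale n v (\<lambda>i j. - q i j) (\<rho> g x))"

section \<open>Skew group algebras\<close>

text \<open>
  For a finite group \<open>G\<close> (the only case considered): an element \<open>\<Sum>\<^sub>g a\<^sub>g g\<close> is the family of its
  coefficients \<open>a\<^sub>g\<close>.  As \<open>(a g) (b h) = a (\<^sup>g b) (g h)\<close>, the coefficient of a product at \<open>k\<close> collects
  the pairs \<open>(g, h)\<close> with \<open>h = g\<^sup>-\<^sup>1 k\<close>.
\<close>

definition skew_group_algebra ::
    "(complex, 'a) module \<Rightarrow> ('g, 'm) monoid_scheme \<Rightarrow> ('g \<Rightarrow> 'a \<Rightarrow> 'a) \<Rightarrow> (complex, 'g \<Rightarrow> 'a) module" where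
  "skew_group_algebra A G \<alpha> =
    \<lparr>carrier = carrier G \<rightarrow>\<^sub>E carrier A,
     mult = (\<lambda>x y. \<lambda>k\<in>carrier G.
       \<Oplus>\<^bsub>A\<^esub> g\<in>carrier G. x g \<otimes>\<^bsub>A\<^esub> \<alpha> g (y (inv\<^bsub>G\<^esub> g \<otimes>\<^bsub>G\<^esub> k))),
     one = (\<lambda>k\<in>carrier G. if k = \<one>\<^bsub>G\<^esub> then \<one>\<^bsub>A\<^esub> else \<zero>\<^bsub>A\<^esub>),
     zero = (\<lambda>k\<in>carrier G. \<zero>\<^bsub>A\<^esub>),
     add = (\<lambda>x y. \<lambda>k\<in>carrier G. x k \<oplus>\<^bsub>A\<^esub> y k),
     smult = (\<lambda>c x. \<lambda>k\<in>carrier G. c \<odot>\<^bsub>A\<^esub> x k)\<rparr>"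

definition skew_component ::
    "nat \<Rightarrow> (nat \<Rightarrow> nat \<Rightarrow> complex) \<Rightarrow> ('g, 'm) monoid_scheme \<Rightarrow> int \<Rightarrow>
     ('g \<Rightarrow> (nat list \<Rightarrow> complex) set) set" where
  "skew_component n q G d = carrier G \<rightarrow>\<^sub>E sym_component n q d"

section \<open>Hochschild cocycles and deformations\<close>

text \<open>Linear maps \<open>R \<otimes> R \<rightarrow> R\<close> are rendered as bilinear maps.\<close>

definition bilinear_map :: "(complex, 'a) module \<Rightarrow> ('a \<Rightarrow> 'a \<Rightarrow> 'a) \<Rightarrow> bool" where
  "bilinear_map R \<mu> \<longleftrightarrow>
    (\<forall>r\<in>carrier R. \<forall>s\<in>carrier R. \<mu> r s \<in> carrier R) \<and>
    (\<forall>r\<in>carrier R. \<forall>r'\<in>carrier R. \<forall>s\<in>carrier R.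
       \<mu> (r \<oplus>\<^bsub>R\<^esub> r') s = \<mu> r s \<oplus>\<^bsub>R\<^esub> \<mu> r' s \<and>
       \<mu> s (r \<oplus>\<^bsub>R\<^esub> r') = \<mu> s r \<oplus>\<^bsub>R\<^esub> \<mu> s r') \<and>
    (\<forall>c. \<forall>r\<in>carrier R. \<forall>s\<in>carrier R.
       \<mu> (c \<odot>\<^bsub>R\<^esub> r) s = c \<odot>\<^bsub>R\<^esub> \<mu> r s \<and>
       \<mu> r (c \<odot>\<^bsub>R\<^esub> s) = c \<odot>\<^bsub>R\<^esub> \<mu> r s)"

definition hochschild_2_cocycle :: "(complex, 'a) module \<Rightarrow> ('a \<Rightarrow> 'a \<Rightarrow> 'a) \<Rightarrow> bool" where
  "hochschild_2_cocycle R \<mu> \<longleftrightarrow>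
    bilinear_map R \<mu> \<and>
    (\<forall>r\<in>carrier R. \<forall>s\<in>carrier R. \<forall>u\<in>carrier R.
       \<mu> r s \<otimes>\<^bsub>R\<^esub> u \<oplus>\<^bsub>R\<^esub> \<mu> (r \<otimes>\<^bsub>R\<^esub> s) u = \<mu> r (s \<otimes>\<^bsub>R\<^esub> u) \<oplus>\<^bsub>R\<^esub> r \<otimes>\<^bsub>R\<^esub> \<mu> s u)"

text \<open>
  The degree \<open>m\<close> part of \<open>R \<otimes> R\<close> is spanned by the \<open>R\<^sub>i \<otimes> R\<^sub>j\<close> with \<open>i + j = m\<close>.  In particular a
  map of degree \<open>-2\<close> vanishes on \<open>R\<^sub>i \<otimes> R\<^sub>j\<close> if \<open>i + j < 2\<close>.
\<close>

definition constant_hochschild_2_cocycle ::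
    "nat \<Rightarrow> (nat \<Rightarrow> nat \<Rightarrow> complex) \<Rightarrow> ('g, 'm) monoid_scheme \<Rightarrow>
     ('g \<Rightarrow> (nat list \<Rightarrow> complex) set \<Rightarrow> (nat list \<Rightarrow> complex) set) \<Rightarrow>
     (('g \<Rightarrow> (nat list \<Rightarrow> complex) set) \<Rightarrow> ('g \<Rightarrow> (nat list \<Rightarrow> complex) set) \<Rightarrow>
      ('g \<Rightarrow> (nat list \<Rightarrow> complex) set)) \<Rightarrow> bool" where
  "constant_hochschild_2_cocycle n q G \<alpha> \<mu> \<longleftrightarrow>
    hochschild_2_cocycle (skew_group_algebra (quantum_symmetric_algebra n q) G \<alpha>) \<mu> \<and>
    (\<forall>i j. \<forall>r\<in>skew_component n q G i. \<forall>s\<in>skew_component n q G j.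
       \<mu> r s \<in> skew_component n q G (i + j - 2))"

text \<open>
  \<open>up R\<close> is the set \<open>R[t]\<close> of finitely supported sequences in \<open>R\<close>.  The \<open>\<complex>[t]\<close>-bilinear extension of
  \<open>r * s = \<Sum>\<^sub>l m l r s t\<^sup>l\<close> sends \<open>(r t\<^sup>i, s t\<^sup>j)\<close> to \<open>\<Sum>\<^sub>l m l r s t\<^bsup>l+i+j\<^esup>\<close>.
\<close>

definition deformed_mult ::
    "(complex, 'a) module \<Rightarrow> (nat \<Rightarrow> 'a \<Rightarrow> 'a \<Rightarrow> 'a) \<Rightarrow> (nat \<Rightarrow> 'a) \<Rightarrow> (nat \<Rightarrow> 'a) \<Rightarrow> nat \<Rightarrow> 'a" where
  "deformed_mult R m f g k =
    (\<Oplus>\<^bsub>R\<^esub> p\<in>{(l, i, j). l + i + j = k}. case p of (l, i, j) \<Rightarrow> m l (f i) (g j))"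

text \<open>
  Distributivity and \<open>\<complex>[t]\<close>-bilinearity of the multiplication follow from bilinearity of the \<open>m l\<close>, so
  that only associativity and the existence of a unit (not required to be the unit
  of \<open>R\<close>) remain to be demanded; both are expressed by \<^locale>\<open>monoid\<close>.
\<close>

definition deformation :: "(complex, 'a) module \<Rightarrow> (nat \<Rightarrow> 'a \<Rightarrow> 'a \<Rightarrow> 'a) \<Rightarrow> bool" where
  "deformation R m \<longleftrightarrow>
    (\<forall>l. bilinear_map R (m l)) \<and>
    (\<forall>r\<in>carrier R. \<forall>s\<in>carrier R. m 0 r s = r \<otimes>\<^bsub>R\<^esub> s) \<and>
    (\<forall>r\<in>carrier R. \<forall>s\<in>carrier R. finite {l. m l r s \<noteq> \<zero>\<^bsub>R\<^esub>}) \<and>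
    (\<exists>e. monoid \<lparr>carrier = up R, mult = deformed_mult R m, one = e\<rparr>)"

end

theory Submission
  imports Defs "HOL-Library.Poly_Mapping" "HOL-Computational_Algebra.Formal_Power_Series"
begin

text \<open>
  Write \<open>R\<close> for the skew group algebra and give the parameter \<open>t\<close> degree 2, so that a constant cocycle is a
  homogeneous first-order deformation of \<open>R\<close>.  The obstruction to passing from order \<open>k - 1\<close> to order
  \<open>k \<ge> 2\<close> is a class in Hochschild cohomology of cohomological degree 3 and of internal degree
  \<open>-2 k \<le> -4\<close>.  Over the semisimple group algebra, \<open>R\<close> is a Koszul algebra: the third
  term of its bimodule resolution is generated by \<open>(relations \<otimes> V) \<inter> (V \<otimes> relations)\<close>, in degree 3.  So
  this cohomology vanishes in internal degrees below \<open>-3\<close>, and every extension problem has a solution.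

  The proof carries this out with operators instead of resolutions.  A product on \<open>R[t]\<close> is determined by
  the operators \<open>X\<^sub>i\<close> and \<open>U\<^sub>h\<close> of left multiplication by the generators \<open>v\<^sub>i\<close> and \<open>h \<in> G\<close>.  These must satisfy
  \<open>U\<^sub>h U\<^sub>k = U\<^sub>h\<^sub>k\<close>, \<open>U\<^sub>h X\<^sub>i = \<Sum>\<^sub>j a\<^sub>i\<^sub>j(h) X\<^sub>j U\<^sub>h\<close> and \<open>X\<^sub>i X\<^sub>j - q\<^sub>i\<^sub>j X\<^sub>j X\<^sub>i = t \<kappa>\<^sub>i\<^sub>j\<close>, where
  \<open>\<kappa>\<^sub>i\<^sub>j = \<mu>(v\<^sub>i, v\<^sub>j) - q\<^sub>i\<^sub>j \<mu>(v\<^sub>j, v\<^sub>i)\<close> has degree 0 and therefore lies in the group algebra.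

  \<^item> An average over \<open>G\<close> changes \<open>\<mu>\<close> by a coboundary so that it vanishes whenever its first argument lies in \<open>G\<close>
    (\<open>Mu_grp\<close>); the operators \<open>U\<^sub>h\<close> can then be taken constant in \<open>t\<close>.

  \<^item> The coefficients of the \<open>X\<^sub>i\<close> are found one power of \<open>t\<close> at a time (\<open>lift_step\<close>).  The error \<open>F\<^sub>i\<^sub>j\<close> at order \<open>k\<close>
    satisfies a Jacobi identity, because the \<open>q\<close>-commutators of any operators do
    (\<open>q_jacobi_q_commutator\<close>) and because the elements \<open>\<kappa>\<^sub>i\<^sub>j\<close> satisfy it against every equivariant family of operators
    (\<open>q_jacobi_K\<close>).  A recursion along the sorted monomials removes such an error
    (\<open>solve_commutation\<close>), and averaging over \<open>G\<close> restores equivariance (\<open>average_solution\<close>).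

  \<^item> The algebra generated by the operators is flat over \<open>\<complex>[t]\<close>, since each relation of \<open>R\<close> lifts to a multiple
    of \<open>t\<close> inside the algebra (\<open>alg_mod_shift\<close>).  Hence evaluation at 1 identifies it with
    \<open>R[t]\<close> (\<open>alg_eval_injective\<close>, \<open>alg_eval_surjective\<close>), and composition of operators becomes an associative product
    on \<open>R[t]\<close> (\<open>star_assoc\<close>).  Undoing the average by conjugation with \<open>1 + t \<phi>\<close> makes its
    first-order term agree with \<open>\<mu>\<close> on generators, hence everywhere (\<open>star_0_1\<close>).

  All of this takes place on functions on the set of pairs \<open>(A, g)\<close>, where the multiset \<open>A\<close> stands for the
  sorted monomial \<open>v\<^sub>A\<close>.  The last sections identify \<open>R\<close>, which is built from cosets in a free algebra,
  with this model.
\<close>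


section \<open>Complex vector spaces, linear endomorphisms and power series\<close>

abbreviation "keys \<equiv> Poly_Mapping.keys"
abbreviation "lookup \<equiv> Poly_Mapping.lookup"

text \<open>
  One class of complex vector spaces covers the model spaces, their endomorphisms and power series in
  either, so that the same rewrite rules apply to all of them.
\<close>

class cvec = ab_group_add +
  fixes scaleC :: "complex \<Rightarrow> 'a \<Rightarrow> 'a" (infixr \<open>*\<^sub>C\<close> 75)
  assumes scaleC_add_right: "c *\<^sub>C (x + y) = c *\<^sub>C x + c *\<^sub>C y"
    and scaleC_add_left: "(c + d) *\<^sub>C x = c *\<^sub>C x + d *\<^sub>C x"
    and scaleC_scaleC [simp]: "c *\<^sub>C d *\<^sub>C x = (c * d) *\<^sub>C x"
    and scaleC_one [simp]: "1 *\<^sub>C x = x"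
begin

lemma scaleC_zero_right [simp]: "c *\<^sub>C 0 = 0"
  using scaleC_add_right[of c 0 0] by simp

lemma scaleC_zero_left [simp]: "0 *\<^sub>C x = 0"
  using scaleC_add_left[of 0 0 x] by simp

lemma scaleC_minus_right [simp]: "c *\<^sub>C (- x) = - (c *\<^sub>C x)"
  using scaleC_add_right[of c x "- x"] by (simp add: eq_neg_iff_add_eq_0 add.commute)

lemma scaleC_minus_left [simp]: "(- c) *\<^sub>C x = - (c *\<^sub>C x)"
  using scaleC_add_left[of c "- c" x] by (simp add: eq_neg_iff_add_eq_0 add.commute)

lemma scaleC_diff_right: "c *\<^sub>C (x - y) = c *\<^sub>C x - c *\<^sub>C y"
  using scaleC_add_right[of c x "- y"] by simp

lemma scaleC_diff_left: "(c - d) *\<^sub>C x = c *\<^sub>C x - d *\<^sub>C x"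
  using scaleC_add_left[of c "- d" x] by simp

lemma scaleC_sum_right: "c *\<^sub>C sum f A = (\<Sum>a\<in>A. c *\<^sub>C f a)"
  by (induction A rule: infinite_finite_induct) (simp_all add: scaleC_add_right)

lemma scaleC_sum_left: "sum f A *\<^sub>C x = (\<Sum>a\<in>A. f a *\<^sub>C x)"
  by (induction A rule: infinite_finite_induct) (simp_all add: scaleC_add_left)

end

class calg = cvec + ring_1 +
  assumes scaleC_mult_left [simp]: "(c *\<^sub>C x) * y = c *\<^sub>C (x * y)"
    and scaleC_mult_right [simp]: "x * (c *\<^sub>C y) = c *\<^sub>C (x * y)"

lemmas scaleC_algebra = scaleC_add_right scaleC_diff_right algebra_simps

instantiation complex :: calg
begin
definition scaleC_complex :: "complex \<Rightarrow> complex \<Rightarrow> complex"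
  where scaleC_complex_eq [simp]: "scaleC_complex c x = c * x"
instance by standard (simp_all add: algebra_simps)
end

instantiation poly_mapping :: (type, cvec) cvec
begin
lift_definition scaleC_poly_mapping :: "complex \<Rightarrow> ('a \<Rightarrow>\<^sub>0 'b) \<Rightarrow> 'a \<Rightarrow>\<^sub>0 'b"
  is "\<lambda>c f a. c *\<^sub>C f a"
  by (rule finite_subset[rotated]) auto
instance
  by standard (transfer; simp add: fun_eq_iff scaleC_add_right scaleC_add_left)+
end

lemma lookup_scaleC [simp]: "lookup (c *\<^sub>C f) a = c *\<^sub>C lookup f a"
  by transfer simp

instantiation fps :: (cvec) cvec
begin
definition scaleC_fps :: "complex \<Rightarrow> 'a fps \<Rightarrow> 'a fps" where
  "scaleC_fps c f = Abs_fps (\<lambda>k. c *\<^sub>C fps_nth f k)"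
instance
  by standard (simp_all add: scaleC_fps_def fps_eq_iff scaleC_add_right scaleC_add_left)
end

lemma fps_nth_scaleC [simp]: "fps_nth (c *\<^sub>C f) k = c *\<^sub>C fps_nth f k"
  by (simp add: scaleC_fps_def)

instance fps :: (calg) calg
  by standard (simp_all add: fps_eq_iff fps_mult_nth scaleC_sum_right)

definition clinear :: "('a::cvec \<Rightarrow> 'b::cvec) \<Rightarrow> bool" where
  "clinear f \<longleftrightarrow> (\<forall>x y. f (x + y) = f x + f y) \<and> (\<forall>c x. f (c *\<^sub>C x) = c *\<^sub>C f x)"

lemma clinearI [intro?]:
  "(\<And>x y. f (x + y) = f x + f y) \<Longrightarrow> (\<And>c x. f (c *\<^sub>C x) = c *\<^sub>C f x) \<Longrightarrow> clinear f"
  by (simp add: clinear_def)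

context
  fixes f :: "'a::cvec \<Rightarrow> 'b::cvec"
  assumes f: "clinear f"
begin

lemma clinear_add: "f (x + y) = f x + f y"
  using f by (simp add: clinear_def)

lemma clinear_scaleC: "f (c *\<^sub>C x) = c *\<^sub>C f x"
  using f by (simp add: clinear_def)

lemma clinear_zero: "f 0 = 0"
  using clinear_scaleC[of 0 0] by simp

lemma clinear_minus: "f (- x) = - f x"
  using clinear_scaleC[of "-1" x] by simp

lemma clinear_diff: "f (x - y) = f x - f y"
  using clinear_add[of x "- y"] by (simp add: clinear_minus)

lemma clinear_sum: "f (sum g A) = (\<Sum>a\<in>A. f (g a))"
  by (induction A rule: infinite_finite_induct) (simp_all add: clinear_zero clinear_add)

end

lemmas clinear_simps = clinear_add clinear_scaleC clinear_zero clinear_minus clinear_diff clinear_sum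

abbreviation basis_vec :: "'b \<Rightarrow> 'b \<Rightarrow>\<^sub>0 complex" where
  "basis_vec b \<equiv> Poly_Mapping.single b 1"

definition lin_ext :: "('b \<Rightarrow> 'v) \<Rightarrow> ('b \<Rightarrow>\<^sub>0 complex) \<Rightarrow> 'v::cvec" where
  "lin_ext \<phi> x = (\<Sum>b\<in>keys x. lookup x b *\<^sub>C \<phi> b)"

lemma lin_ext_superset:
  assumes "finite S" "keys x \<subseteq> S"
  shows "lin_ext \<phi> x = (\<Sum>b\<in>S. lookup x b *\<^sub>C \<phi> b)"
  unfolding lin_ext_def
  by (rule sum.mono_neutral_left) (use assms in \<open>auto simp: in_keys_iff\<close>)

lemma clinear_lin_ext: "clinear (lin_ext (\<phi> :: 'b \<Rightarrow> 'v::cvec))"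
proof
  fix x y :: "'b \<Rightarrow>\<^sub>0 complex" and c
  let ?S = "keys x \<union> keys y"
  have "keys (x + y) \<subseteq> ?S" by (rule Poly_Mapping.keys_add)
  then show "lin_ext \<phi> (x + y) = lin_ext \<phi> x + lin_ext \<phi> y"
    by (simp add: lin_ext_superset[of ?S] lookup_add scaleC_add_left sum.distrib)
  have "keys (c *\<^sub>C x) \<subseteq> keys x" by (auto simp: in_keys_iff)
  then show "lin_ext \<phi> (c *\<^sub>C x) = c *\<^sub>C lin_ext \<phi> x"
    by (simp add: lin_ext_superset[of "keys x"] scaleC_sum_right)
qed

lemma lin_ext_basis [simp]: "lin_ext \<phi> (basis_vec b) = \<phi> b"
  by (simp add: lin_ext_def)

lemma basis_expansion:
  "(\<Sum>b\<in>keys x. lookup x b *\<^sub>C basis_vec b) = x"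
  by (rule poly_mapping_eqI)
     (auto simp: lookup_sum lookup_single when_def in_keys_iff sum.delta' if_distrib
      cong: if_cong)

lemma clinear_expand:
  assumes "clinear f"
  shows "f x = (\<Sum>b\<in>keys x. lookup x b *\<^sub>C f (basis_vec b))"
  by (subst basis_expansion[of x, symmetric]) (simp add: clinear_simps[OF assms])

lemma clinear_eq_on_basis:
  assumes "clinear f" "clinear g" "\<And>b. b \<in> keys x \<Longrightarrow> f (basis_vec b) = g (basis_vec b)"
  shows "f x = g x"
  unfolding clinear_expand[OF assms(1), of x] clinear_expand[OF assms(2), of x]
  by (rule sum.cong) (simp_all add: assms(3))

lemma keys_add_subset:
  "keys x \<subseteq> S \<Longrightarrow> keys y \<subseteq> S \<Longrightarrow> keys (x + y) \<subseteq> S"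
  using Poly_Mapping.keys_add[of x y] by blast

lemma keys_sum_subset:
  "(\<And>a. a \<in> A \<Longrightarrow> keys (f a) \<subseteq> S) \<Longrightarrow> keys (sum f A) \<subseteq> S"
  by (induction A rule: infinite_finite_induct) (simp_all add: keys_add_subset)

lemma clinear_keys:
  assumes "clinear f" "\<And>b. b \<in> keys x \<Longrightarrow> keys (f (basis_vec b)) \<subseteq> S"
  shows "keys (f x :: 'c \<Rightarrow>\<^sub>0 complex) \<subseteq> S"
proof -
  have "keys (lookup x b *\<^sub>C f (basis_vec b)) \<subseteq> S"
    if "b \<in> keys x" for b
    using assms(2)[OF that] by (auto simp: in_keys_iff)
  then show ?thesis by (subst clinear_expand[OF assms(1)]) (rule keys_sum_subset)
qed

text \<open>
  Endomorphisms form a type of their own so that power series over them are a ring.  A power series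
  \<open>\<Sum>\<^sub>k T\<^sub>k t\<^sup>k\<close> in this ring is a \<open>t\<close>-linear operator on power series with coefficients in the
  vector space.
\<close>

typedef 'b endo = "{f :: ('b \<Rightarrow>\<^sub>0 complex) \<Rightarrow> ('b \<Rightarrow>\<^sub>0 complex). clinear f}"
  morphisms app Endo
  by (rule exI[of _ id]) (simp add: clinear_def)

setup_lifting type_definition_endo

lemma clinear_app: "clinear (app T)"
  using app by auto

lemmas app_simps [simp] = clinear_simps[OF clinear_app]

lemma app_Endo [simp]: "clinear f \<Longrightarrow> app (Endo f) = f"
  by (simp add: Endo_inverse)

lemma endo_eqI: "(\<And>x. app S x = app T x) \<Longrightarrow> S = T"
  by (metis app_inject ext)

instantiation endo :: (type) calg
begin
lift_definition zero_endo :: "'a endo" is "\<lambda>x. 0" by (simp add: clinear_def)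
lift_definition one_endo :: "'a endo" is "\<lambda>x. x" by (simp add: clinear_def)
lift_definition plus_endo :: "'a endo \<Rightarrow> 'a endo \<Rightarrow> 'a endo" is "\<lambda>f g x. f x + g x"
  by (simp add: clinear_def scaleC_add_right)
lift_definition uminus_endo :: "'a endo \<Rightarrow> 'a endo" is "\<lambda>f x. - f x"
  by (simp add: clinear_def)
lift_definition minus_endo :: "'a endo \<Rightarrow> 'a endo \<Rightarrow> 'a endo" is "\<lambda>f g x. f x - g x"
  by (simp add: clinear_def scaleC_diff_right)
lift_definition times_endo :: "'a endo \<Rightarrow> 'a endo \<Rightarrow> 'a endo" is "\<lambda>f g x. f (g x)"
  by (simp add: clinear_def)
lift_definition scaleC_endo :: "complex \<Rightarrow> 'a endo \<Rightarrow> 'a endo" is "\<lambda>c f x. c *\<^sub>C f x"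
  by (simp add: clinear_def scaleC_add_right mult.commute)
instance
proof
  show "(0::'a endo) \<noteq> 1"
    by transfer (metis single_one single_zero zero_neq_one lookup_single_eq lookup_zero)
qed (transfer; simp add: fun_eq_iff clinear_def scaleC_add_right scaleC_add_left algebra_simps)+
end


section \<open>Quantum monomials\<close>

text \<open>
  Group elements have degree 0.  Upper bounds on degrees suffice everywhere: a bound that becomes
  negative forces an element to vanish, and this is the source of all finiteness statements.
\<close>

definition degree_le :: "int \<Rightarrow> (nat multiset \<times> 'z \<Rightarrow>\<^sub>0 complex) set" where
  "degree_le N = {x. \<forall>b\<in>keys x. int (size (fst b)) \<le> N}"

lemma degree_le_zero [simp]: "0 \<in> degree_le N"
  by (simp add: degree_le_def)

lemma degree_le_add: "x \<in> degree_le N \<Longrightarrow> y \<in> degree_le N \<Longrightarrow> x + y \<in> degree_le N"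
  using Poly_Mapping.keys_add[of x y] by (fastforce simp: degree_le_def)

lemma degree_le_scaleC: "x \<in> degree_le N \<Longrightarrow> c *\<^sub>C x \<in> degree_le N"
  by (auto simp: degree_le_def in_keys_iff)

lemma degree_le_minus: "x \<in> degree_le N \<Longrightarrow> - x \<in> degree_le N"
  using degree_le_scaleC[of x N "-1"] by simp

lemma degree_le_diff: "x \<in> degree_le N \<Longrightarrow> y \<in> degree_le N \<Longrightarrow> x - y \<in> degree_le N"
  using degree_le_add[of x N "- y"] degree_le_minus[of y N] by simp

lemma degree_le_sum: "(\<And>a. a \<in> A \<Longrightarrow> f a \<in> degree_le N) \<Longrightarrow> sum f A \<in> degree_le N"
  by (induction A rule: infinite_finite_induct) (auto intro: degree_le_add)

lemma degree_le_basis [simp]: "basis_vec b \<in> degree_le N \<longleftrightarrow> int (size (fst b)) \<le> N"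
  by (simp add: degree_le_def)

lemma degree_le_mono: "x \<in> degree_le N \<Longrightarrow> N \<le> M \<Longrightarrow> x \<in> degree_le M"
  by (force simp: degree_le_def)

lemma degree_le_negative: "x \<in> degree_le N \<Longrightarrow> N < 0 \<Longrightarrow> x = 0"
  by (rule poly_mapping_eqI) (force simp: degree_le_def in_keys_iff)

lemma degree_le_ex: "\<exists>N. x \<in> degree_le N"
proof
  show "x \<in> degree_le (Max ((\<lambda>b. int (size (fst b))) ` keys x))"
    by (simp add: degree_le_def)
qed

definition raises_degree :: "int \<Rightarrow> (nat multiset \<times> 'z) endo \<Rightarrow> bool" where
  "raises_degree d T \<longleftrightarrow> (\<forall>N. \<forall>x\<in>degree_le N. app T x \<in> degree_le (N + d))"

lemma raises_degreeD: "raises_degree d T \<Longrightarrow> x \<in> degree_le N \<Longrightarrow> app T x \<in> degree_le (N + d)"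
  by (simp add: raises_degree_def)

lemma raises_degree_basis:
  fixes T :: "(nat multiset \<times> 'z) endo"
  assumes "\<And>b. app T (basis_vec b) \<in> degree_le (int (size (fst b)) + d)"
  shows "raises_degree d T"
  unfolding raises_degree_def
proof (intro allI ballI)
  fix N and x :: "nat multiset \<times> 'z \<Rightarrow>\<^sub>0 complex"
  assume "x \<in> degree_le N"
  then have "app T (basis_vec b) \<in> degree_le (N + d)" if "b \<in> keys x" for b
    using that by (intro degree_le_mono[OF assms]) (auto simp: degree_le_def)
  then show "app T x \<in> degree_le (N + d)"
    by (subst clinear_expand[OF clinear_app]) (auto intro!: degree_le_sum degree_le_scaleC)
qed

lemma app_endo_simps [simp]:
  "app (S + T) x = app S x + app T x" "app (S - T) x = app S x - app T x" "app (- S) x = - app S x"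
  "app (S * T) x = app S (app T x)" "app (c *\<^sub>C S) x = c *\<^sub>C app S x" "app 1 x = x" "app 0 x = 0"
  by (transfer; simp)+

lemma app_endo_sum [simp]: "app (sum S A) x = (\<Sum>a\<in>A. app (S a) x)"
  by (induction A rule: infinite_finite_induct) simp_all

lemma raises_degree_mult:
  "raises_degree d S \<Longrightarrow> raises_degree e T \<Longrightarrow> raises_degree (d + e) (S * T)"
  by (fastforce simp: raises_degree_def algebra_simps)

lemma raises_degree_add:
  "raises_degree d S \<Longrightarrow> raises_degree d T \<Longrightarrow> raises_degree d (S + T)"
  by (auto simp: raises_degree_def intro!: degree_le_add)

lemma raises_degree_scaleC: "raises_degree d S \<Longrightarrow> raises_degree d (c *\<^sub>C S)"
  by (auto simp: raises_degree_def intro!: degree_le_scaleC)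

lemma raises_degree_zero [simp]: "raises_degree d 0"
  by (auto simp: raises_degree_def)

lemma raises_degree_diff:
  "raises_degree d S \<Longrightarrow> raises_degree d T \<Longrightarrow> raises_degree d (S - T)"
  by (auto simp: raises_degree_def intro!: degree_le_diff)

lemma raises_degree_sum:
  "(\<And>a. a \<in> A \<Longrightarrow> raises_degree d (f a)) \<Longrightarrow> raises_degree d (sum f A)"
  by (induction A rule: infinite_finite_induct) (auto intro: raises_degree_add)

lemma raises_degree_mono: "raises_degree d S \<Longrightarrow> d \<le> e \<Longrightarrow> raises_degree e S"
  unfolding raises_degree_def by (meson add_left_mono degree_le_mono)

text \<open>The scalar acquired when \<open>v\<^sub>i\<close> is moved into its place in a sorted monomial.\<close>

definition move_coeff :: "(nat \<Rightarrow> nat \<Rightarrow> complex) \<Rightarrow> nat \<Rightarrow> nat multiset \<Rightarrow> complex" where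
  "move_coeff q i A = (\<Prod>j\<in>#A. if j < i then q i j else 1)"

lemma move_coeff_empty [simp]: "move_coeff q i {#} = 1"
  by (simp add: move_coeff_def)

lemma move_coeff_add_mset [simp]:
  "move_coeff q i (add_mset j A) = (if j < i then q i j else 1) * move_coeff q i A"
  by (simp add: move_coeff_def)

lemma move_coeff_le: "(\<And>j. j \<in># A \<Longrightarrow> i \<le> j) \<Longrightarrow> move_coeff q i A = 1"
proof (induction A)
  case (add j A)
  then have "i \<le> j" "move_coeff q i A = 1" by auto
  then show ?case by simp
qed simp

lemma multiset_min_cases:
  fixes A :: "nat multiset"
  obtains (empty) "A = {#}"
  | (add) i A' where "A = add_mset i A'" "\<And>j. j \<in># A' \<Longrightarrow> i \<le> j"
proof (cases "A = {#}")
  case False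
  then have "Min_mset A \<in># A" by simp
  then obtain A' where A': "A = add_mset (Min_mset A) A'" by (meson multi_member_split)
  have "j \<in># A" if "j \<in># A'" for j
    using that A' by (metis insert_iff set_mset_add_mset_insert)
  then have "Min_mset A \<le> j" if "j \<in># A'" for j
    using that by simp
  with A' show ?thesis by (rule add)
qed

locale quantum_coefficients =
  fixes I :: "nat set" and q :: "nat \<Rightarrow> nat \<Rightarrow> complex"
  assumes finite_I [simp]: "finite I"
    and q_nonzero: "i \<in> I \<Longrightarrow> j \<in> I \<Longrightarrow> q i j \<noteq> 0"
    and q_diag [simp]: "i \<in> I \<Longrightarrow> q i i = 1"
    and q_inverse: "i \<in> I \<Longrightarrow> j \<in> I \<Longrightarrow> q j i = inverse (q i j)"
begin

lemma q_cancel: "i \<in> I \<Longrightarrow> j \<in> I \<Longrightarrow> q i j * q j i = 1"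
  by (metis q_inverse q_nonzero right_inverse)

end

text \<open>
  The operators of left multiplication by \<open>v\<^sub>i\<close> on the space with basis \<open>v\<^sub>A z\<close>, where \<open>z\<close> is a label that they
  do not touch.  As the admissible indices do not form a type, all operators act on a larger space
  and vanish on the superfluous basis vectors.
\<close>

locale quantum_operators = quantum_coefficients +
  fixes Z :: "'z set" and V :: "nat \<Rightarrow> (nat multiset \<times> 'z) endo"
  assumes V_basis: "i \<in> I \<Longrightarrow> set_mset A \<subseteq> I \<Longrightarrow> z \<in> Z \<Longrightarrow>
      app (V i) (basis_vec (A, z)) = move_coeff q i A *\<^sub>C basis_vec (add_mset i A, z)"
    and V_outside: "b \<notin> {A. set_mset A \<subseteq> I} \<times> Z \<Longrightarrow> app (V i) (basis_vec b) = 0"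
begin

abbreviation Basis :: "(nat multiset \<times> 'z) set" where
  "Basis \<equiv> {A. set_mset A \<subseteq> I} \<times> Z"

lemma V_basis_min:
  assumes "i \<in> I" "set_mset A \<subseteq> I" "z \<in> Z" "\<And>j. j \<in># A \<Longrightarrow> i \<le> j"
  shows "basis_vec (add_mset i A, z) = app (V i) (basis_vec (A, z))"
  using assms V_basis by (simp add: move_coeff_le)

lemma V_degree: "i \<in> I \<Longrightarrow> raises_degree 1 (V i)"
proof (rule raises_degree_basis)
  fix b assume "i \<in> I"
  then show "app (V i) (basis_vec b) \<in> degree_le (int (size (fst b)) + 1)"
    by (cases "b \<in> Basis") (auto simp: V_basis V_outside intro!: degree_le_scaleC)
qed

lemma V_commute:
  assumes "i \<in> I" "j \<in> I"
  shows "V i * V j = q i j *\<^sub>C (V j * V i)"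
proof (rule endo_eqI, rule clinear_eq_on_basis[OF clinear_app clinear_app])
  fix b
  have "(if j < i then q i j else 1) = q i j * (if i < j then q j i else 1)"
    using assms q_cancel[of i j] by (cases i j rule: linorder_cases) auto
  then show "app (V i * V j) (basis_vec b) = app (q i j *\<^sub>C (V j * V i)) (basis_vec b)"
    using assms
    by (cases "b \<in> Basis") (auto simp: V_basis V_outside add_mset_commute algebra_simps)
qed

end

text \<open>
  The values forced by \<open>V\<^sub>i \<Lambda>\<^sub>j + \<Lambda>\<^sub>i V\<^sub>j - q\<^sub>i\<^sub>j (V\<^sub>j \<Lambda>\<^sub>i + \<Lambda>\<^sub>j V\<^sub>i) = F\<^sub>i\<^sub>j\<close> once \<open>\<Lambda>\<^sub>i\<close> is chosen to be 0 on those
  sorted monomials that stay sorted when \<open>v\<^sub>i\<close> is put in front: if \<open>j < i\<close> is at most every letter of a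
  word \<open>w\<close>, then \<open>\<Lambda>\<^sub>j w\<close> and \<open>\<Lambda>\<^sub>j (v\<^sub>i w)\<close> vanish and the equation at \<open>w\<close> determines \<open>\<Lambda>\<^sub>i (v\<^sub>j w)\<close>.
\<close>

primrec commutation_solution ::
  "(nat \<Rightarrow> nat \<Rightarrow> complex) \<Rightarrow> (nat \<Rightarrow> (nat multiset \<times> 'z) endo) \<Rightarrow>
    (nat \<Rightarrow> nat \<Rightarrow> (nat multiset \<times> 'z) endo) \<Rightarrow> nat \<Rightarrow> 'z \<Rightarrow> nat list \<Rightarrow>
    nat multiset \<times> 'z \<Rightarrow>\<^sub>0 complex" where
  "commutation_solution q V F i z [] = 0"
| "commutation_solution q V F i z (j # js) =
    (if i \<le> j then 0
     else q i j *\<^sub>C app (V j) (commutation_solution q V F i z js) + app (F i j) (basis_vec (mset js, z)))"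

context quantum_operators
begin

lemma commutation_solution_degree:
  assumes "set js \<subseteq> I" "i \<in> I"
    and "\<And>i j. i \<in> I \<Longrightarrow> j \<in> I \<Longrightarrow> raises_degree (d + 1) (F i j)"
  shows "commutation_solution q V F i z js \<in> degree_le (int (length js) + d)"
  using assms(1)
proof (induction js)
  case (Cons j js)
  have "app (V j) (commutation_solution q V F i z js) \<in> degree_le (int (length js) + d + 1)"
    using Cons V_degree raises_degreeD by fastforce
  moreover have "app (F i j) (basis_vec (mset js, z)) \<in> degree_le (int (length js) + (d + 1))"
    by (rule raises_degreeD[OF assms(3)]) (use Cons.prems assms(2) in auto)
  ultimately show ?case
    using Cons.prems by (auto intro!: degree_le_add degree_le_scaleC simp: algebra_simps)
qed simp

text \<open>
  Exactness of the Koszul complex in the degree that matters.  Only the monomials \<open>v\<^sub>l w\<close> with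
  \<open>l < j < i\<close> are not covered by the recursion; there the equation reduces, by the Jacobi identity for
  \<open>F\<close>, to \<open>v\<^sub>l\<close> times the equation at the shorter monomial \<open>w\<close>.
\<close>

lemma solve_commutation:
  fixes F :: "nat \<Rightarrow> nat \<Rightarrow> (nat multiset \<times> 'z) endo"
  assumes F_degree: "\<And>i j. i \<in> I \<Longrightarrow> j \<in> I \<Longrightarrow> raises_degree (d + 1) (F i j)"
    and jacobi: "\<And>i j l b. i \<in> I \<Longrightarrow> j \<in> I \<Longrightarrow> l \<in> I \<Longrightarrow> l < j \<Longrightarrow> j < i \<Longrightarrow> b \<in> Basis \<Longrightarrow>
      app (F i j * V l - (q i l * q j l) *\<^sub>C (V l * F i j) - V i * F j l + q i j *\<^sub>C (V j * F i l)
        - q j l *\<^sub>C (F i l * V j) + (q i j * q i l) *\<^sub>C (F j l * V i)) (basis_vec b) = 0"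
  obtains \<Lambda> where "\<And>i. i \<in> I \<Longrightarrow> raises_degree d (\<Lambda> i)"
    and "\<And>i b. b \<notin> Basis \<Longrightarrow> app (\<Lambda> i) (basis_vec b) = 0"
    and "\<And>i j b. i \<in> I \<Longrightarrow> j \<in> I \<Longrightarrow> j < i \<Longrightarrow> b \<in> Basis \<Longrightarrow>
      app (V i * \<Lambda> j + \<Lambda> i * V j - q i j *\<^sub>C (V j * \<Lambda> i + \<Lambda> j * V i)) (basis_vec b)
        = app (F i j) (basis_vec b)"
proof
  define \<phi> where "\<phi> i b = (if b \<in> Basis
      then commutation_solution q V F i (snd b) (sorted_list_of_multiset (fst b)) else 0)" for i b
  define \<Lambda> where "\<Lambda> i = Endo (lin_ext (\<phi> i))" for i
  have \<Lambda>: "app (\<Lambda> i) (basis_vec b) = \<phi> i b" for i b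
    by (simp add: \<Lambda>_def clinear_lin_ext)
  show "app (\<Lambda> i) (basis_vec b) = 0" if "b \<notin> Basis" for i b
    using that by (auto simp: \<Lambda> \<phi>_def)
  show "raises_degree d (\<Lambda> i)" if "i \<in> I" for i
  proof (rule raises_degree_basis)
    fix b :: "nat multiset \<times> 'z"
    have "length (sorted_list_of_multiset (fst b)) = size (fst b)"
      by (metis mset_sorted_list_of_multiset size_mset)
    then show "app (\<Lambda> i) (basis_vec b) \<in> degree_le (int (size (fst b)) + d)"
      using commutation_solution_degree[of "sorted_list_of_multiset (fst b)" i d F "snd b", OF _ that F_degree]
      by (auto simp: \<Lambda> \<phi>_def)
  qed
  have small: "app (\<Lambda> i) (basis_vec (A, z)) = 0" if "\<And>j. j \<in># A \<Longrightarrow> i \<le> j" for i A z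
  proof (cases A rule: multiset_min_cases)
    case empty
    then show ?thesis by (simp add: \<Lambda> \<phi>_def)
  next
    case (add k A')
    then show ?thesis using that by (simp add: \<Lambda> \<phi>_def insort_is_Cons)
  qed
  have step: "app (\<Lambda> i) (app (V k) (basis_vec (A, z)))
      = q i k *\<^sub>C app (V k) (app (\<Lambda> i) (basis_vec (A, z))) + app (F i k) (basis_vec (A, z))"
    if "k < i" "k \<in> I" "set_mset A \<subseteq> I" "z \<in> Z" "\<And>j. j \<in># A \<Longrightarrow> k \<le> j" for i k A z
    using that
    by (subst V_basis_min[symmetric]) (auto simp: \<Lambda> \<phi>_def insort_is_Cons)
  have main: "app (V i) (app (\<Lambda> j) (basis_vec (A, z))) + app (\<Lambda> i) (app (V j) (basis_vec (A, z)))
        - q i j *\<^sub>C (app (V j) (app (\<Lambda> i) (basis_vec (A, z))) + app (\<Lambda> j) (app (V i) (basis_vec (A, z))))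
        = app (F i j) (basis_vec (A, z))"
    if ij: "i \<in> I" "j \<in> I" "j < i" and z: "z \<in> Z" and A: "set_mset A \<subseteq> I" for i j A z
    using A
  proof (induction "size A" arbitrary: A rule: less_induct)
    case less
    show ?case
    proof (cases "\<forall>k. k \<in># A \<longrightarrow> j \<le> k")
      case True
      have "app (\<Lambda> j) (basis_vec (add_mset i A, z)) = 0"
        by (rule small) (use True ij in auto)
      then have "app (\<Lambda> j) (app (V i) (basis_vec (A, z))) = 0"
        using ij z less.prems by (simp add: V_basis)
      then show ?thesis using True ij z less.prems by (simp add: step small)
    next
      case False
      then obtain k A' where A': "A = add_mset k A'" and k: "\<And>l. l \<in># A' \<Longrightarrow> k \<le> l"
        by (cases A rule: multiset_min_cases) auto
      have kj: "k < j" using False A' k by fastforce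
      have kI: "k \<in> I" and A'I: "set_mset A' \<subseteq> I" using less.prems A' by auto
      let ?b = "basis_vec (A', z)"
      have b: "basis_vec (A, z) = app (V k) ?b"
        unfolding A' by (rule V_basis_min) (use kI A'I z k in auto)
      have IH: "app (V i) (app (\<Lambda> j) ?b) = app (F i j) ?b - app (\<Lambda> i) (app (V j) ?b)
        + q i j *\<^sub>C (app (V j) (app (\<Lambda> i) ?b) + app (\<Lambda> j) (app (V i) ?b))"
        using less.hyps[of A'] A' A'I by (simp add: algebra_simps)
      have sw: "app (V p) (app (V k) x) = q p k *\<^sub>C app (V k) (app (V p) x)"
        if "p \<in> I" for p x
        using V_commute[OF that kI] by (metis app_endo_simps(4,5))
      have st: "app (\<Lambda> p) (app (V k) ?b) = q p k *\<^sub>C app (V k) (app (\<Lambda> p) ?b) + app (F p k) ?b"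
        if "k < p" for p
        by (rule step) (use that kI A'I z k in auto)
      (* v_r b need not be a basis vector, but it is a multiple of one whose smallest letter exceeds k *)
      have st2: "app (\<Lambda> p) (app (V k) (app (V r) ?b))
          = q p k *\<^sub>C app (V k) (app (\<Lambda> p) (app (V r) ?b)) + app (F p k) (app (V r) ?b)"
        if "k < p" "k < r" "r \<in> I" for p r
      proof -
        have "app (\<Lambda> p) (app (V k) (basis_vec (add_mset r A', z)))
            = q p k *\<^sub>C app (V k) (app (\<Lambda> p) (basis_vec (add_mset r A', z)))
              + app (F p k) (basis_vec (add_mset r A', z))"
          by (rule step) (use that kI A'I z k in \<open>auto simp: less_imp_le\<close>)
        then show ?thesis
          using that A'I z by (simp add: V_basis[of r A' z] scaleC_algebra)
      qed
      have IH': "app (V k) (app (V i) (app (\<Lambda> j) ?b)) = app (V k) (app (F i j) ?b)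
        - app (V k) (app (\<Lambda> i) (app (V j) ?b)) + q i j *\<^sub>C (app (V k) (app (V j) (app (\<Lambda> i) ?b))
        + app (V k) (app (\<Lambda> j) (app (V i) ?b)))"
        unfolding IH by (simp add: scaleC_algebra)
      have "app (F i j) (app (V k) ?b) = (q i k * q j k) *\<^sub>C app (V k) (app (F i j) ?b)
        + app (V i) (app (F j k) ?b) - q i j *\<^sub>C app (V j) (app (F i k) ?b)
        + q j k *\<^sub>C app (F i k) (app (V j) ?b) - (q i j * q i k) *\<^sub>C app (F j k) (app (V i) ?b)"
        using jacobi[of i j k "(A', z)"] ij kI kj A'I z by (simp add: algebra_simps)
      then show ?thesis
        unfolding b using ij kj kI
        by (simp add: st sw[of i ?b] sw[of j ?b] st2 sw[of i "app (\<Lambda> j) ?b"] sw[of j "app (\<Lambda> i) ?b"]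
            IH' scaleC_algebra)
    qed
  qed
  show "app (V i * \<Lambda> j + \<Lambda> i * V j - q i j *\<^sub>C (V j * \<Lambda> i + \<Lambda> j * V i)) (basis_vec b)
        = app (F i j) (basis_vec b)"
    if "i \<in> I" "j \<in> I" "j < i" "b \<in> Basis" for i j b
    using main[of i j "snd b" "fst b"] that by auto
qed

end


section \<open>Operators that are equivariant under the group\<close>

text \<open>
  \<open>a h i j\<close> are the matrix coefficients of \<open>h\<close> on the span of the generators.  \<open>H \<one>\<close> is the projection
  onto the span of the admissible basis vectors, and \<open>V\<close> and \<open>H\<close> lie in the corner ring that has it as
  its unit.
\<close>

locale equivariant_operators = quantum_operators I q "carrier G" V + group G
  for I q and G :: "('g, 'm) monoid_scheme" (structure) and V +
  fixes H :: "'g \<Rightarrow> (nat multiset \<times> 'g) endo" and a :: "'g \<Rightarrow> nat \<Rightarrow> nat \<Rightarrow> complex"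
  assumes finite_G [simp]: "finite (carrier G)"
    and H_group: "h \<in> carrier G \<Longrightarrow> g \<in> carrier G \<Longrightarrow>
      app (H h) (basis_vec ({#}, g)) = basis_vec ({#}, h \<otimes> g)"
    and H_mult: "h \<in> carrier G \<Longrightarrow> k \<in> carrier G \<Longrightarrow> H h * H k = H (h \<otimes> k)"
    and H_V: "h \<in> carrier G \<Longrightarrow> i \<in> I \<Longrightarrow> H h * V i = (\<Sum>j\<in>I. a h i j *\<^sub>C (V j * H h))"
    and H_one: "b \<in> Basis \<Longrightarrow> app (H \<one>) (basis_vec b) = basis_vec b"
    and H_one_outside: "b \<notin> Basis \<Longrightarrow> app (H \<one>) (basis_vec b) = 0"
begin

lemma H_outside: "h \<in> carrier G \<Longrightarrow> b \<notin> Basis \<Longrightarrow> app (H h) (basis_vec b) = 0"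
  using H_mult[of h \<one>] H_one_outside[of b] app_endo_simps(4)[of "H h" "H \<one>" "basis_vec b"] by simp

lemma V_H_one [simp]: "V i * H \<one> = V i"
  by (rule endo_eqI, rule clinear_eq_on_basis[OF clinear_app clinear_app])
    (metis H_one H_one_outside V_outside app_endo_simps(4) app_simps(3))

lemma H_one_V [simp]: "i \<in> I \<Longrightarrow> H \<one> * V i = V i"
proof (rule endo_eqI, rule clinear_eq_on_basis[OF clinear_app clinear_app])
  fix b assume "i \<in> I"
  then show "app (H \<one> * V i) (basis_vec b) = app (V i) (basis_vec b)"
    by (cases "b \<in> Basis") (auto simp: V_basis V_outside H_one)
qed

lemma lookup_V_sum:
  assumes "p \<in> I" "g \<in> carrier G"
  shows "lookup (\<Sum>j\<in>I. c j *\<^sub>C app (V j) (basis_vec ({#}, g))) ({#p#}, g) = c p"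
  using assms
  by (simp add: V_basis lookup_sum lookup_single when_def if_distrib sum.delta' cong: if_cong)

lemma a_mult:
  assumes h: "h \<in> carrier G" and k: "k \<in> carrier G" and i: "i \<in> I" and p: "p \<in> I"
  shows "a (h \<otimes> k) i p = (\<Sum>j\<in>I. a k i j * a h j p)"
proof -
  have "H (h \<otimes> k) * V i = H h * (H k * V i)"
    using h k by (simp add: H_mult mult.assoc[symmetric])
  also have "\<dots> = (\<Sum>j\<in>I. a k i j *\<^sub>C ((H h * V j) * H k))"
    by (simp add: H_V[OF k i] sum_distrib_left mult.assoc)
  also have "\<dots> = (\<Sum>j\<in>I. \<Sum>p\<in>I. (a k i j * a h j p) *\<^sub>C (V p * H (h \<otimes> k)))"
    using h k by (simp add: H_V H_mult sum_distrib_right scaleC_sum_right mult.assoc)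
  also have "\<dots> = (\<Sum>p\<in>I. (\<Sum>j\<in>I. a k i j * a h j p) *\<^sub>C (V p * H (h \<otimes> k)))"
    by (subst sum.swap) (simp add: scaleC_sum_left)
  finally have "(\<Sum>p\<in>I. a (h \<otimes> k) i p *\<^sub>C (V p * H (h \<otimes> k)))
      = (\<Sum>p\<in>I. (\<Sum>j\<in>I. a k i j * a h j p) *\<^sub>C (V p * H (h \<otimes> k)))"
    using h k i by (simp add: H_V)
  then have "app (\<Sum>p\<in>I. a (h \<otimes> k) i p *\<^sub>C (V p * H (h \<otimes> k))) (basis_vec ({#}, \<one>))
      = app (\<Sum>p\<in>I. (\<Sum>j\<in>I. a k i j * a h j p) *\<^sub>C (V p * H (h \<otimes> k))) (basis_vec ({#}, \<one>))"
    by simp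
  then have "(\<Sum>p\<in>I. a (h \<otimes> k) i p *\<^sub>C app (V p) (basis_vec ({#}, h \<otimes> k)))
      = (\<Sum>p\<in>I. (\<Sum>j\<in>I. a k i j * a h j p) *\<^sub>C app (V p) (basis_vec ({#}, h \<otimes> k)))"
    using h k by (simp add: H_group)
  then have "lookup (\<Sum>p\<in>I. a (h \<otimes> k) i p *\<^sub>C app (V p) (basis_vec ({#}, h \<otimes> k))) ({#p#}, h \<otimes> k)
      = lookup (\<Sum>p\<in>I. (\<Sum>j\<in>I. a k i j * a h j p) *\<^sub>C app (V p) (basis_vec ({#}, h \<otimes> k))) ({#p#}, h \<otimes> k)"
    by simp
  then show ?thesis
    using h k p by (simp only: lookup_V_sum m_closed)
qed

lemma a_one:
  assumes "i \<in> I" "p \<in> I"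
  shows "a \<one> i p = (if i = p then 1 else 0)"
proof -
  have "(\<Sum>j\<in>I. a \<one> i j *\<^sub>C V j) = V i"
    using H_V[of \<one> i] assms by simp
  then have "app (\<Sum>j\<in>I. a \<one> i j *\<^sub>C V j) (basis_vec ({#}, \<one>)) = app (V i) (basis_vec ({#}, \<one>))"
    by simp
  then have "(\<Sum>j\<in>I. a \<one> i j *\<^sub>C app (V j) (basis_vec ({#}, \<one>))) = app (V i) (basis_vec ({#}, \<one>))"
    by simp
  then have "a \<one> i p = lookup (app (V i) (basis_vec ({#}, \<one>))) ({#p#}, \<one>)"
    using lookup_V_sum[of p \<one> "a \<one> i"] assms by simp
  then show ?thesis using assms by (simp add: V_basis lookup_single when_def)
qed

lemma H_degree:
  assumes h: "h \<in> carrier G"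
  shows "raises_degree 0 (H h)"
proof (rule raises_degree_basis)
  fix b :: "nat multiset \<times> 'g"
  show "app (H h) (basis_vec b) \<in> degree_le (int (size (fst b)) + 0)"
  proof (cases "b \<in> Basis")
    case False
    then show ?thesis using H_outside h by simp
  next
    case True
    have "app (H h) (basis_vec (A, g)) \<in> degree_le (int (size A))"
      if "set_mset A \<subseteq> I" "g \<in> carrier G" for A g
      using that(1)
    proof (induction "size A" arbitrary: A)
      case 0
      then show ?case using h that by (simp add: H_group)
    next
      case (Suc m)
      then obtain i A' where A': "A = add_mset i A'" "\<And>j. j \<in># A' \<Longrightarrow> i \<le> j"
        by (cases A rule: multiset_min_cases) auto
      have "app (H h) (basis_vec (A, g)) = app (H h * V i) (basis_vec (A', g))"
        using Suc.prems that(2) A' by (simp add: V_basis_min)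
      also have "\<dots> = (\<Sum>j\<in>I. a h i j *\<^sub>C app (V j) (app (H h) (basis_vec (A', g))))"
        using Suc.prems A' h by (simp add: H_V)
      also have "\<dots> \<in> degree_le (int (size A') + 1)"
        using Suc A' V_degree by (auto intro!: degree_le_sum degree_le_scaleC raises_degreeD)
      finally show ?case using A' by (simp add: algebra_simps)
    qed
    then show ?thesis using True by auto
  qed
qed

text \<open>
  The coefficient of \<open>v\<^sub>p v\<^sub>l\<close> in \<open>\<^sup>hv\<^sub>i \<^sup>hv\<^sub>j - q\<^sub>i\<^sub>j \<^sup>hv\<^sub>j \<^sup>hv\<^sub>i\<close>.
\<close>

definition quantum_minor :: "'g \<Rightarrow> nat \<Rightarrow> nat \<Rightarrow> nat \<Rightarrow> nat \<Rightarrow> complex" where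
  "quantum_minor h i j p l = a h i p * a h j l - q i j * a h j p * a h i l"

lemma equivariant_product:
  fixes X Y :: "nat \<Rightarrow> 'a::calg"
  assumes X: "\<And>i. i \<in> I \<Longrightarrow> Hh * X i = (\<Sum>j\<in>I. a h i j *\<^sub>C (X j * Hh))"
    and Y: "\<And>i. i \<in> I \<Longrightarrow> Hh * Y i = (\<Sum>j\<in>I. a h i j *\<^sub>C (Y j * Hh))"
    and "i \<in> I" "j \<in> I"
  shows "Hh * (X i * Y j) = (\<Sum>p\<in>I. \<Sum>l\<in>I. (a h i p * a h j l) *\<^sub>C (X p * Y l * Hh))"
proof -
  have "Hh * (X i * Y j) = (\<Sum>p\<in>I. a h i p *\<^sub>C (X p * (Hh * Y j)))"
    by (simp add: mult.assoc[symmetric] sum_distrib_right X[OF assms(3)])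
  then show ?thesis
    using assms by (simp add: mult.assoc sum_distrib_left scaleC_sum_right)
qed

lemma equivariant_commutator:
  fixes X :: "nat \<Rightarrow> 'a::calg"
  assumes "\<And>i. i \<in> I \<Longrightarrow> Hh * X i = (\<Sum>j\<in>I. a h i j *\<^sub>C (X j * Hh))"
    and "i \<in> I" "j \<in> I"
  shows "Hh * (X i * X j - q i j *\<^sub>C (X j * X i))
    = (\<Sum>p\<in>I. \<Sum>l\<in>I. quantum_minor h i j p l *\<^sub>C (X p * X l * Hh))"
  using assms
  by (simp add: right_diff_distrib equivariant_product[OF assms(1,1)] scaleC_sum_right
      quantum_minor_def scaleC_diff_left sum_subtractf algebra_simps)

text \<open>
  The expression just described is zero in \<open>S\<^sub>q(V)\<close> because \<open>h\<close> acts by algebra automorphisms; comparing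
  the coefficients of the monomial \<open>{#p, l#}\<close> gives the symmetry.
\<close>

lemma quantum_minor_swap:
  assumes h: "h \<in> carrier G" and ij: "i \<in> I" "j \<in> I" and pl: "p \<in> I" "l \<in> I"
  shows "quantum_minor h i j l p = - q p l * quantum_minor h i j p l"
proof -
  let ?D = "quantum_minor h i j"
  have "(\<Sum>p\<in>I. \<Sum>l\<in>I. ?D p l *\<^sub>C (V p * V l * H h)) = H h * (V i * V j - q i j *\<^sub>C (V j * V i))"
    by (rule equivariant_commutator[OF H_V, symmetric]) (use h ij in auto)
  also have "\<dots> = 0" using V_commute[OF ij] by simp
  finally have VV: "app (\<Sum>p\<in>I. \<Sum>l\<in>I. ?D p l *\<^sub>C (V p * V l * H h)) (basis_vec ({#}, \<one>)) = 0"
    by simp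
  have 0: "(\<Sum>r\<in>I \<times> I. (?D (fst r) (snd r) * (if snd r < fst r then q (fst r) (snd r) else 1))
      *\<^sub>C basis_vec ({#fst r, snd r#}, h)) = 0"
  proof -
    have "app (V p) (app (V l) (basis_vec ({#}, h)))
        = (if l < p then q p l else 1) *\<^sub>C basis_vec ({#p, l#}, h)" if "p \<in> I" "l \<in> I" for p l
      using that h by (simp add: V_basis)
    then have "(\<Sum>p\<in>I. \<Sum>l\<in>I. (?D p l * (if l < p then q p l else 1)) *\<^sub>C basis_vec ({#p, l#}, h))
        = (\<Sum>p\<in>I. \<Sum>l\<in>I. ?D p l *\<^sub>C app (V p) (app (V l) (basis_vec ({#}, h))))"
      by (intro sum.cong refl) simp
    also have "\<dots> = 0"
      using VV h by (simp add: H_group)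
    finally show ?thesis by (simp add: sum.cartesian_product split_def)
  qed
  define e where "e r = ?D (fst r) (snd r) * (if snd r < fst r then q (fst r) (snd r) else 1)" for r
  have 0: "(\<Sum>r\<in>I \<times> I. e r *\<^sub>C basis_vec ({#fst r, snd r#}, h)) = 0"
    using 0 by (simp add: e_def)
  have eq: "({#fst r, snd r#} = {#p, l#}) \<longleftrightarrow> r \<in> {(p, l), (l, p)}" for r :: "nat \<times> nat"
    by (cases r) (auto simp: add_eq_conv_ex)
  have "(\<Sum>r\<in>I \<times> I. if r \<in> {(p, l), (l, p)} then e r else 0) = 0"
    using arg_cong[OF 0, of "\<lambda>x. lookup x ({#p, l#}, h)"]
    by (simp add: lookup_sum lookup_single when_def eq if_distrib cong: if_cong)
  moreover have "I \<times> I \<inter> {(p, l), (l, p)} = {(p, l), (l, p)}" using pl by auto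
  ultimately have sum0: "sum e {(p, l), (l, p)} = 0"
    by (simp add: sum.inter_restrict[symmetric] del: insert_iff)
  (* only one of the two words v_p v_l and v_l v_p is out of order *)
  consider "p = l" | "p < l" | "l < p" by linarith
  then show ?thesis
  proof cases
    case 1
    then show ?thesis using sum0 by (simp add: e_def)
  next
    case 2
    then have "?D p l + ?D l p * q l p = 0" using sum0 by (simp add: e_def)
    then have "q p l * (?D p l + ?D l p * q l p) = 0" by simp
    then have "q p l * ?D p l + (q p l * q l p) * ?D l p = 0"
      by (simp only: distrib_left mult.assoc mult.commute[of "?D l p"])
    then have "q p l * ?D p l + ?D l p = 0" by (simp only: q_cancel[OF pl] mult_1)
    then have "?D l p = - (q p l * ?D p l)" by (metis add_eq_0_iff)
    then show ?thesis by simp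
  next
    case 3
    then have "?D p l * q p l + ?D l p = 0" using sum0 by (simp add: e_def)
    then have "?D l p = - (?D p l * q p l)" by (metis add_eq_0_iff)
    then show ?thesis by (simp add: mult.commute)
  qed
qed

text \<open>
  By the symmetry of the minors, the image under \<open>h\<close> of a defining relation is again a combination
  of defining relations.
\<close>

lemma quantum_minor_sum:
  fixes B :: "nat \<Rightarrow> nat \<Rightarrow> 'a::cvec"
  assumes h: "h \<in> carrier G" and ij: "i \<in> I" "j \<in> I"
  shows "(\<Sum>p\<in>I. \<Sum>l\<in>I. quantum_minor h i j p l *\<^sub>C B p l)
    = (\<Sum>p\<in>I. \<Sum>l\<in>I. (quantum_minor h i j p l / 2) *\<^sub>C (B p l - q p l *\<^sub>C B l p))"
proof -
  let ?D = "quantum_minor h i j"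
  let ?S = "\<Sum>p\<in>I. \<Sum>l\<in>I. ?D p l *\<^sub>C B p l"
  have "(\<Sum>p\<in>I. \<Sum>l\<in>I. (?D p l / 2) *\<^sub>C (q p l *\<^sub>C B l p)) = (\<Sum>p\<in>I. \<Sum>l\<in>I. - ((1/2) *\<^sub>C ?D l p *\<^sub>C B l p))"
  proof (intro sum.cong refl)
    fix p l assume "p \<in> I" "l \<in> I"
    then show "(?D p l / 2) *\<^sub>C (q p l *\<^sub>C B l p) = - ((1/2) *\<^sub>C ?D l p *\<^sub>C B l p)"
      using quantum_minor_swap[OF h ij, of p l] by (simp add: mult.commute)
  qed
  also have "\<dots> = - ((1/2) *\<^sub>C ?S)"
    by (subst sum.swap) (simp add: scaleC_sum_right sum_negf)
  finally have "(\<Sum>p\<in>I. \<Sum>l\<in>I. (?D p l / 2) *\<^sub>C (q p l *\<^sub>C B l p)) = - ((1/2) *\<^sub>C ?S)" .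
  then have "(\<Sum>p\<in>I. \<Sum>l\<in>I. (?D p l / 2) *\<^sub>C (B p l - q p l *\<^sub>C B l p)) = (1/2) *\<^sub>C ?S + (1/2) *\<^sub>C ?S"
    by (simp add: scaleC_diff_right sum_subtractf) (simp add: scaleC_sum_right)
  also have "\<dots> = ?S" by (simp add: scaleC_add_left[symmetric] del: scaleC_scaleC)
  finally show ?thesis by simp
qed

lemma equivariant_commutator_half:
  fixes X :: "nat \<Rightarrow> 'a::calg"
  assumes "\<And>i. i \<in> I \<Longrightarrow> Hh * X i = (\<Sum>j\<in>I. a h i j *\<^sub>C (X j * Hh))"
    and "h \<in> carrier G" "i \<in> I" "j \<in> I"
  shows "Hh * (X i * X j - q i j *\<^sub>C (X j * X i))
    = (\<Sum>p\<in>I. \<Sum>l\<in>I. (quantum_minor h i j p l / 2) *\<^sub>C ((X p * X l - q p l *\<^sub>C (X l * X p)) * Hh))"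
proof -
  have "Hh * (X i * X j - q i j *\<^sub>C (X j * X i))
    = (\<Sum>p\<in>I. \<Sum>l\<in>I. quantum_minor h i j p l *\<^sub>C (X p * X l * Hh))"
    by (rule equivariant_commutator) (use assms in auto)
  also have "\<dots> = (\<Sum>p\<in>I. \<Sum>l\<in>I. (quantum_minor h i j p l / 2) *\<^sub>C
      (X p * X l * Hh - q p l *\<^sub>C (X l * X p * Hh)))"
    by (rule quantum_minor_sum) (use assms in auto)
  finally show ?thesis by (simp add: left_diff_distrib)
qed

end


section \<open>Lifting the generators order by order\<close>

definition q_commutator :: "(nat \<Rightarrow> nat \<Rightarrow> complex) \<Rightarrow> (nat \<Rightarrow> 'a::calg) \<Rightarrow> nat \<Rightarrow> nat \<Rightarrow> 'a" where
  "q_commutator q X i j = X i * X j - q i j *\<^sub>C (X j * X i)"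

text \<open>
  \<open>q_jacobi q F X i j l\<close> compares the two ways of reversing \<open>v\<^sub>i v\<^sub>j v\<^sub>l\<close>, where \<open>F i j\<close> is the price of
  interchanging \<open>v\<^sub>i\<close> and \<open>v\<^sub>j\<close>.  It is the pairing of \<open>F\<close> with the element of
  \<open>(relations \<otimes> V) \<inter> (V \<otimes> relations)\<close> that belongs to \<open>i, j, l\<close>.
\<close>

definition q_jacobi ::
  "(nat \<Rightarrow> nat \<Rightarrow> complex) \<Rightarrow> (nat \<Rightarrow> nat \<Rightarrow> 'a::calg) \<Rightarrow> (nat \<Rightarrow> 'a) \<Rightarrow> nat \<Rightarrow> nat \<Rightarrow> nat \<Rightarrow> 'a" where
  "q_jacobi q F X i j l = F i j * X l - (q i l * q j l) *\<^sub>C (X l * F i j) - X i * F j l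
    + q i j *\<^sub>C (X j * F i l) - q j l *\<^sub>C (F i l * X j) + (q i j * q i l) *\<^sub>C (F j l * X i)"

lemma sum_const_scaleC: "(\<Sum>a\<in>A. x) = of_nat (card A) *\<^sub>C (x :: 'a::cvec)"
  by (induction A rule: infinite_finite_induct) (simp_all add: scaleC_add_left)

lemma q_jacobi_q_commutator: "q_jacobi q (q_commutator q X) X i j l = 0"
  by (simp add: q_jacobi_def q_commutator_def scaleC_algebra)

lemma q_jacobi_diff:
  "q_jacobi q (\<lambda>i j. F i j - F' i j) X i j l = q_jacobi q F X i j l - q_jacobi q F' X i j l"
  by (simp add: q_jacobi_def scaleC_algebra)

lemma fps_nth_mult_lowest:
  fixes f g :: "'a::ring_1 fps"
  assumes "\<And>b. b < k \<Longrightarrow> fps_nth f b = 0"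
  shows "fps_nth (f * g) k = fps_nth f k * fps_nth g 0"
    and "fps_nth (g * f) k = fps_nth g 0 * fps_nth f k"
proof -
  have "fps_nth (f * g) k = (\<Sum>i=0..k. if i = k then fps_nth f k * fps_nth g 0 else 0)"
    unfolding fps_mult_nth by (rule sum.cong) (use assms in auto)
  then show "fps_nth (f * g) k = fps_nth f k * fps_nth g 0" by simp
  have "fps_nth (g * f) k = (\<Sum>i=0..k. if i = 0 then fps_nth g 0 * fps_nth f k else 0)"
    unfolding fps_mult_nth by (rule sum.cong) (use assms in auto)
  then show "fps_nth (g * f) k = fps_nth g 0 * fps_nth f k" by simp
qed

lemma q_jacobi_lowest:
  fixes X :: "nat \<Rightarrow> 'a::calg fps"
  assumes "\<And>i j b. i \<in> I \<Longrightarrow> j \<in> I \<Longrightarrow> b < k \<Longrightarrow> fps_nth (F i j) b = 0" "i \<in> I" "j \<in> I" "l \<in> I"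
  shows "fps_nth (q_jacobi q F X i j l) k
    = q_jacobi q (\<lambda>i j. fps_nth (F i j) k) (\<lambda>i. fps_nth (X i) 0) i j l"
  using assms by (simp add: q_jacobi_def fps_nth_mult_lowest)

lemma fps_nth_shift_const:
  fixes g :: "'a::calg fps"
  shows "fps_nth (fps_X * fps_const c * g) (Suc k) = c * fps_nth g k"
    and "fps_nth (g * (fps_X * fps_const c)) (Suc k) = fps_nth g k * c"
proof -
  show "fps_nth (fps_X * fps_const c * g) (Suc k) = c * fps_nth g k"
    by (simp add: mult.assoc)
  have "g * (fps_X * fps_const c) = fps_X * (g * fps_const c)"
    by (metis (no_types, lifting) fps_mult_fps_X_commute mult.assoc)
  then show "fps_nth (g * (fps_X * fps_const c)) (Suc k) = fps_nth g k * c"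
    by simp
qed

lemma q_jacobi_shift_const:
  fixes X :: "nat \<Rightarrow> 'a::calg fps"
  shows "fps_nth (q_jacobi q (\<lambda>i j. fps_X * fps_const (K i j)) X i j l) (Suc k)
    = q_jacobi q K (\<lambda>i. fps_nth (X i) k) i j l"
  by (simp add: q_jacobi_def fps_nth_shift_const)

text \<open>
  The assumptions on \<open>L1\<close> say that the operators \<open>V i + t L1 i\<close> satisfy all relations modulo \<open>t\<^sup>2\<close>.
\<close>

locale first_order = equivariant_operators I q G V H a
  for I q and G :: "('g, 'm) monoid_scheme" (structure) and V H a +
  fixes L1 :: "nat \<Rightarrow> (nat multiset \<times> 'g) endo" and \<kappa> :: "nat \<Rightarrow> nat \<Rightarrow> 'g \<Rightarrow> complex"
  assumes L1_degree: "i \<in> I \<Longrightarrow> raises_degree (-1) (L1 i)"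
    and H_L1: "h \<in> carrier G \<Longrightarrow> i \<in> I \<Longrightarrow> H h * L1 i = (\<Sum>j\<in>I. a h i j *\<^sub>C (L1 j * H h))"
    and L1_H_one: "i \<in> I \<Longrightarrow> L1 i * H \<one> = L1 i"
    and L1_commutator: "i \<in> I \<Longrightarrow> j \<in> I \<Longrightarrow>
      V i * L1 j + L1 i * V j - q i j *\<^sub>C (V j * L1 i + L1 j * V i) = (\<Sum>h\<in>carrier G. \<kappa> i j h *\<^sub>C H h)"
begin

definition K :: "nat \<Rightarrow> nat \<Rightarrow> (nat multiset \<times> 'g) endo" where
  "K i j = (\<Sum>h\<in>carrier G. \<kappa> i j h *\<^sub>C H h)"

lemma K_mult:
  assumes Y: "\<And>h i. h \<in> carrier G \<Longrightarrow> i \<in> I \<Longrightarrow> H h * Y i = (\<Sum>j\<in>I. a h i j *\<^sub>C (Y j * H h))"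
    and "l \<in> I"
  shows "K i j * Y l = (\<Sum>h\<in>carrier G. \<Sum>p\<in>I. (\<kappa> i j h * a h l p) *\<^sub>C (Y p * H h))"
    and "Y l * K i j = (\<Sum>h\<in>carrier G. \<Sum>p\<in>I. (\<kappa> i j h * (if p = l then 1 else 0)) *\<^sub>C (Y p * H h))"
proof -
  show "K i j * Y l = (\<Sum>h\<in>carrier G. \<Sum>p\<in>I. (\<kappa> i j h * a h l p) *\<^sub>C (Y p * H h))"
    unfolding K_def sum_distrib_right
    by (intro sum.cong refl) (simp add: Y assms(2) scaleC_sum_right)
  have "Y l * K i j = (\<Sum>h\<in>carrier G. \<Sum>p\<in>I. if p = l then \<kappa> i j h *\<^sub>C (Y p * H h) else 0)"
    unfolding K_def sum_distrib_left using assms(2) by simp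
  also have "\<dots> = (\<Sum>h\<in>carrier G. \<Sum>p\<in>I. (\<kappa> i j h * (if p = l then 1 else 0)) *\<^sub>C (Y p * H h))"
    by (intro sum.cong refl) auto
  finally show "Y l * K i j
    = (\<Sum>h\<in>carrier G. \<Sum>p\<in>I. (\<kappa> i j h * (if p = l then 1 else 0)) *\<^sub>C (Y p * H h))" .
qed

definition jacobi_coeff :: "nat \<Rightarrow> nat \<Rightarrow> nat \<Rightarrow> 'g \<Rightarrow> nat \<Rightarrow> complex" where
  "jacobi_coeff i j l h p = \<kappa> i j h * a h l p - (q i l * q j l) * (\<kappa> i j h * (if p = l then 1 else 0))
    - \<kappa> j l h * (if p = i then 1 else 0) + q i j * (\<kappa> i l h * (if p = j then 1 else 0))
    - q j l * (\<kappa> i l h * a h j p) + (q i j * q i l) * (\<kappa> j l h * a h i p)"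

lemma q_jacobi_K_expand:
  assumes Y: "\<And>h i. h \<in> carrier G \<Longrightarrow> i \<in> I \<Longrightarrow> H h * Y i = (\<Sum>j\<in>I. a h i j *\<^sub>C (Y j * H h))"
    and "i \<in> I" "j \<in> I" "l \<in> I"
  shows "q_jacobi q K Y i j l
    = (\<Sum>h\<in>carrier G. \<Sum>p\<in>I. jacobi_coeff i j l h p *\<^sub>C (Y p * H h))"
proof -
  have "K i j * Y l = (\<Sum>h\<in>carrier G. \<Sum>p\<in>I. (\<kappa> i j h * a h l p) *\<^sub>C (Y p * H h))"
    "Y l * K i j = (\<Sum>h\<in>carrier G. \<Sum>p\<in>I. (\<kappa> i j h * (if p = l then 1 else 0)) *\<^sub>C (Y p * H h))"
    if "l \<in> I" for i j l
    by (rule K_mult; use Y that in auto)+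
  note K_Y = this[OF \<open>i \<in> I\<close>] this[OF \<open>j \<in> I\<close>] this[OF \<open>l \<in> I\<close>]
  show ?thesis
    unfolding q_jacobi_def jacobi_coeff_def K_Y
      scaleC_add_left scaleC_diff_left scaleC_sum_right sum.distrib sum_subtractf scaleC_scaleC ..
qed

text \<open>
  The relations hold modulo \<open>t\<^sup>k\<close>.  Degree and equivariance are required of all coefficients, including
  those from \<open>k\<close> on, which are otherwise free: the next step changes only the coefficient of \<open>t\<^sup>k\<close>.
\<close>

definition lifts :: "nat \<Rightarrow> (nat \<Rightarrow> (nat multiset \<times> 'g) endo fps) \<Rightarrow> bool" where
  "lifts k X \<longleftrightarrow>
    (\<forall>i\<in>I. fps_nth (X i) 0 = V i \<and> fps_nth (X i) 1 = L1 i \<and> X i * fps_const (H \<one>) = X i \<and>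
       (\<forall>b. raises_degree (1 - 2 * int b) (fps_nth (X i) b)) \<and>
       (\<forall>h\<in>carrier G. fps_const (H h) * X i = (\<Sum>j\<in>I. a h i j *\<^sub>C (X j * fps_const (H h))))) \<and>
    (\<forall>i\<in>I. \<forall>j\<in>I. \<forall>b<k. fps_nth (q_commutator q X i j - fps_X * fps_const (K i j)) b = 0)"

lemma lifts_nth_H:
  assumes "lifts k X" "h \<in> carrier G" "i \<in> I"
  shows "H h * fps_nth (X i) b = (\<Sum>j\<in>I. a h i j *\<^sub>C (fps_nth (X j) b * H h))"
proof -
  have "fps_nth (fps_const (H h) * X i) b = fps_nth (\<Sum>j\<in>I. a h i j *\<^sub>C (X j * fps_const (H h))) b"
    using assms by (simp add: lifts_def)
  then show ?thesis by (simp add: fps_sum_nth)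
qed

text \<open>
  The coefficient of \<open>t\<close> in the formal identity \<open>q_jacobi_q_commutator\<close> is the Jacobi identity of \<open>K\<close>
  against \<open>V\<close>.  As the products \<open>v\<^sub>p h\<close> are linearly independent, it amounts to the vanishing of scalars, and
  these scalars are the same for every family that transforms under \<open>G\<close> as \<open>V\<close> does.  This is where
  the degree of \<open>\<mu>\<close> is decisive: with \<open>K\<close> in the group algebra, no condition beyond the first-order
  one is left.
\<close>

lemma q_jacobi_K:
  assumes X: "lifts 2 X"
    and Y: "\<And>h i. h \<in> carrier G \<Longrightarrow> i \<in> I \<Longrightarrow> H h * Y i = (\<Sum>j\<in>I. a h i j *\<^sub>C (Y j * H h))"
    and ijl: "i \<in> I" "j \<in> I" "l \<in> I"
  shows "q_jacobi q K Y i j l = 0"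
proof -
  define P where "P i j = q_commutator q X i j - fps_X * fps_const (K i j)" for i j
  have P0: "fps_nth (P i j) b = 0" if "i \<in> I" "j \<in> I" "b \<le> 1" for i j b
    using X that by (auto simp: lifts_def P_def)
  have "q_jacobi q P X i j l = - q_jacobi q (\<lambda>i j. fps_X * fps_const (K i j)) X i j l"
    unfolding P_def by (simp add: q_jacobi_diff q_jacobi_q_commutator)
  moreover have "fps_nth (q_jacobi q P X i j l) 1 = 0"
    by (subst q_jacobi_lowest[where I=I]) (use P0 ijl in \<open>auto simp: q_jacobi_def\<close>)
  ultimately have "q_jacobi q K (\<lambda>i. fps_nth (X i) 0) i j l = 0"
    using q_jacobi_shift_const[of q K X i j l 0] by simp
  then have "q_jacobi q K V i j l = 0"
    using X ijl by (simp add: q_jacobi_def lifts_def)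
  then have "(\<Sum>h\<in>carrier G. \<Sum>p\<in>I. jacobi_coeff i j l h p *\<^sub>C (V p * H h)) = 0"
    using q_jacobi_K_expand[OF H_V ijl] by simp
  then have "app (\<Sum>h\<in>carrier G. \<Sum>p\<in>I. jacobi_coeff i j l h p *\<^sub>C (V p * H h)) (basis_vec ({#}, \<one>)) = 0"
    by simp
  then have 0: "(\<Sum>h\<in>carrier G. \<Sum>p\<in>I. jacobi_coeff i j l h p *\<^sub>C app (V p) (basis_vec ({#}, h))) = 0"
    by (simp add: H_group)
  have "jacobi_coeff i j l h p = 0" if "h \<in> carrier G" "p \<in> I" for h p
  proof -
    have "lookup (\<Sum>p\<in>I. jacobi_coeff i j l g p *\<^sub>C app (V p) (basis_vec ({#}, g))) ({#p#}, h)
        = (if g = h then jacobi_coeff i j l h p else 0)" if "g \<in> carrier G" for g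
      using \<open>p \<in> I\<close> that
      by (auto simp: lookup_V_sum)
        (auto simp: V_basis lookup_sum lookup_single when_def intro!: sum.neutral)
    then have "(\<Sum>g\<in>carrier G. if g = h then jacobi_coeff i j l h p else 0) = 0"
      using arg_cong[OF 0, of "\<lambda>x. lookup x ({#p#}, h)"]
      by (simp add: lookup_sum)
    then show ?thesis using that by simp
  qed
  then show ?thesis
    using q_jacobi_K_expand[OF Y ijl] by simp
qed

lemma q_commutator_swap:
  fixes X :: "nat \<Rightarrow> 'b::calg"
  assumes "i \<in> I" "j \<in> I"
  shows "q_commutator q X j i = - (q j i *\<^sub>C q_commutator q X i j)"
  using q_cancel[OF assms(2,1)] by (simp add: q_commutator_def scaleC_diff_right)

text \<open>
  Since the system and its right hand side \<open>F\<close> are equivariant, conjugating a solution by a group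
  element gives a solution; the average of all conjugates is an equivariant one.
\<close>

lemma average_solution:
  assumes F_H: "\<And>h i j. h \<in> carrier G \<Longrightarrow> i \<in> I \<Longrightarrow> j \<in> I \<Longrightarrow>
      H h * F i j = (\<Sum>p\<in>I. \<Sum>l\<in>I. (quantum_minor h i j p l / 2) *\<^sub>C (F p l * H h))"
    and F_one: "\<And>i j. i \<in> I \<Longrightarrow> j \<in> I \<Longrightarrow> H \<one> * F i j = F i j"
    and sol: "\<And>i j. i \<in> I \<Longrightarrow> j \<in> I \<Longrightarrow>
      V i * \<Lambda> j + \<Lambda> i * V j - q i j *\<^sub>C (V j * \<Lambda> i + \<Lambda> j * V i) = F i j"
    and deg: "\<And>i. i \<in> I \<Longrightarrow> raises_degree d (\<Lambda> i)"
  obtains M where "\<And>i. i \<in> I \<Longrightarrow> raises_degree d (M i)"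
    and "\<And>i. i \<in> I \<Longrightarrow> M i * H \<one> = M i"
    and "\<And>h i. h \<in> carrier G \<Longrightarrow> i \<in> I \<Longrightarrow> H h * M i = (\<Sum>j\<in>I. a h i j *\<^sub>C (M j * H h))"
    and "\<And>i j. i \<in> I \<Longrightarrow> j \<in> I \<Longrightarrow>
      V i * M j + M i * V j - q i j *\<^sub>C (V j * M i + M j * V i) = F i j"
proof
  define c where "c = (1 / of_nat (card (carrier G)) :: complex)"
  have c: "of_nat (card (carrier G)) * c = 1"
    using finite_G one_closed by (auto simp: c_def)
  define N where "N h i = (\<Sum>j\<in>I. a (inv h) i j *\<^sub>C (H h * \<Lambda> j * H (inv h)))" for h i
  define M where "M i = c *\<^sub>C (\<Sum>h\<in>carrier G. N h i)" for i
  show "raises_degree d (M i)" if "i \<in> I" for i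
  proof -
    have "raises_degree (0 + d + 0) (H h * \<Lambda> j * H (inv h))" if "h \<in> carrier G" "j \<in> I" for h j
      by (intro raises_degree_mult H_degree deg) (use that in auto)
    then show ?thesis unfolding M_def N_def
      by (auto intro!: raises_degree_scaleC raises_degree_sum)
  qed
  show "M i * H \<one> = M i" if "i \<in> I" for i
    unfolding M_def N_def scaleC_mult_left sum_distrib_right
    by (intro arg_cong[of _ _ "(*\<^sub>C) c"] sum.cong refl) (simp add: mult.assoc H_mult)
  show "H k * M i = (\<Sum>j\<in>I. a k i j *\<^sub>C (M j * H k))" if k: "k \<in> carrier G" and i: "i \<in> I" for k i
  proof -
    have shift: "H k * N h i = (\<Sum>p\<in>I. a k i p *\<^sub>C (N (k \<otimes> h) p * H k))" if h: "h \<in> carrier G" for h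
    proof -
      have inv: "inv (k \<otimes> h) \<otimes> k = inv h" using h k by (simp add: inv_mult_group m_assoc)
      have "(\<Sum>p\<in>I. a k i p *\<^sub>C (N (k \<otimes> h) p * H k))
          = (\<Sum>p\<in>I. \<Sum>j\<in>I. (a k i p * a (inv (k \<otimes> h)) p j) *\<^sub>C (H (k \<otimes> h) * \<Lambda> j * H (inv h)))"
        using h k
        by (simp add: N_def sum_distrib_right scaleC_sum_right mult.assoc H_mult inv)
      also have "\<dots> = (\<Sum>j\<in>I. a (inv (k \<otimes> h) \<otimes> k) i j *\<^sub>C (H (k \<otimes> h) * \<Lambda> j * H (inv h)))"
        using h k i by (subst sum.swap, intro sum.cong refl) (simp add: a_mult scaleC_sum_left)
      also have "\<dots> = H k * N h i"
        using h k by (simp add: N_def inv sum_distrib_left mult.assoc[symmetric] H_mult)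
      finally show ?thesis by simp
    qed
    have "H k * M i = c *\<^sub>C (\<Sum>h\<in>carrier G. \<Sum>p\<in>I. a k i p *\<^sub>C (N (k \<otimes> h) p * H k))"
      by (simp add: M_def sum_distrib_left shift)
    also have "\<dots> = (\<Sum>p\<in>I. a k i p *\<^sub>C (c *\<^sub>C (\<Sum>h\<in>carrier G. N (k \<otimes> h) p) * H k))"
      by (subst sum.swap) (simp add: scaleC_sum_right sum_distrib_right mult.commute)
    also have "\<dots> = (\<Sum>p\<in>I. a k i p *\<^sub>C (M p * H k))"
    proof -
      have "(\<Sum>h\<in>carrier G. N (k \<otimes> h) p) = (\<Sum>h\<in>carrier G. N h p)" for p
        by (rule sum.reindex_bij_witness[of _ "\<lambda>h. inv k \<otimes> h" "\<lambda>h. k \<otimes> h"])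
           (use k in \<open>auto simp: m_assoc[symmetric]\<close>)
      then show ?thesis by (simp add: M_def)
    qed
    finally show ?thesis .
  qed
  show "V i * M j + M i * V j - q i j *\<^sub>C (V j * M i + M j * V i) = F i j"
    if ij: "i \<in> I" "j \<in> I" for i j
  proof -
    have "V i * N h j + N h i * V j - q i j *\<^sub>C (V j * N h i + N h j * V i) = F i j"
      if h: "h \<in> carrier G" for h
    proof -
      let ?a = "a (inv h)" and ?H = "H (inv h)"
      have V_H: "V i * H h = (\<Sum>p\<in>I. ?a i p *\<^sub>C (H h * V p))" if "i \<in> I" for i
      proof -
        have "V i * H h = H \<one> * V i * H h" using that by simp
        also have "\<dots> = H h * (?H * V i) * H h"
          using h by (simp add: mult.assoc[symmetric] H_mult)
        also have "\<dots> = (\<Sum>p\<in>I. ?a i p *\<^sub>C (H h * (V p * (?H * H h))))"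
          using h that by (simp add: H_V sum_distrib_left sum_distrib_right mult.assoc)
        finally show ?thesis using h by (simp add: H_mult)
      qed
      have VN: "V i * N h j = (\<Sum>p\<in>I. \<Sum>l\<in>I. (?a i p * ?a j l) *\<^sub>C (H h * (V p * \<Lambda> l) * ?H))"
        if "i \<in> I" "j \<in> I" for i j
      proof -
        have "V i * N h j = (\<Sum>l\<in>I. ?a j l *\<^sub>C ((V i * H h) * \<Lambda> l * ?H))"
          by (simp add: N_def sum_distrib_left mult.assoc)
        also have "\<dots> = (\<Sum>l\<in>I. \<Sum>p\<in>I. (?a i p * ?a j l) *\<^sub>C (H h * (V p * \<Lambda> l) * ?H))"
          by (simp add: V_H[OF that(1)] sum_distrib_right scaleC_sum_right mult.assoc mult.commute)
        finally show ?thesis by (subst sum.swap)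
      qed
      have NV: "N h i * V j = (\<Sum>p\<in>I. \<Sum>l\<in>I. (?a i p * ?a j l) *\<^sub>C (H h * (\<Lambda> p * V l) * ?H))"
        if "i \<in> I" "j \<in> I" for i j
        using that h
        by (simp add: N_def sum_distrib_right sum_distrib_left scaleC_sum_right mult.assoc H_V)
      let ?B = "\<lambda>p l. H h * (V p * \<Lambda> l + \<Lambda> p * V l) * ?H"
      have "V i * N h j + N h i * V j - q i j *\<^sub>C (V j * N h i + N h j * V i)
          = (\<Sum>p\<in>I. \<Sum>l\<in>I. quantum_minor (inv h) i j p l *\<^sub>C ?B p l)"
      proof -
        show ?thesis
        unfolding VN[OF ij] NV[OF ij] VN[OF ij(2,1)] NV[OF ij(2,1)]
        by (simp add: quantum_minor_def scaleC_add_right scaleC_diff_left distrib_left distrib_right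
            sum.distrib sum_subtractf scaleC_sum_right mult.assoc)
      qed
      also have "\<dots> = (\<Sum>p\<in>I. \<Sum>l\<in>I. (quantum_minor (inv h) i j p l / 2) *\<^sub>C
          (?B p l - q p l *\<^sub>C ?B l p))"
        by (rule quantum_minor_sum) (use h ij in auto)
      also have "\<dots> = (\<Sum>p\<in>I. \<Sum>l\<in>I. (quantum_minor (inv h) i j p l / 2) *\<^sub>C (H h * F p l * ?H))"
      proof (intro sum.cong refl)
        fix p l assume "p \<in> I" "l \<in> I"
        then have "?B p l - q p l *\<^sub>C ?B l p = H h * F p l * ?H"
          unfolding sol[OF \<open>p \<in> I\<close> \<open>l \<in> I\<close>, symmetric] by (simp add: algebra_simps)
        then show "(quantum_minor (inv h) i j p l / 2) *\<^sub>C (?B p l - q p l *\<^sub>C ?B l p)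
          = (quantum_minor (inv h) i j p l / 2) *\<^sub>C (H h * F p l * ?H)" by simp
      qed
      also have "\<dots> = H h * (?H * F i j)"
        using h ij by (simp add: F_H[of "inv h" i j] sum_distrib_left mult.assoc)
      also have "\<dots> = F i j"
        using h ij by (simp add: mult.assoc[symmetric] H_mult F_one)
      finally show ?thesis .
    qed
    then have "(\<Sum>h\<in>carrier G. V i * N h j + N h i * V j - q i j *\<^sub>C (V j * N h i + N h j * V i))
        = of_nat (card (carrier G)) *\<^sub>C F i j" by (simp add: sum_const_scaleC del: sum_constant)
    moreover have "V i * M j + M i * V j - q i j *\<^sub>C (V j * M i + M j * V i)
      = c *\<^sub>C (\<Sum>h\<in>carrier G. V i * N h j + N h i * V j - q i j *\<^sub>C (V j * N h i + N h j * V i))"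
      by (simp add: M_def sum.distrib sum_subtractf sum_distrib_left sum_distrib_right
          scaleC_add_right scaleC_diff_right scaleC_sum_right mult.commute)
    ultimately show ?thesis using c by (simp add: mult.commute)
  qed
qed


lemma lifts_H_one:
  assumes X: "lifts k X" and i: "i \<in> I"
  shows "fps_const (H \<one>) * X i = X i"
proof -
  have "fps_const (H \<one>) * X i = (\<Sum>j\<in>I. a \<one> i j *\<^sub>C X j)"
    using X i by (simp add: lifts_def)
  also have "\<dots> = (\<Sum>j\<in>I. if i = j then X i else 0)"
    by (intro sum.cong refl) (use i in \<open>auto simp: a_one\<close>)
  finally show ?thesis using i by simp
qed

text \<open>
  The error \<open>F\<close> at order \<open>k\<close> satisfies the Jacobi identity: in the one for
  \<open>q_commutator q X = P + t K\<close>, which holds identically, the coefficient of \<open>t\<^sup>k\<close> involves \<open>P\<close> only through its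
  lowest coefficient \<open>-F\<close>, and the contribution of \<open>K\<close> vanishes by \<open>q_jacobi_K\<close>.  So \<open>F\<close> can be removed by a
  new coefficient of \<open>t\<^sup>k\<close>.
\<close>

lemma lift_step:
  assumes X: "lifts k X" and k: "2 \<le> k"
  obtains X' where "lifts (Suc k) X'" and "\<And>i b. b < k \<Longrightarrow> fps_nth (X' i) b = fps_nth (X i) b"
proof -
  define P where "P i j = q_commutator q X i j - fps_X * fps_const (K i j)" for i j
  define F where "F i j = - fps_nth (P i j) k" for i j
  have F_eq: "F i j = - fps_nth (q_commutator q X i j) k" for i j
    using k by (simp add: F_def P_def)
  have P_low: "fps_nth (P i j) b = 0" if "i \<in> I" "j \<in> I" "b < k" for i j b
    using X that by (simp add: lifts_def P_def)
  have X0: "fps_nth (X i) 0 = V i" if "i \<in> I" for i using X that by (simp add: lifts_def)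
  have X_H_one: "X i * fps_const (H \<one>) = X i" if "i \<in> I" for i using X that by (simp add: lifts_def)
  have H_X: "fps_const (H h) * X i = (\<Sum>j\<in>I. a h i j *\<^sub>C (X j * fps_const (H h)))"
    if "h \<in> carrier G" "i \<in> I" for h i using X that by (simp add: lifts_def)
  have X_degree: "raises_degree (1 - 2 * int b) (fps_nth (X i) b)" if "i \<in> I" for i b
    using X that by (simp add: lifts_def)
  have H_one_X: "fps_const (H \<one>) * X i = X i" if "i \<in> I" for i
    using lifts_H_one[OF X that] .
  (* the coefficient of t^k in a product of two operators of total degree 1 has degree 2 - 2 k *)
  have F_degree: "raises_degree ((1 - 2 * int k) + 1) (F i j)" if "i \<in> I" "j \<in> I" for i j
  proof -
    have XX: "raises_degree ((1 - 2 * int k) + 1) (fps_nth (X i * X j) k)" if "i \<in> I" "j \<in> I" for i j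
      unfolding fps_mult_nth
    proof (rule raises_degree_sum)
      fix b assume "b \<in> {0..k}"
      then have "(1 - 2 * int b) + (1 - 2 * int (k - b)) = (1 - 2 * int k) + 1" by auto
      then show "raises_degree ((1 - 2 * int k) + 1) (fps_nth (X i) b * fps_nth (X j) (k - b))"
        using raises_degree_mult[OF X_degree[OF that(1), of b] X_degree[OF that(2), of "k - b"]] by simp
    qed
    have "raises_degree ((1 - 2 * int k) + 1) ((-1) *\<^sub>C
        (fps_nth (X i * X j) k - q i j *\<^sub>C fps_nth (X j * X i) k))"
      by (intro raises_degree_scaleC raises_degree_diff XX that)
    then show ?thesis by (simp add: F_eq q_commutator_def)
  qed
  have F_jacobi: "q_jacobi q F V i j l = 0" if ijl: "i \<in> I" "j \<in> I" "l \<in> I" for i j l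
  proof -
    have "lifts 2 X" using X k by (auto simp: lifts_def)
    then have "q_jacobi q K (\<lambda>i. fps_nth (X i) (k - 1)) i j l = 0"
      by (rule q_jacobi_K[OF _ _ ijl]) (use lifts_nth_H[OF X] in auto)
    then have "fps_nth (q_jacobi q (\<lambda>i j. fps_X * fps_const (K i j)) X i j l) k = 0"
      using q_jacobi_shift_const[of q K X i j l "k - 1"] k by simp
    moreover have "q_jacobi q P X i j l = - q_jacobi q (\<lambda>i j. fps_X * fps_const (K i j)) X i j l"
      unfolding P_def by (simp add: q_jacobi_diff q_jacobi_q_commutator)
    ultimately have "fps_nth (q_jacobi q P X i j l) k = 0" by simp
    then have "q_jacobi q (\<lambda>i j. fps_nth (P i j) k) (\<lambda>i. fps_nth (X i) 0) i j l = 0"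
      by (subst (asm) q_jacobi_lowest[where I=I]) (use P_low ijl in auto)
    moreover have "q_jacobi q F V i j l
        = - q_jacobi q (\<lambda>i j. fps_nth (P i j) k) (\<lambda>i. fps_nth (X i) 0) i j l"
      using ijl X0 by (simp add: q_jacobi_def F_def algebra_simps)
    ultimately show ?thesis by simp
  qed
  have F_one: "H \<one> * F i j = F i j" "F i j * H \<one> = F i j" if "i \<in> I" "j \<in> I" for i j
  proof -
    have "fps_const (H \<one>) * q_commutator q X i j = q_commutator q X i j"
      "q_commutator q X i j * fps_const (H \<one>) = q_commutator q X i j"
      using that
      by (simp_all add: q_commutator_def left_diff_distrib right_diff_distrib H_one_X X_H_one
          mult.assoc) (simp_all add: mult.assoc[symmetric] H_one_X)
    then show "H \<one> * F i j = F i j" "F i j * H \<one> = F i j"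
      unfolding F_eq by (metis fps_mult_left_const_nth mult_minus_right)
        (metis F_eq \<open>q_commutator q X i j * fps_const (H \<one>) = q_commutator q X i j\<close>
          fps_mult_right_const_nth mult_minus_left)
  qed
  have F_H: "H h * F i j = (\<Sum>p\<in>I. \<Sum>l\<in>I. (quantum_minor h i j p l / 2) *\<^sub>C (F p l * H h))"
    if "h \<in> carrier G" "i \<in> I" "j \<in> I" for h i j
  proof -
    have "fps_const (H h) * q_commutator q X i j = (\<Sum>p\<in>I. \<Sum>l\<in>I.
        (quantum_minor h i j p l / 2) *\<^sub>C (q_commutator q X p l * fps_const (H h)))"
      unfolding q_commutator_def by (rule equivariant_commutator_half) (use that H_X in auto)
    then have "fps_nth (fps_const (H h) * q_commutator q X i j) k = fps_nth (\<Sum>p\<in>I. \<Sum>l\<in>I.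
        (quantum_minor h i j p l / 2) *\<^sub>C (q_commutator q X p l * fps_const (H h))) k"
      by simp
    then show ?thesis by (simp add: F_eq fps_sum_nth sum_negf)
  qed
  obtain \<Lambda> where \<Lambda>_degree: "\<And>i. i \<in> I \<Longrightarrow> raises_degree (1 - 2 * int k) (\<Lambda> i)"
    and \<Lambda>_outside: "\<And>i b. b \<notin> Basis \<Longrightarrow> app (\<Lambda> i) (basis_vec b) = 0"
    and \<Lambda>: "\<And>i j b. i \<in> I \<Longrightarrow> j \<in> I \<Longrightarrow> j < i \<Longrightarrow> b \<in> Basis \<Longrightarrow>
      app (V i * \<Lambda> j + \<Lambda> i * V j - q i j *\<^sub>C (V j * \<Lambda> i + \<Lambda> j * V i)) (basis_vec b)
        = app (F i j) (basis_vec b)"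
  proof (rule solve_commutation[of "1 - 2 * int k" F])
    show "raises_degree ((1 - 2 * int k) + 1) (F i j)" if "i \<in> I" "j \<in> I" for i j
      by (rule F_degree[OF that])
    show "app (F i j * V l - (q i l * q j l) *\<^sub>C (V l * F i j) - V i * F j l + q i j *\<^sub>C (V j * F i l)
        - q j l *\<^sub>C (F i l * V j) + (q i j * q i l) *\<^sub>C (F j l * V i)) (basis_vec b) = 0"
      if "i \<in> I" "j \<in> I" "l \<in> I" for i j l b
      using F_jacobi[OF that] by (simp only: q_jacobi_def app_endo_simps)
  qed blast
  let ?E = "\<lambda>\<Lambda> i j. V i * \<Lambda> j + \<Lambda> i * V j - q i j *\<^sub>C (V j * \<Lambda> i + \<Lambda> j * V i)"
  have E_less: "?E \<Lambda> i j = F i j" if ij: "i \<in> I" "j \<in> I" "j < i" for i j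
  proof (rule endo_eqI, rule clinear_eq_on_basis[OF clinear_app clinear_app])
    fix b
    show "app (?E \<Lambda> i j) (basis_vec b) = app (F i j) (basis_vec b)"
    proof (cases "b \<in> Basis")
      case True
      then show ?thesis using \<Lambda> ij by blast
    next
      case False
      have "app (F i j) (basis_vec b) = app (F i j * H \<one>) (basis_vec b)"
        by (simp only: F_one[OF ij(1,2)])
      then show ?thesis using False ij by (simp add: H_one_outside V_outside \<Lambda>_outside)
    qed
  qed
  have E: "?E \<Lambda> i j = F i j" if ij: "i \<in> I" "j \<in> I" for i j
  proof (cases i j rule: linorder_cases)
    case less
    have "?E \<Lambda> i j = - (q i j *\<^sub>C ?E \<Lambda> j i)"
      using q_cancel[OF ij] by (simp add: scaleC_algebra)
    also have "\<dots> = - (q i j *\<^sub>C F j i)" by (simp only: E_less[OF ij(2,1) less])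
    also have "\<dots> = F i j"
      unfolding F_eq by (subst q_commutator_swap[OF ij(2,1)]) simp
    finally show ?thesis .
  next
    case equal
    then show ?thesis using ij by (simp add: F_eq q_commutator_def algebra_simps)
  next
    case greater
    then show ?thesis using E_less ij by simp
  qed
  obtain M where M_degree: "\<And>i. i \<in> I \<Longrightarrow> raises_degree (1 - 2 * int k) (M i)"
    and M_one: "\<And>i. i \<in> I \<Longrightarrow> M i * H \<one> = M i"
    and H_M: "\<And>h i. h \<in> carrier G \<Longrightarrow> i \<in> I \<Longrightarrow> H h * M i = (\<Sum>j\<in>I. a h i j *\<^sub>C (M j * H h))"
    and M: "\<And>i j. i \<in> I \<Longrightarrow> j \<in> I \<Longrightarrow> ?E M i j = F i j"
    using average_solution[of F \<Lambda> "1 - 2 * int k", OF F_H F_one(1) E \<Lambda>_degree] by blast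
  define T where "T i = fps_X ^ k * fps_const (M i)" for i
  define X' where "X' i = X i + T i" for i
  have T_nth: "fps_nth (T i) b = (if b = k then M i else 0)" for i b
    by (auto simp: T_def fps_X_power_mult_nth)
  show ?thesis
  proof
    show "fps_nth (X' i) b = fps_nth (X i) b" if "b < k" for i b
      using that by (simp add: X'_def T_nth)
    have 1: "fps_nth (q_commutator q X' i j - fps_X * fps_const (K i j)) b = 0"
      if ij: "i \<in> I" "j \<in> I" and b: "b < Suc k" for i j b
    proof -
      have T_low: "fps_nth (T i) b = 0" if "b < k" for i b using that by (simp add: T_nth)
      have TX: "fps_nth (T i * Y) b = (if b = k then M i * fps_nth Y 0 else 0)"
        "fps_nth (Y * T i) b = (if b = k then fps_nth Y 0 * M i else 0)" for i Y
      proof -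
        have "fps_nth (T i * Y) b = fps_nth (T i) b * fps_nth Y 0"
          "fps_nth (Y * T i) b = fps_nth Y 0 * fps_nth (T i) b"
          by (rule fps_nth_mult_lowest; use b in \<open>auto intro: T_low\<close>)+
        then show "fps_nth (T i * Y) b = (if b = k then M i * fps_nth Y 0 else 0)"
          "fps_nth (Y * T i) b = (if b = k then fps_nth Y 0 * M i else 0)"
          by (auto simp: T_nth)
      qed
      have T0: "fps_nth (T i) 0 = 0" for i using k by (simp add: T_nth)
      have "q_commutator q X' i j - fps_X * fps_const (K i j) = P i j
          + ((X i * T j + T i * X j + T i * T j) - q i j *\<^sub>C (X j * T i + T j * X i + T j * T i))"
        by (simp add: q_commutator_def X'_def P_def scaleC_algebra)
      then have "fps_nth (q_commutator q X' i j - fps_X * fps_const (K i j)) b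
          = fps_nth (P i j) b + (if b = k then ?E M i j else 0)"
        using ij by (simp add: TX T0 X0)
      also have "\<dots> = 0"
        using b ij P_low[OF ij, of b] by (auto simp: M F_def)
      finally show ?thesis .
    qed
    have 2: "X' i * fps_const (H \<one>) = X' i" if "i \<in> I" for i
      using that by (simp add: X'_def T_def distrib_right X_H_one mult.assoc M_one)
    have 3: "raises_degree (1 - 2 * int b) (fps_nth (X' i) b)" if "i \<in> I" for i b
      using that X_degree M_degree by (auto simp: X'_def T_nth intro: raises_degree_add)
    have 4: "fps_const (H h) * X' i = (\<Sum>j\<in>I. a h i j *\<^sub>C (X' j * fps_const (H h)))"
      if "h \<in> carrier G" "i \<in> I" for h i
    proof -
      have "fps_const (H h) * T i = fps_X ^ k * fps_const (H h * M i)"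
        unfolding T_def by (simp add: mult.assoc[symmetric] fps_mult_fps_X_power_commute)
      also have "\<dots> = (\<Sum>j\<in>I. a h i j *\<^sub>C (T j * fps_const (H h)))"
        by (rule fps_ext) (simp add: fps_X_power_mult_nth H_M that fps_sum_nth T_nth)
      finally show ?thesis
        using that by (simp add: X'_def distrib_left distrib_right H_X scaleC_add_right sum.distrib)
    qed
    show "lifts (Suc k) X'"
      unfolding lifts_def using 1 2 3 4 X k by (auto simp: X'_def T_nth lifts_def)
  qed
qed

text \<open>
  The choices made at successive orders stabilise coefficientwise.
\<close>

lemma lift_exists:
  obtains X where "\<And>k. lifts k X"
proof -
  (* lift_step starts at order 2; the polynomial V + t L1 provides the start *)
  define X1 where "X1 i = fps_const (V i) + fps_X * fps_const (L1 i)" for i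
  have nth: "fps_nth (X1 i) b = (if b = 0 then V i else if b = 1 then L1 i else 0)" for i b
    by (auto simp: X1_def)
  have "lifts 2 X1"
  proof -
    have "fps_nth (q_commutator q X1 i j - fps_X * fps_const (K i j)) b = 0"
      if ij: "i \<in> I" "j \<in> I" and b: "b < 2" for i j b
    proof -
      consider "b = 0" | "b = Suc 0" using b by linarith
      then show ?thesis
      proof cases
        case 1
        then show ?thesis using V_commute[OF ij] by (simp add: q_commutator_def nth)
      next
        case 2
        then show ?thesis
          using L1_commutator[OF ij] by (simp add: q_commutator_def nth K_def)
      qed
    qed
    moreover have "fps_const (H h) * X1 i = (\<Sum>j\<in>I. a h i j *\<^sub>C (X1 j * fps_const (H h)))"
      if "h \<in> carrier G" "i \<in> I" for h i
      by (rule fps_ext) (auto simp: fps_sum_nth nth H_V H_L1 that)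
    moreover have "X1 i * fps_const (H \<one>) = X1 i" if "i \<in> I" for i
      by (rule fps_ext) (auto simp: nth L1_H_one that)
    ultimately show ?thesis
      using V_degree L1_degree by (auto simp: lifts_def nth)
  qed
  obtain Y where Y0: "Y 0 = X1" and Y: "\<And>m. lifts (m + 2) (Y m)"
      "\<And>m i b. b < m + 2 \<Longrightarrow> fps_nth (Y (Suc m) i) b = fps_nth (Y m i) b"
  proof -
    have "\<exists>Y. \<forall>m. (lifts (m + 2) (Y m) \<and> (m = 0 \<longrightarrow> Y m = X1)) \<and>
        (\<forall>i b. b < m + 2 \<longrightarrow> fps_nth (Y (Suc m) i) b = fps_nth (Y m i) b)"
    proof (rule dependent_nat_choice)
      show "\<exists>Y. lifts (0 + 2) Y \<and> (0 = 0 \<longrightarrow> Y = X1)" using \<open>lifts 2 X1\<close> by (simp add: numeral_2_eq_2)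
      fix Y m assume Y: "lifts (m + 2) Y \<and> (m = 0 \<longrightarrow> Y = X1)"
      then obtain Y' where "lifts (Suc (m + 2)) Y'"
          "\<And>i b. b < m + 2 \<Longrightarrow> fps_nth (Y' i) b = fps_nth (Y i) b"
        using lift_step[of "m + 2" Y] by auto
      then show "\<exists>Y'. (lifts (Suc m + 2) Y' \<and> (Suc m = 0 \<longrightarrow> Y' = X1)) \<and>
          (\<forall>i b. b < m + 2 \<longrightarrow> fps_nth (Y' i) b = fps_nth (Y i) b)"
        by auto
    qed
    then show ?thesis using that by blast
  qed
  define X where "X i = Abs_fps (\<lambda>b. fps_nth (Y b i) b)" for i
  have stable: "fps_nth (Y (b + c) i) b = fps_nth (Y b i) b" for b c i
    by (induction c) (use Y(2) in auto)
  have X_eq: "fps_nth (X i) b = fps_nth (Y m i) b" if "b \<le> m" for i b m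
    using stable[of b "m - b" i] that by (simp add: X_def)
  show ?thesis
  proof
    fix k
    have mult_eq: "fps_nth (X i * X j) b = fps_nth (Y b i * Y b j) b" for i j b
      unfolding fps_mult_nth by (rule sum.cong) (auto simp: X_eq[of _ b])
    have "fps_nth (q_commutator q X i j - fps_X * fps_const (K i j)) b
        = fps_nth (q_commutator q (Y b) i j - fps_X * fps_const (K i j)) b" for i j b
      by (simp add: q_commutator_def mult_eq)
    then have "fps_nth (q_commutator q X i j - fps_X * fps_const (K i j)) b = 0"
      if "i \<in> I" "j \<in> I" for i j b
      using Y(1)[of b] that by (simp add: lifts_def)
    moreover have "fps_const (H h) * X i = (\<Sum>j\<in>I. a h i j *\<^sub>C (X j * fps_const (H h)))"
      if "h \<in> carrier G" "i \<in> I" for h i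
      by (rule fps_ext) (simp add: X_def fps_sum_nth lifts_nth_H[OF Y(1) that])
    moreover have "X i * fps_const (H \<one>) = X i" if "i \<in> I" for i
    proof (rule fps_ext)
      fix b
      have "fps_nth (Y b i * fps_const (H \<one>)) b = fps_nth (Y b i) b"
        using Y(1)[of b] that by (simp add: lifts_def)
      then show "fps_nth (X i * fps_const (H \<one>)) b = fps_nth (X i) b"
        by (simp add: X_def)
    qed
    moreover have "fps_nth (X i) 0 = V i" "fps_nth (X i) 1 = L1 i"
      "raises_degree (1 - 2 * int b) (fps_nth (X i) b)" if "i \<in> I" for i b
      using Y(1)[of 0] Y(1)[of 1] Y(1)[of b] that by (simp_all add: lifts_def X_def)
    ultimately show "lifts k X"
      unfolding lifts_def by auto
  qed
qed

end


section \<open>The first-order term given by a cocycle\<close>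

text \<open>
  The skew group algebra in coordinates: the basis vector \<open>(A, g)\<close> is the product \<open>v\<^sub>A g\<close>.  Basis
  vectors outside the index set annihilate everything, so that products are total and bilinear
  and associativity holds without side conditions; \<open>basis_vec ({#}, \<one>)\<close> is a unit on the span of the
  index set only.
\<close>

locale skew_model = quantum_coefficients I q + group G
  for I q and G :: "('g, 'm) monoid_scheme" (structure) +
  fixes pr :: "(nat multiset \<times> 'g \<Rightarrow>\<^sub>0 complex) \<Rightarrow> (nat multiset \<times> 'g \<Rightarrow>\<^sub>0 complex) \<Rightarrow>
      (nat multiset \<times> 'g \<Rightarrow>\<^sub>0 complex)" (infixl \<open>\<bullet>\<close> 70)
    and a :: "'g \<Rightarrow> nat \<Rightarrow> nat \<Rightarrow> complex"
  assumes finite_carrier: "finite (carrier G)"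
    and pr_linear_left: "clinear (\<lambda>x. x \<bullet> y)"
    and pr_linear_right: "clinear (\<lambda>y. x \<bullet> y)"
    and pr_assoc: "(x \<bullet> y) \<bullet> z = x \<bullet> (y \<bullet> z)"
    and pr_outside_right: "b \<notin> {A. set_mset A \<subseteq> I} \<times> carrier G \<Longrightarrow> x \<bullet> basis_vec b = 0"
    and pr_keys: "keys (x \<bullet> y) \<subseteq> {A. set_mset A \<subseteq> I} \<times> carrier G"
    and pr_unit_left: "b \<in> {A. set_mset A \<subseteq> I} \<times> carrier G \<Longrightarrow>
      basis_vec ({#}, \<one>) \<bullet> basis_vec b = basis_vec b"
    and pr_unit_right: "b \<in> {A. set_mset A \<subseteq> I} \<times> carrier G \<Longrightarrow>
      basis_vec b \<bullet> basis_vec ({#}, \<one>) = basis_vec b"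
    and pr_gen: "i \<in> I \<Longrightarrow> set_mset A \<subseteq> I \<Longrightarrow> g \<in> carrier G \<Longrightarrow>
      basis_vec ({#i#}, \<one>) \<bullet> basis_vec (A, g) = move_coeff q i A *\<^sub>C basis_vec (add_mset i A, g)"
    and pr_group: "h \<in> carrier G \<Longrightarrow> g \<in> carrier G \<Longrightarrow>
      basis_vec ({#}, h) \<bullet> basis_vec ({#}, g) = basis_vec ({#}, h \<otimes> g)"
    and pr_group_gen: "h \<in> carrier G \<Longrightarrow> i \<in> I \<Longrightarrow>
      basis_vec ({#}, h) \<bullet> basis_vec ({#i#}, \<one>) = (\<Sum>j\<in>I. a h i j *\<^sub>C basis_vec ({#j#}, h))"
begin

abbreviation B :: "(nat multiset \<times> 'g) set" where "B \<equiv> {A. set_mset A \<subseteq> I} \<times> carrier G"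
abbreviation gen :: "nat \<Rightarrow> nat multiset \<times> 'g \<Rightarrow>\<^sub>0 complex" where "gen i \<equiv> basis_vec ({#i#}, \<one>)"
abbreviation grp :: "'g \<Rightarrow> nat multiset \<times> 'g \<Rightarrow>\<^sub>0 complex" where "grp h \<equiv> basis_vec ({#}, h)"

definition lmult :: "(nat multiset \<times> 'g \<Rightarrow>\<^sub>0 complex) \<Rightarrow> (nat multiset \<times> 'g) endo" where
  "lmult x = Endo (\<lambda>y. x \<bullet> y)"

lemma app_lmult [simp]: "app (lmult x) y = x \<bullet> y"
  by (simp add: lmult_def pr_linear_right)

lemmas pr_simps = clinear_simps[OF pr_linear_left] clinear_simps[OF pr_linear_right]

lemma lmult_linear: "clinear lmult"
  by standard (rule endo_eqI; simp add: pr_simps)+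

lemmas lmult_simps = clinear_simps[OF lmult_linear]

lemma lmult_pr: "lmult (x \<bullet> y) = lmult x * lmult y"
  by (rule endo_eqI) (simp add: pr_assoc)

lemma unit_left: "keys x \<subseteq> B \<Longrightarrow> grp \<one> \<bullet> x = x"
  by (rule clinear_eq_on_basis[OF pr_linear_right, where g = "\<lambda>x. x"])
     (auto simp: clinear_def pr_unit_left)

lemma unit_right: "keys x \<subseteq> B \<Longrightarrow> x \<bullet> grp \<one> = x"
  by (rule clinear_eq_on_basis[OF pr_linear_left, where g = "\<lambda>x. x"])
     (auto simp: clinear_def pr_unit_right)

sublocale equivariant_operators I q G "\<lambda>i. lmult (gen i)" "\<lambda>h. lmult (grp h)" a
proof
  show "lmult (grp h) * lmult (gen i) = (\<Sum>j\<in>I. a h i j *\<^sub>C (lmult (gen j) * lmult (grp h)))"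
    if "h \<in> carrier G" "i \<in> I" for h i
  proof -
    have "basis_vec ({#j#}, h) = gen j \<bullet> grp h" if "j \<in> I" for j
      using pr_gen[of j "{#}" h] that \<open>h \<in> carrier G\<close> by simp
    then have "lmult (grp h \<bullet> gen i) = lmult (\<Sum>j\<in>I. a h i j *\<^sub>C (gen j \<bullet> grp h))"
      using that by (simp add: pr_group_gen)
    then show ?thesis by (simp add: lmult_simps lmult_pr)
  qed
  show "lmult (grp h) * lmult (grp k) = lmult (grp (h \<otimes> k))"
    if "h \<in> carrier G" "k \<in> carrier G" for h k
    using that by (simp add: lmult_pr[symmetric] pr_group)
qed (auto simp: pr_gen pr_outside_right pr_group pr_unit_left finite_carrier)

abbreviation V :: "nat \<Rightarrow> (nat multiset \<times> 'g) endo" where "V i \<equiv> lmult (gen i)"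
abbreviation H :: "'g \<Rightarrow> (nat multiset \<times> 'g) endo" where "H h \<equiv> lmult (grp h)"

lemma degree_zero_expand:
  assumes "x \<in> degree_le 0" "keys x \<subseteq> B"
  shows "x = (\<Sum>h\<in>carrier G. lookup x ({#}, h) *\<^sub>C grp h)"
proof -
  have "keys x \<subseteq> Pair {#} ` carrier G"
    using assms by (force simp: degree_le_def)
  then have "x = (\<Sum>b\<in>Pair {#} ` carrier G. lookup x b *\<^sub>C basis_vec b)"
    using lin_ext_superset[of "Pair {#} ` carrier G" x basis_vec] finite_carrier
    by (simp add: lin_ext_def basis_expansion)
  then show ?thesis by (simp add: sum.reindex inj_on_def)
qed

end

locale skew_cocycle = skew_model +
  fixes \<mu> :: "(nat multiset \<times> 'a \<Rightarrow>\<^sub>0 complex) \<Rightarrow> (nat multiset \<times> 'a \<Rightarrow>\<^sub>0 complex) \<Rightarrow>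
      (nat multiset \<times> 'a \<Rightarrow>\<^sub>0 complex)"
  assumes mu_linear_left: "clinear (\<lambda>x. \<mu> x y)"
    and mu_linear_right: "clinear (\<lambda>y. \<mu> x y)"
    and mu_outside_right: "b \<notin> B \<Longrightarrow> \<mu> x (basis_vec b) = 0"
    and mu_keys: "keys (\<mu> x y) \<subseteq> B"
    and mu_cocycle: "\<mu> x y \<bullet> z + \<mu> (x \<bullet> y) z = \<mu> x (y \<bullet> z) + x \<bullet> \<mu> y z"
    and mu_degree: "\<mu> (basis_vec b) (basis_vec b') \<in> degree_le (int (size (fst b)) + int (size (fst b')) - 2)"
begin

definition Mu :: "(nat multiset \<times> 'a \<Rightarrow>\<^sub>0 complex) \<Rightarrow> (nat multiset \<times> 'a) endo" where
  "Mu x = Endo (\<mu> x)"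

lemma app_Mu [simp]: "app (Mu x) y = \<mu> x y"
  by (simp add: Mu_def mu_linear_right)

lemmas mu_simps = clinear_simps[OF mu_linear_left] clinear_simps[OF mu_linear_right]

lemma Mu_linear: "clinear Mu"
  by standard (rule endo_eqI; simp add: mu_simps)+

lemmas Mu_simps = clinear_simps[OF Mu_linear]

lemma Mu_pr: "Mu (x \<bullet> y) = Mu x * lmult y + lmult x * Mu y - lmult (\<mu> x y)"
proof (rule endo_eqI)
  fix z
  show "app (Mu (x \<bullet> y)) z = app (Mu x * lmult y + lmult x * Mu y - lmult (\<mu> x y)) z"
    using mu_cocycle[of x y z] by (simp add: algebra_simps)
qed

lemma Mu_H_one [simp]: "Mu x * H \<one> = Mu x"
proof (rule endo_eqI, rule clinear_eq_on_basis[OF clinear_app clinear_app])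
  show "app (Mu x * H \<one>) (basis_vec b) = app (Mu x) (basis_vec b)" for b
    by (cases "b \<in> B") (auto simp: pr_unit_left pr_outside_right mu_outside_right mu_simps)
qed

lemma H_one_Mu [simp]: "H \<one> * Mu x = Mu x"
  by (rule endo_eqI) (simp add: unit_left mu_keys)

lemma mu_degree_zero:
  assumes "size (fst b) + size (fst b') < 2"
  shows "\<mu> (basis_vec b) (basis_vec b') = 0"
  by (rule degree_le_negative[OF mu_degree]) (use assms in auto)

lemma mu_unit: "keys x \<subseteq> B \<Longrightarrow> \<mu> x (grp \<one>) = 0"
  using mu_cocycle[of x "grp \<one>" "grp \<one>"] mu_degree_zero[of "({#}, \<one>)" "({#}, \<one>)"]
  by (simp add: unit_right unit_left mu_keys pr_group pr_simps)

lemma Mu_degree: "raises_degree (int (size (fst b)) - 2) (Mu (basis_vec b))"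
  by (rule raises_degree_basis) (use mu_degree[of b] in \<open>simp add: algebra_simps\<close>)

text \<open>
  The cochain whose coboundary makes the cocycle vanish on group elements in the first argument.
\<close>

definition \<phi> :: "(nat multiset \<times> 'a) endo" where
  "\<phi> = (1 / of_nat (card (carrier G))) *\<^sub>C (\<Sum>h\<in>carrier G. H (inv h) * Mu (grp h))"

lemma phi_degree: "raises_degree (-2) \<phi>"
proof -
  have "raises_degree (0 + (-2)) (H (inv h) * Mu (grp h))" if "h \<in> carrier G" for h
    by (rule raises_degree_mult) (use H_degree that Mu_degree[of "({#}, h)"] in auto)
  then show ?thesis
    by (auto simp: \<phi>_def intro!: raises_degree_scaleC raises_degree_sum)
qed

lemma phi_H_one: "\<phi> * H \<one> = \<phi>" "H \<one> * \<phi> = \<phi>"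
proof -
  show "\<phi> * H \<one> = \<phi>" by (simp add: \<phi>_def sum_distrib_right mult.assoc)
  have "H \<one> * (H (inv h) * Mu (grp h)) = H (inv h) * Mu (grp h)" if "h \<in> carrier G" for h
    using that by (simp add: mult.assoc[symmetric] H_mult)
  then show "H \<one> * \<phi> = \<phi>" by (simp add: \<phi>_def sum_distrib_left)
qed

text \<open>
  Here \<open>\<mu>(h, k) = 0\<close> for reasons of degree.  Multiplying the cocycle identity at \<open>(h, k, s)\<close> by the inverse
  of \<open>h\<close> and averaging over \<open>h\<close> gives \<open>\<mu>(k, s) = k \<phi>(s) - \<phi>(k s)\<close>.
\<close>

lemma Mu_grp:
  assumes k: "k \<in> carrier G"
  shows "Mu (grp k) = H k * \<phi> - \<phi> * H k"
proof -
  let ?c = "1 / of_nat (card (carrier G)) :: complex"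
  have "carrier G \<noteq> {}" using one_closed by blast
  then have c: "?c * of_nat (card (carrier G)) = 1" using finite_carrier by simp
  have "H (inv h) * Mu (grp h) * H k = H (inv h) * Mu (grp (h \<otimes> k)) - Mu (grp k)"
    if h: "h \<in> carrier G" for h
  proof -
    have "Mu (grp h) * H k = Mu (grp (h \<otimes> k)) - H h * Mu (grp k)"
      using Mu_pr[of "grp h" "grp k"] h k mu_degree_zero[of "({#}, h)" "({#}, k)"]
      by (simp add: pr_group lmult_simps algebra_simps)
    then have "H (inv h) * Mu (grp h) * H k = H (inv h) * Mu (grp (h \<otimes> k)) - H (inv h) * H h * Mu (grp k)"
      by (simp add: mult.assoc right_diff_distrib)
    then show ?thesis using h by (simp add: H_mult)
  qed
  then have "\<phi> * H k = ?c *\<^sub>C (\<Sum>h\<in>carrier G. H (inv h) * Mu (grp (h \<otimes> k)) - Mu (grp k))"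
    by (simp add: \<phi>_def sum_distrib_right)
  also have "\<dots> = ?c *\<^sub>C (\<Sum>h\<in>carrier G. H (inv h) * Mu (grp (h \<otimes> k))) - Mu (grp k)"
    using c by (simp add: sum_subtractf sum_const_scaleC scaleC_diff_right del: sum_constant)
  also have "(\<Sum>h\<in>carrier G. H (inv h) * Mu (grp (h \<otimes> k))) = (\<Sum>h\<in>carrier G. H k * (H (inv h) * Mu (grp h)))"
  proof (rule sum.reindex_bij_witness[of _ "\<lambda>h. h \<otimes> inv k" "\<lambda>h. h \<otimes> k"])
    fix h assume "h \<in> carrier G"
    then show "H k * (H (inv (h \<otimes> k)) * Mu (grp (h \<otimes> k))) = H (inv h) * Mu (grp (h \<otimes> k))"
      using k by (simp add: mult.assoc[symmetric] H_mult inv_mult_group m_assoc[symmetric])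
  qed (use k in \<open>auto simp: m_assoc\<close>)
  also have "?c *\<^sub>C \<dots> = H k * \<phi>"
    by (simp add: \<phi>_def sum_distrib_left)
  finally show ?thesis by (simp add: algebra_simps)
qed

text \<open>
  \<open>L1 i\<close> is \<open>s \<mapsto> \<mu>'(v\<^sub>i, s)\<close> for the corrected cocycle \<open>\<mu>'(r, s) = \<mu>(r, s) - r \<phi>(s) + \<phi>(r s) - \<phi>(r) s\<close>, because
  \<open>\<phi>(v\<^sub>i)\<close> has negative degree.
\<close>

definition L1 :: "nat \<Rightarrow> (nat multiset \<times> 'a) endo" where
  "L1 i = Mu (gen i) - V i * \<phi> + \<phi> * V i"

definition \<kappa> :: "nat \<Rightarrow> nat \<Rightarrow> 'a \<Rightarrow> complex" where
  "\<kappa> i j h = lookup (\<mu> (gen i) (gen j) - q i j *\<^sub>C \<mu> (gen j) (gen i)) ({#}, h)"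

sublocale first_order I q G V H a L1 \<kappa>
proof
  show "raises_degree (-1) (L1 i)" if "i \<in> I" for i
  proof -
    have "raises_degree (1 + (-2)) (V i * \<phi>)" "raises_degree (-2 + 1) (\<phi> * V i)"
      by (intro raises_degree_mult V_degree phi_degree that)+
    then show ?thesis
      using Mu_degree[of "({#i#}, \<one>)"] unfolding L1_def
      by (intro raises_degree_add raises_degree_diff) auto
  qed
  show "H h * L1 i = (\<Sum>j\<in>I. a h i j *\<^sub>C (L1 j * H h))" if h: "h \<in> carrier G" and i: "i \<in> I" for h i
  proof -
    have gen_grp: "basis_vec ({#j#}, h) = gen j \<bullet> grp h" if "j \<in> I" for j
      using pr_gen[of j "{#}" h] that h by simp
    have "Mu (grp h \<bullet> gen i) = (\<Sum>j\<in>I. a h i j *\<^sub>C Mu (gen j \<bullet> grp h))"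
      using h i gen_grp by (simp add: pr_group_gen Mu_simps)
    moreover have "Mu (grp h \<bullet> gen i) = Mu (grp h) * V i + H h * Mu (gen i)"
      using mu_degree_zero[of "({#}, h)" "({#i#}, \<one>)"] by (simp add: Mu_pr lmult_simps)
    moreover have "Mu (gen j \<bullet> grp h) = Mu (gen j) * H h + V j * Mu (grp h)" for j
      using mu_degree_zero[of "({#j#}, \<one>)" "({#}, h)"] by (simp add: Mu_pr lmult_simps)
    ultimately have "H h * Mu (gen i)
        = (\<Sum>j\<in>I. a h i j *\<^sub>C (Mu (gen j) * H h + V j * (H h * \<phi> - \<phi> * H h)))
          - (H h * \<phi> - \<phi> * H h) * V i"
      using h by (simp add: Mu_grp algebra_simps)
    moreover have "H h * V i * \<phi> = (\<Sum>j\<in>I. a h i j *\<^sub>C (V j * H h * \<phi>))"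
      "\<phi> * (H h * V i) = (\<Sum>j\<in>I. a h i j *\<^sub>C (\<phi> * V j * H h))"
      by (simp_all add: H_V[OF h i] sum_distrib_left sum_distrib_right mult.assoc)
    ultimately show ?thesis
      by (simp add: L1_def left_diff_distrib right_diff_distrib distrib_left distrib_right mult.assoc
          scaleC_add_right scaleC_diff_right sum.distrib sum_subtractf)
  qed
  show "L1 i * H \<one> = L1 i" if "i \<in> I" for i
    by (simp add: L1_def left_diff_distrib distrib_right mult.assoc phi_H_one)
  show "V i * L1 j + L1 i * V j - q i j *\<^sub>C (V j * L1 i + L1 j * V i)
      = (\<Sum>h\<in>carrier G. \<kappa> i j h *\<^sub>C H h)" if ij: "i \<in> I" "j \<in> I" for i j
  proof -
    let ?k = "\<mu> (gen i) (gen j) - q i j *\<^sub>C \<mu> (gen j) (gen i)"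
    have "?k \<in> degree_le 0"
      using mu_degree[of "({#i#}, \<one>)" "({#j#}, \<one>)"] mu_degree[of "({#j#}, \<one>)" "({#i#}, \<one>)"]
      by (auto intro!: degree_le_diff degree_le_scaleC)
    moreover have "keys ?k \<subseteq> B"
    proof
      fix b assume "b \<in> keys ?k"
      then have "b \<in> keys (\<mu> (gen i) (gen j)) \<or> b \<in> keys (\<mu> (gen j) (gen i))"
        by (auto simp: in_keys_iff lookup_minus)
      then show "b \<in> B" using mu_keys by blast
    qed
    ultimately have "?k = (\<Sum>h\<in>carrier G. \<kappa> i j h *\<^sub>C grp h)"
      unfolding \<kappa>_def by (rule degree_zero_expand)
    then have "lmult ?k = (\<Sum>h\<in>carrier G. \<kappa> i j h *\<^sub>C H h)" by (simp add: lmult_simps)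
    moreover have "gen i \<bullet> gen j = q i j *\<^sub>C (gen j \<bullet> gen i)"
      using arg_cong[OF V_commute[OF ij], of "\<lambda>T. app T (grp \<one>)"] ij by (simp add: pr_unit_right)
    then have "Mu (gen i \<bullet> gen j) = q i j *\<^sub>C Mu (gen j \<bullet> gen i)"
      by (simp add: Mu_simps)
    ultimately have "Mu (gen i) * V j + V i * Mu (gen j)
        - q i j *\<^sub>C (Mu (gen j) * V i + V j * Mu (gen i)) = (\<Sum>h\<in>carrier G. \<kappa> i j h *\<^sub>C H h)"
      by (simp add: Mu_pr lmult_simps scaleC_algebra)
    moreover have "V i * (V j * \<phi>) = q i j *\<^sub>C (V j * (V i * \<phi>))"
      "\<phi> * (V i * V j) = q i j *\<^sub>C (\<phi> * (V j * V i))"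
      by (simp_all add: V_commute[OF ij] mult.assoc[symmetric])
    ultimately show ?thesis
      by (simp add: L1_def left_diff_distrib right_diff_distrib distrib_left distrib_right mult.assoc
          scaleC_add_right scaleC_diff_right algebra_simps)
  qed
qed

end


section \<open>The algebra generated by the lifted operators\<close>

definition fps_raises_degree :: "int \<Rightarrow> (nat multiset \<times> 'z) endo fps \<Rightarrow> bool" where
  "fps_raises_degree d f \<longleftrightarrow> (\<forall>k. raises_degree (d - 2 * int k) (fps_nth f k))"

lemma fps_raises_degree_mult:
  assumes "fps_raises_degree d f" "fps_raises_degree e g"
  shows "fps_raises_degree (d + e) (f * g)"
  unfolding fps_raises_degree_def fps_mult_nth
proof (intro allI raises_degree_sum)
  fix k b :: nat assume "b \<in> {0..k}"
  then have "(d - 2 * int b) + (e - 2 * int (k - b)) = d + e - 2 * int k" by auto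
  moreover have "raises_degree ((d - 2 * int b) + (e - 2 * int (k - b))) (fps_nth f b * fps_nth g (k - b))"
    by (rule raises_degree_mult) (use assms in \<open>auto simp: fps_raises_degree_def\<close>)
  ultimately show "raises_degree (d + e - 2 * int k) (fps_nth f b * fps_nth g (k - b))"
    by (simp only:)
qed

lemma fps_raises_degree_add:
  "fps_raises_degree d f \<Longrightarrow> fps_raises_degree d g \<Longrightarrow> fps_raises_degree d (f + g)"
  by (simp add: fps_raises_degree_def raises_degree_add)

lemma fps_raises_degree_scaleC: "fps_raises_degree d f \<Longrightarrow> fps_raises_degree d (c *\<^sub>C f)"
  by (simp add: fps_raises_degree_def raises_degree_scaleC)

lemma fps_raises_degree_mono: "fps_raises_degree d f \<Longrightarrow> d \<le> e \<Longrightarrow> fps_raises_degree e f"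
  unfolding fps_raises_degree_def by (meson diff_right_mono raises_degree_mono)

lemma fps_raises_degree_X: "fps_raises_degree 2 fps_X"
  by (auto simp: fps_raises_degree_def fps_X_def raises_degree_def)

text \<open>
  Operators that obey the relations of the deformed algebra and whose coefficients of \<open>t\<close> are
  given by \<open>\<mu>\<close> itself, not by a cohomologous cocycle.
\<close>

locale star_generators = skew_cocycle I q G pr a \<mu>
  for I q and G :: "('g, 'm) monoid_scheme" (structure) and pr (infixl \<open>\<bullet>\<close> 70) and a \<mu> +
  fixes X :: "nat \<Rightarrow> (nat multiset \<times> 'g) endo fps" and U :: "'g \<Rightarrow> (nat multiset \<times> 'g) endo fps"
    and c :: "nat \<Rightarrow> nat \<Rightarrow> 'g \<Rightarrow> complex"
  assumes X_0: "i \<in> I \<Longrightarrow> fps_nth (X i) 0 = V i" and X_1: "i \<in> I \<Longrightarrow> fps_nth (X i) 1 = Mu (gen i)"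
    and U_0: "h \<in> carrier G \<Longrightarrow> fps_nth (U h) 0 = H h"
    and U_1: "h \<in> carrier G \<Longrightarrow> fps_nth (U h) 1 = Mu (grp h)"
    and X_degree: "i \<in> I \<Longrightarrow> fps_raises_degree 1 (X i)"
    and U_degree: "h \<in> carrier G \<Longrightarrow> fps_raises_degree 0 (U h)"
    and U_mult: "h \<in> carrier G \<Longrightarrow> k \<in> carrier G \<Longrightarrow> U h * U k = U (h \<otimes> k)"
    and U_X: "h \<in> carrier G \<Longrightarrow> i \<in> I \<Longrightarrow> U h * X i = (\<Sum>j\<in>I. a h i j *\<^sub>C (X j * U h))"
    and X_X: "i \<in> I \<Longrightarrow> j \<in> I \<Longrightarrow>
      X i * X j = q i j *\<^sub>C (X j * X i) + fps_X * (\<Sum>h\<in>carrier G. c i j h *\<^sub>C U h)"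
    and U_one: "U \<one> = fps_const (H \<one>)"
    and U_one_X: "i \<in> I \<Longrightarrow> U \<one> * X i = X i"
begin

text \<open>
  The \<open>\<complex>[t]\<close>-algebra generated by the operators.  Closure under left multiplication by the
  \<open>X\<^sub>i\<close> suffices, because the \<open>U\<^sub>h\<close> can be moved to the right.
\<close>

inductive_set alg :: "(nat multiset \<times> 'g) endo fps set" where
  alg_zero: "0 \<in> alg"
| alg_U: "h \<in> carrier G \<Longrightarrow> U h \<in> alg"
| alg_add: "S \<in> alg \<Longrightarrow> T \<in> alg \<Longrightarrow> S + T \<in> alg"
| alg_scale: "T \<in> alg \<Longrightarrow> d *\<^sub>C T \<in> alg"
| alg_X: "i \<in> I \<Longrightarrow> T \<in> alg \<Longrightarrow> X i * T \<in> alg"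
| alg_shift: "T \<in> alg \<Longrightarrow> fps_X * T \<in> alg"

lemma alg_sum: "(\<And>x. x \<in> A \<Longrightarrow> f x \<in> alg) \<Longrightarrow> sum f A \<in> alg"
  by (induction A rule: infinite_finite_induct) (auto intro: alg_zero alg_add)

lemma alg_diff: "S \<in> alg \<Longrightarrow> T \<in> alg \<Longrightarrow> S - T \<in> alg"
  using alg_add[of S "(-1) *\<^sub>C T"] alg_scale[of T "-1"] by simp

lemma alg_shift_power: "T \<in> alg \<Longrightarrow> fps_X ^ k * T \<in> alg"
  by (induction k) (auto simp: mult.assoc intro: alg_shift)

lemma shift_commute: "T * (fps_X * S) = fps_X * (T * S)" for S T :: "(nat multiset \<times> 'g) endo fps"
  by (metis fps_mult_fps_X_commute mult.assoc)

lemma alg_U_mult: "T \<in> alg \<Longrightarrow> h \<in> carrier G \<Longrightarrow> U h * T \<in> alg"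
proof (induction rule: alg.induct)
  case (alg_X i T)
  have "U h * (X i * T) = (\<Sum>j\<in>I. a h i j *\<^sub>C (X j * (U h * T)))"
    using alg_X by (simp add: mult.assoc[symmetric] U_X sum_distrib_right)
  then show ?case using alg_X by (auto intro: alg_sum alg_scale alg.alg_X)
qed (auto simp: U_mult distrib_left shift_commute intro: alg.intros)

lemma alg_mult: "S \<in> alg \<Longrightarrow> T \<in> alg \<Longrightarrow> S * T \<in> alg"
  by (induction rule: alg.induct)
    (auto simp: distrib_right mult.assoc alg_U_mult intro: alg.intros)

lemma alg_unit: "T \<in> alg \<Longrightarrow> fps_const (H \<one>) * T = T" "T \<in> alg \<Longrightarrow> T * fps_const (H \<one>) = T"
proof -
  show "fps_const (H \<one>) * T = T" if "T \<in> alg"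
    using that
  proof (induction rule: alg.induct)
    case (alg_X i T)
    then show ?case using U_one_X[of i] by (simp add: U_one mult.assoc[symmetric])
  qed (auto simp: U_one[symmetric] U_mult distrib_left shift_commute)
  show "T * fps_const (H \<one>) = T" if "T \<in> alg"
    using that
    by (induction rule: alg.induct) (auto simp: U_one[symmetric] U_mult distrib_right mult.assoc)
qed

lemma alg_degree: "T \<in> alg \<Longrightarrow> \<exists>d. fps_raises_degree d T"
proof (induction rule: alg.induct)
  case (alg_add S T)
  then obtain d e where "fps_raises_degree d S" "fps_raises_degree e T" by blast
  then have "fps_raises_degree (max d e) (S + T)"
    by (intro fps_raises_degree_add) (auto elim: fps_raises_degree_mono)
  then show ?case ..
next
  case (alg_X i T)
  then show ?case using X_degree fps_raises_degree_mult by blast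
next
  case (alg_shift T)
  then show ?case using fps_raises_degree_X fps_raises_degree_mult by blast
next
  case (alg_scale T d)
  then show ?case using fps_raises_degree_scaleC by blast
next
  case (alg_U h)
  then show ?case using U_degree by blast
qed (auto simp: fps_raises_degree_def)

text \<open>
  The lift of the basis vector \<open>v\<^sub>A g\<close> of \<open>R\<close>, with its letters in increasing order.
\<close>

definition sorted_op :: "nat multiset \<times> 'g \<Rightarrow> (nat multiset \<times> 'g) endo fps" where
  "sorted_op b = foldr (\<lambda>i T. X i * T) (sorted_list_of_multiset (fst b)) (U (snd b))"

lemma sorted_op_empty [simp]: "sorted_op ({#}, g) = U g"
  by (simp add: sorted_op_def)

lemma sorted_op_add:
  "(\<And>j. j \<in># A \<Longrightarrow> i \<le> j) \<Longrightarrow> sorted_op (add_mset i A, g) = X i * sorted_op (A, g)"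
  by (simp add: sorted_op_def insort_is_Cons)

lemma basis_induct [consumes 1, case_names empty add]:
  assumes "b \<in> B"
    and "\<And>g. g \<in> carrier G \<Longrightarrow> P ({#}, g)"
    and "\<And>i A g. i \<in> I \<Longrightarrow> set_mset A \<subseteq> I \<Longrightarrow> g \<in> carrier G \<Longrightarrow> (\<And>j. j \<in># A \<Longrightarrow> i \<le> j) \<Longrightarrow>
      P (A, g) \<Longrightarrow> P (add_mset i A, g)"
  shows "P b"
proof -
  obtain A g where b: "b = (A, g)" "set_mset A \<subseteq> I" "g \<in> carrier G" using assms(1) by auto
  have "P (A, g)" using b(2)
  proof (induction "size A" arbitrary: A)
    case 0
    then show ?case using assms(2) b by simp
  next
    case (Suc m)
    show ?case
    proof (cases A rule: multiset_min_cases)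
      case (add i A')
      then show ?thesis using Suc assms(3)[of i A' g] b by simp
    qed (use Suc in simp)
  qed
  then show ?thesis using b by simp
qed

lemma sorted_op_alg: "b \<in> B \<Longrightarrow> sorted_op b \<in> alg"
  by (induction rule: basis_induct) (auto simp: sorted_op_add intro: alg.intros)

lemma sorted_op_degree: "b \<in> B \<Longrightarrow> fps_raises_degree (int (size (fst b))) (sorted_op b)"
proof (induction rule: basis_induct)
  case (add i A g)
  then show ?case
    using fps_raises_degree_mult[OF X_degree[of i], of "int (size A)" "sorted_op (A, g)"]
    by (simp add: sorted_op_add algebra_simps)
qed (use U_degree in auto)

lemma sorted_op_0: "b \<in> B \<Longrightarrow> app (fps_nth (sorted_op b) 0) (grp \<one>) = basis_vec b"
proof (induction rule: basis_induct)
  case (empty g)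
  then show ?case by (simp add: U_0 pr_group)
next
  case (add i A g)
  then show ?case by (simp add: sorted_op_add X_0 pr_gen move_coeff_le)
qed

lemma X_sorted_op:
  assumes "i \<in> I" "set_mset A \<subseteq> I" "g \<in> carrier G"
  shows "\<exists>S\<in>alg. X i * sorted_op (A, g)
    = move_coeff q i A *\<^sub>C sorted_op (add_mset i A, g) + fps_X * S"
  using assms(2)
proof (induction "size A" arbitrary: A rule: less_induct)
  case less
  show ?case
  proof (cases "\<forall>j. j \<in># A \<longrightarrow> i \<le> j")
    case True
    then show ?thesis
      by (intro bexI[of _ 0]) (simp_all add: sorted_op_add move_coeff_le alg_zero)
  next
    case False
    then obtain k A' where A: "A = add_mset k A'" and k: "\<And>j. j \<in># A' \<Longrightarrow> k \<le> j"
      by (cases A rule: multiset_min_cases) auto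
    have ki: "k < i" using False A k by fastforce
    have kI: "k \<in> I" and A': "set_mset A' \<subseteq> I" using less.prems A by auto
    let ?N = "sorted_op (A', g)" and ?m = "move_coeff q i A'"
    obtain S where S: "S \<in> alg" "X i * ?N = ?m *\<^sub>C sorted_op (add_mset i A', g) + fps_X * S"
      using less.hyps[of A'] A A' by auto
    let ?S = "q i k *\<^sub>C (X k * S) + (\<Sum>h\<in>carrier G. c i k h *\<^sub>C (U h * ?N))"
    have N: "?N \<in> alg" by (rule sorted_op_alg) (use A' assms in auto)
    have "sorted_op (A, g) = X k * ?N" unfolding A by (rule sorted_op_add) (rule k)
    then have "X i * sorted_op (A, g) = (X i * X k) * ?N" by (simp add: mult.assoc)
    also have "\<dots> = q i k *\<^sub>C (X k * (X i * ?N)) + fps_X * (\<Sum>h\<in>carrier G. c i k h *\<^sub>C (U h * ?N))"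
      unfolding X_X[OF assms(1) kI] by (simp add: distrib_right mult.assoc sum_distrib_right)
    also have "X k * (X i * ?N) = ?m *\<^sub>C sorted_op (add_mset k (add_mset i A'), g) + fps_X * (X k * S)"
    proof -
      have "sorted_op (add_mset k (add_mset i A'), g) = X k * sorted_op (add_mset i A', g)"
        by (rule sorted_op_add) (use k ki in \<open>auto simp: less_imp_le\<close>)
      then show ?thesis by (simp add: S distrib_left shift_commute)
    qed
    finally have "X i * sorted_op (A, g)
        = move_coeff q i A *\<^sub>C sorted_op (add_mset i A, g) + fps_X * ?S"
      using ki by (simp add: A scaleC_add_right distrib_left add_mset_commute)
    moreover have "?S \<in> alg"
      using S N kI by (intro alg_add alg_scale alg_X alg_sum alg_U_mult) auto
    ultimately show ?thesis by blast
  qed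
qed

text \<open>
  Flatness.  Words in the generators are rewritten as sorted ones by means of the relations, and
  each application of a relation leaves a remainder that is \<open>t\<close> times an element of the algebra.
\<close>

lemma alg_mod_shift:
  assumes "T \<in> alg"
  shows "\<exists>x. keys x \<subseteq> B \<and> (\<exists>S\<in>alg. T = lin_ext sorted_op x + fps_X * S)"
  using assms
proof (induction rule: alg.induct)
  case alg_zero
  show ?case
    by (rule exI[of _ 0]) (auto simp: clinear_simps[OF clinear_lin_ext] intro!: bexI[of _ 0] alg.alg_zero)
next
  case (alg_U h)
  then show ?case
    by (intro exI[of _ "grp h"]) (auto intro!: bexI[of _ 0] alg.alg_zero)
next
  case (alg_add S T)
  then obtain x S' y T' where "keys x \<subseteq> B" "S' \<in> alg" "S = lin_ext sorted_op x + fps_X * S'"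
    "keys y \<subseteq> B" "T' \<in> alg" "T = lin_ext sorted_op y + fps_X * T'" by blast
  then show ?case
    by (intro exI[of _ "x + y"] conjI bexI[of _ "S' + T'"])
      (use Poly_Mapping.keys_add[of x y] in
        \<open>auto simp: clinear_simps[OF clinear_lin_ext] distrib_left intro: alg.alg_add\<close>)
next
  case (alg_scale T d)
  then obtain x S where "keys x \<subseteq> B" "S \<in> alg" "T = lin_ext sorted_op x + fps_X * S" by blast
  then show ?case
    by (intro exI[of _ "d *\<^sub>C x"] conjI bexI[of _ "d *\<^sub>C S"])
      (auto simp: clinear_simps[OF clinear_lin_ext] scaleC_add_right in_keys_iff intro: alg.alg_scale)
next
  case (alg_X i T)
  then obtain x S where x: "keys x \<subseteq> B" and S: "S \<in> alg" "T = lin_ext sorted_op x + fps_X * S"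
    by blast
  have "\<exists>R. R \<in> alg \<and> X i * sorted_op b = lin_ext sorted_op (gen i \<bullet> basis_vec b) + fps_X * R"
    if "b \<in> keys x" for b
  proof -
    have b: "b \<in> B" using x that by auto
    then show ?thesis
      using X_sorted_op[OF alg_X.hyps(1), of "fst b" "snd b"] pr_gen[OF alg_X.hyps(1), of "fst b" "snd b"]
      by (auto simp: clinear_simps[OF clinear_lin_ext])
  qed
  then obtain R where R: "\<And>b. b \<in> keys x \<Longrightarrow> R b \<in> alg"
    "\<And>b. b \<in> keys x \<Longrightarrow>
      X i * sorted_op b = lin_ext sorted_op (gen i \<bullet> basis_vec b) + fps_X * R b" by metis
  have "X i * lin_ext sorted_op x = (\<Sum>b\<in>keys x. lookup x b *\<^sub>C
      (lin_ext sorted_op (gen i \<bullet> basis_vec b) + fps_X * R b))"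
    by (simp add: lin_ext_def[of _ x] sum_distrib_left R(2))
  also have "\<dots> = lin_ext sorted_op (\<Sum>b\<in>keys x. lookup x b *\<^sub>C (gen i \<bullet> basis_vec b))
      + fps_X * (\<Sum>b\<in>keys x. lookup x b *\<^sub>C R b)"
    by (simp add: clinear_simps[OF clinear_lin_ext] scaleC_add_right sum.distrib sum_distrib_left)
  also have "(\<Sum>b\<in>keys x. lookup x b *\<^sub>C (gen i \<bullet> basis_vec b)) = gen i \<bullet> x"
    by (rule clinear_expand[OF pr_linear_right, symmetric])
  finally have "X i * T = lin_ext sorted_op (gen i \<bullet> x)
      + fps_X * ((\<Sum>b\<in>keys x. lookup x b *\<^sub>C R b) + X i * S)"
    by (simp add: S distrib_left shift_commute)
  moreover have "(\<Sum>b\<in>keys x. lookup x b *\<^sub>C R b) + X i * S \<in> alg"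
    using R S alg_X by (intro alg_add alg.alg_X alg_sum alg_scale) auto
  ultimately show ?case using pr_keys by blast
next
  case (alg_shift T)
  then show ?case
    by (intro exI[of _ 0]) (auto simp: clinear_simps[OF clinear_lin_ext])
qed

lemma lin_ext_sorted_op_0:
  "keys x \<subseteq> B \<Longrightarrow> app (fps_nth (lin_ext sorted_op x) 0) (grp \<one>) = x"
  by (rule clinear_eq_on_basis[where g = "\<lambda>x. x"])
    (auto simp: clinear_def clinear_simps[OF clinear_lin_ext] sorted_op_0)

text \<open>
  An operator that kills 1 has no sorted part modulo \<open>t\<close>, so by flatness it is \<open>t\<close> times another element of
  the algebra that kills 1; repeating this shows that all its coefficients vanish.
\<close>

lemma alg_eval_injective:
  assumes "T \<in> alg" "\<And>k. app (fps_nth T k) (grp \<one>) = 0"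
  shows "T = 0"
proof (rule fps_ext)
  fix k
  have "fps_nth T k = 0" using assms
  proof (induction k arbitrary: T)
    case 0
    obtain x S where x: "keys x \<subseteq> B" "T = lin_ext sorted_op x + fps_X * S"
      using alg_mod_shift[OF 0(1)] by blast
    then have "x = 0" using lin_ext_sorted_op_0[OF x(1)] 0(2)[of 0] by simp
    then show ?case using x by (simp add: clinear_simps[OF clinear_lin_ext])
  next
    case (Suc k)
    obtain x S where x: "keys x \<subseteq> B" "T = lin_ext sorted_op x + fps_X * S" "S \<in> alg"
      using alg_mod_shift[OF Suc.prems(1)] by blast
    then have "x = 0" using lin_ext_sorted_op_0[OF x(1)] Suc.prems(2)[of 0] by simp
    then have T: "T = fps_X * S" using x by (simp add: clinear_simps[OF clinear_lin_ext])
    have "app (fps_nth S l) (grp \<one>) = 0" for l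
      using Suc.prems(2)[of "Suc l"] by (simp add: T)
    then show ?case using Suc.IH[OF x(3)] by (simp add: T)
  qed
  then show "fps_nth T k = fps_nth 0 k" by simp
qed

lemma alg_eval_keys:
  assumes "T \<in> alg"
  shows "keys (app (fps_nth T k) x) \<subseteq> B"
proof -
  have "fps_nth T k = H \<one> * fps_nth T k"
    using arg_cong[OF alg_unit(1)[OF assms], of "\<lambda>f. fps_nth f k"] by simp
  then show ?thesis using pr_keys by (metis app_endo_simps(4) app_lmult)
qed

text \<open>
  The lift of \<open>x\<close> sends 1 to \<open>x\<close> plus multiples of positive powers of \<open>t\<close> whose coefficients have lower degree
  than \<open>x\<close>; these are removed by induction on the degree.
\<close>

lemma alg_eval_surjective:
  assumes "keys x \<subseteq> B"
  shows "\<exists>T\<in>alg. \<forall>k. app (fps_nth T k) (grp \<one>) = (if k = 0 then x else 0)"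
proof -
  have "\<exists>T\<in>alg. \<forall>k. app (fps_nth T k) (grp \<one>) = (if k = 0 then x else 0)"
    if "x \<in> degree_le (int N)" "keys x \<subseteq> B" for N
    using that
  proof (induction N arbitrary: x rule: less_induct)
    case (less N)
    let ?T0 = "lin_ext sorted_op x"
    define y where "y k = app (fps_nth ?T0 k) (grp \<one>)" for k
    have T0: "?T0 \<in> alg"
      unfolding lin_ext_def using less.prems by (intro alg_sum alg_scale sorted_op_alg) auto
    have y_degree: "y k \<in> degree_le (int N - 2 * int k)" for k
    proof -
      have "raises_degree (int N - 2 * int k) (fps_nth ?T0 k)"
        unfolding lin_ext_def fps_sum_nth fps_nth_scaleC
      proof (intro raises_degree_sum raises_degree_scaleC)
        fix b assume "b \<in> keys x"
        then have "b \<in> B" "int (size (fst b)) \<le> int N"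
          using less.prems by (auto simp: degree_le_def)
        then show "raises_degree (int N - 2 * int k) (fps_nth (sorted_op b) k)"
          using fps_raises_degree_mono[OF sorted_op_degree[of b], of "int N"]
          by (simp add: fps_raises_degree_def)
      qed
      then show ?thesis
        using raises_degreeD[of "int N - 2 * int k" "fps_nth ?T0 k" "grp \<one>" 0] by (simp add: y_def)
    qed
    have "\<exists>T. T \<in> alg \<and> (\<forall>l. app (fps_nth T l) (grp \<one>) = (if l = 0 then y k else 0))"
      if "1 \<le> k" for k
    proof (cases "2 * k \<le> N")
      case True
      then have "y k \<in> degree_le (int (N - 2 * k))"
        using y_degree[of k] by (simp add: of_nat_diff)
      moreover have "keys (y k) \<subseteq> B"
        unfolding y_def by (rule alg_eval_keys[OF T0])
      ultimately show ?thesis using less.IH[of "N - 2 * k" "y k"] that True by auto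
    next
      case False
      then have "y k = 0" by (intro degree_le_negative[OF y_degree]) simp
      then show ?thesis using alg_zero by (intro exI[of _ 0]) auto
    qed
    then obtain S where S: "\<And>k. 1 \<le> k \<Longrightarrow> S k \<in> alg"
      "\<And>k l. 1 \<le> k \<Longrightarrow> app (fps_nth (S k) l) (grp \<one>) = (if l = 0 then y k else 0)" by metis
    let ?T = "?T0 - (\<Sum>k\<in>{1..N}. fps_X ^ k * S k)"
    have "?T \<in> alg" using T0 S(1) by (auto intro!: alg_diff alg_sum alg_shift_power)
    moreover have "app (fps_nth ?T l) (grp \<one>) = (if l = 0 then x else 0)" for l
    proof -
      have "app (fps_nth (fps_X ^ k * S k) l) (grp \<one>) = (if k = l then y l else 0)" if "1 \<le> k" for k
        using S(2)[OF that, of "l - k"] by (auto simp: fps_X_power_mult_nth)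
      then have "(\<Sum>k\<in>{1..N}. app (fps_nth (fps_X ^ k * S k) l) (grp \<one>))
          = (\<Sum>k\<in>{1..N}. if k = l then y l else 0)"
        by (intro sum.cong refl) auto
      then have "app (fps_nth ?T l) (grp \<one>) = y l - (\<Sum>k\<in>{1..N}. if k = l then y l else 0)"
        by (simp only: y_def fps_sub_nth fps_sum_nth app_endo_simps app_endo_sum)
      also have "\<dots> = (if l = 0 then x else 0)"
      proof (cases "l = 0")
        case True
        then show ?thesis using lin_ext_sorted_op_0[OF less.prems(2)] by (simp add: y_def)
      next
        case False
        moreover have "y l = 0" if "N < l"
          by (rule degree_le_negative[OF y_degree]) (use that in simp)
        ultimately show ?thesis by (cases "N < l") auto
      qed
      finally show ?thesis .
    qed
    ultimately show ?case by blast
  qed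
  moreover obtain N where "x \<in> degree_le N" using degree_le_ex by blast
  then have "x \<in> degree_le (int (nat N))" by (rule degree_le_mono) simp
  ultimately show ?thesis using assms by blast
qed

text \<open>
  Left multiplication by \<open>x\<close> in the deformed algebra: the operator in the algebra that sends 1 to \<open>x\<close>.
  The factor \<open>grp \<one>\<close> discards superfluous basis vectors.
\<close>

definition op :: "(nat multiset \<times> 'g \<Rightarrow>\<^sub>0 complex) \<Rightarrow> (nat multiset \<times> 'g) endo fps" where
  "op x = (THE T. T \<in> alg \<and> (\<forall>k. app (fps_nth T k) (grp \<one>) = (if k = 0 then grp \<one> \<bullet> x else 0)))"

lemma op_eqI:
  assumes "T \<in> alg" "\<And>k. app (fps_nth T k) (grp \<one>) = (if k = 0 then grp \<one> \<bullet> x else 0)"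
  shows "op x = T"
  unfolding op_def
proof (rule the_equality)
  fix S assume "S \<in> alg \<and> (\<forall>k. app (fps_nth S k) (grp \<one>) = (if k = 0 then grp \<one> \<bullet> x else 0))"
  then have "S - T = 0" using assms by (intro alg_eval_injective alg_diff) auto
  then show "S = T" by simp
qed (use assms in auto)

lemma op: "op x \<in> alg" "app (fps_nth (op x) k) (grp \<one>) = (if k = 0 then grp \<one> \<bullet> x else 0)"
proof -
  obtain T where "T \<in> alg" "\<And>k. app (fps_nth T k) (grp \<one>) = (if k = 0 then grp \<one> \<bullet> x else 0)"
    using alg_eval_surjective[OF pr_keys, of "grp \<one>" x] by blast
  then show "op x \<in> alg" "app (fps_nth (op x) k) (grp \<one>) = (if k = 0 then grp \<one> \<bullet> x else 0)"
    using op_eqI[of T x] by simp_all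
qed

lemma op_linear: "clinear op"
proof
  show "op (x + y) = op x + op y" for x y
    by (rule op_eqI) (simp_all add: op alg_add pr_simps)
  show "op (d *\<^sub>C x) = d *\<^sub>C op x" for d x
    by (rule op_eqI) (simp_all add: op alg_scale pr_simps)
qed

definition star :: "nat \<Rightarrow> (nat multiset \<times> 'g \<Rightarrow>\<^sub>0 complex) \<Rightarrow> (nat multiset \<times> 'g \<Rightarrow>\<^sub>0 complex) \<Rightarrow>
    (nat multiset \<times> 'g \<Rightarrow>\<^sub>0 complex)" where
  "star k x y = app (fps_nth (op x) k) y"

lemma star_keys: "keys (star k x y) \<subseteq> B"
  unfolding star_def by (rule alg_eval_keys) (rule op)

lemma star_linear_left: "clinear (\<lambda>x. star k x y)"
  by standard (simp_all add: star_def clinear_simps[OF op_linear])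

lemma star_linear_right: "clinear (star k x)"
  by standard (simp_all add: star_def)

lemma star_unit_right_arg: "star k x (grp \<one> \<bullet> y) = star k x y"
  using arg_cong[OF alg_unit(2)[OF op(1)[of x]], of "\<lambda>f. app (fps_nth f k) y"]
  by (simp add: star_def)

lemma star_finite: "\<exists>K. \<forall>k>K. star k x y = 0"
proof -
  obtain d where d: "fps_raises_degree d (op x)" using alg_degree[OF op(1)] by blast
  obtain N where N: "y \<in> degree_le N" using degree_le_ex by blast
  have "star k x y = 0" if "nat (N + d) < k" for k
  proof (rule degree_le_negative)
    show "star k x y \<in> degree_le (N + (d - 2 * int k))"
      unfolding star_def using d N by (auto simp: fps_raises_degree_def intro: raises_degreeD)
  qed (use that in linarith)
  then show ?thesis by blast
qed

text \<open>
  Both sides are coefficients of elements of the algebra, and these agree at 1.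
\<close>

lemma op_star:
  "fps_nth (op x * op y) l = (\<Sum>k\<le>l. fps_nth (op (star k x y)) (l - k))"
proof -
  obtain K where K: "\<And>k. k > K \<Longrightarrow> star k x y = 0" using star_finite by blast
  let ?S = "\<Sum>k\<le>K. fps_X ^ k * op (star k x y)"
  have "op x * op y - ?S = 0"
  proof (rule alg_eval_injective)
    show "op x * op y - ?S \<in> alg"
      by (intro alg_diff alg_mult alg_sum alg_shift_power op)
    fix k
    have "app (fps_nth (op x * op y) k) (grp \<one>)
        = (\<Sum>i=0..k. if i = k then star k x (grp \<one> \<bullet> y) else 0)"
      unfolding fps_mult_nth app_endo_sum
      by (rule sum.cong) (auto simp: op star_def)
    moreover have "app (fps_nth (fps_X ^ i * op (star i x y)) k) (grp \<one>)
        = (if i = k then star k x y else 0)" for i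
      by (auto simp: fps_X_power_mult_nth op unit_left star_keys)
    then have "app (fps_nth ?S k) (grp \<one>) = (\<Sum>i\<le>K. if i = k then star k x y else 0)"
      by (simp only: fps_sum_nth app_endo_sum)
    moreover have "(\<Sum>i\<le>K. if i = k then star k x y else 0) = star k x y"
      using K[of k] by (cases "k \<le> K") auto
    ultimately show "app (fps_nth (op x * op y - ?S) k) (grp \<one>) = 0"
      by (simp add: star_unit_right_arg)
  qed
  then have "fps_nth (op x * op y) l = (\<Sum>k\<le>K. if k \<le> l then fps_nth (op (star k x y)) (l - k) else 0)"
    by (auto simp: fps_sum_nth fps_X_power_mult_nth intro!: sum.cong)
  also have "\<dots> = (\<Sum>k\<le>max K l. if k \<le> l then fps_nth (op (star k x y)) (l - k) else 0)"
    by (rule sum.mono_neutral_left) (auto simp: K clinear_simps[OF op_linear])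
  also have "\<dots> = (\<Sum>k\<le>l. if k \<le> l then fps_nth (op (star k x y)) (l - k) else 0)"
    by (rule sum.mono_neutral_right) auto
  finally show ?thesis by simp
qed

lemma star_assoc: "(\<Sum>k\<le>l. star (l - k) (star k x y) z) = (\<Sum>k\<le>l. star k x (star (l - k) y z))"
  using arg_cong[OF op_star[of x y l], of "\<lambda>T. app T z"]
  by (simp add: fps_mult_nth star_def atLeast0AtMost)

text \<open>
  By the cocycle identity, the operators whose first two coefficients are \<open>x\<close> and
  \<open>\<mu>(x, _) + y\<close> are closed under multiplication by the generators.
\<close>

lemma alg_first_order:
  assumes "T \<in> alg"
  shows "\<exists>x y. keys x \<subseteq> B \<and> keys y \<subseteq> B \<and>
    fps_nth T 0 = lmult x \<and> fps_nth T 1 = Mu x + lmult y"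
  using assms
proof (induction rule: alg.induct)
  case alg_zero
  show ?case by (intro exI[of _ 0]) (simp add: lmult_simps Mu_simps)
next
  case (alg_U h)
  then show ?case
    by (rule_tac exI[of _ "grp h"], rule_tac exI[of _ 0]) (use U_1[of h] in \<open>auto simp: U_0 lmult_simps\<close>)
next
  case (alg_add S T)
  then obtain x y x' y' where "keys x \<subseteq> B" "keys y \<subseteq> B"
    "fps_nth S 0 = lmult x" "fps_nth S 1 = Mu x + lmult y"
    "keys x' \<subseteq> B" "keys y' \<subseteq> B"
    "fps_nth T 0 = lmult x'" "fps_nth T 1 = Mu x' + lmult y'" by blast
  then show ?case
    by (rule_tac exI[of _ "x + x'"], rule_tac exI[of _ "y + y'"])
      (simp add: lmult_simps Mu_simps keys_add_subset)
next
  case (alg_scale T d)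
  then obtain x y where "keys x \<subseteq> B" "keys y \<subseteq> B"
    "fps_nth T 0 = lmult x" "fps_nth T 1 = Mu x + lmult y" by blast
  then show ?case
    by (rule_tac exI[of _ "d *\<^sub>C x"], rule_tac exI[of _ "d *\<^sub>C y"])
      (auto simp: lmult_simps Mu_simps scaleC_add_right in_keys_iff)
next
  case (alg_X i T)
  then obtain x y where xy: "fps_nth T 0 = lmult x" "fps_nth T 1 = Mu x + lmult y" by blast
  have "fps_nth (X i * T) 1 = V i * Mu x + V i * lmult y + Mu (gen i) * lmult x"
    using X_1[OF alg_X(1)] xy by (simp add: X_0 alg_X distrib_left)
  also have "\<dots> = Mu (gen i \<bullet> x) + lmult (\<mu> (gen i) x + gen i \<bullet> y)"
    by (simp add: Mu_pr lmult_simps lmult_pr algebra_simps)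
  finally have "fps_nth (X i * T) 1 = Mu (gen i \<bullet> x) + lmult (\<mu> (gen i) x + gen i \<bullet> y)" .
  moreover have "keys (\<mu> (gen i) x + gen i \<bullet> y) \<subseteq> B"
    using Poly_Mapping.keys_add[of "\<mu> (gen i) x" "gen i \<bullet> y"] mu_keys pr_keys by blast
  moreover have "fps_nth (X i * T) 0 = lmult (gen i \<bullet> x)"
    using alg_X xy by (simp add: X_0 lmult_pr)
  ultimately show ?case using pr_keys by blast
next
  case (alg_shift T)
  then obtain x where x: "keys x \<subseteq> B" "fps_nth T 0 = lmult x" by blast
  then show ?case
    by (rule_tac exI[of _ 0], rule_tac exI[of _ x]) (simp add: lmult_simps Mu_simps)
qed

lemma star_0_1: "star 0 x y = x \<bullet> y" "star 1 x y = \<mu> (grp \<one> \<bullet> x) y"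
proof -
  obtain u w where uw: "keys u \<subseteq> B" "keys w \<subseteq> B"
    "fps_nth (op x) 0 = lmult u" "fps_nth (op x) 1 = Mu u + lmult w"
    using alg_first_order[OF op(1)] by blast
  have u: "u = grp \<one> \<bullet> x" using op(2)[of x 0] uw by (simp add: unit_right)
  then show "star 0 x y = x \<bullet> y"
    using uw by (simp add: star_def pr_assoc) (metis pr_keys unit_left)
  have "w = 0" using op(2)[of x 1] uw by (simp add: unit_right mu_unit)
  then show "star 1 x y = \<mu> (grp \<one> \<bullet> x) y"
    using uw u by (simp add: star_def lmult_simps)
qed

lemma star_one_left: "star k (grp \<one>) y = (if k = 0 then grp \<one> \<bullet> y else 0)"
proof -
  have "op (grp \<one>) = U \<one>"
    by (rule op_eqI[OF alg_U[OF one_closed]]) (simp add: U_one pr_group)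
  then show ?thesis by (simp add: star_def U_one)
qed

lemma star_one_right: "star k x (grp \<one>) = (if k = 0 then grp \<one> \<bullet> x else 0)"
  by (simp add: star_def op)

end

context skew_cocycle
begin

text \<open>
  Conjugation by \<open>\<Phi> = 1 + t \<phi>\<close> preserves the relations, and it replaces the coefficient \<open>T\<^sub>1\<close> of \<open>t\<close> by
  \<open>T\<^sub>1 + T\<^sub>0 \<phi> - \<phi> T\<^sub>0\<close>.  On \<open>X\<^sub>i\<close> this cancels the correction in \<open>L1\<close>, and on the constant operators \<open>U\<^sub>h\<close>
  it produces \<open>\<mu>(h, _)\<close> by \<open>Mu_grp\<close>.
\<close>

lemma star_generators_exist:
  obtains X U c where "star_generators I q G pr a \<mu> X U c"
proof -
  obtain Y where Y: "\<And>k. lifts k Y" using lift_exists by blast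
  define \<Phi> where "\<Phi> = 1 + fps_X * fps_const \<phi>"
  define \<Psi> where "\<Psi> = Abs_fps (\<lambda>k. (- \<phi>) ^ k)"
  have \<Phi>_nth: "fps_nth \<Phi> k = (if k = 0 then 1 else if k = 1 then \<phi> else 0)" for k
    by (auto simp: \<Phi>_def)
  have \<Psi>\<Phi>: "\<Psi> * \<Phi> = 1" "\<Phi> * \<Psi> = 1"
  proof -
    have comm: "(- \<phi>) ^ k * \<phi> = \<phi> * (- \<phi>) ^ k" for k
      using power_commutes[of "- \<phi>" k] by simp
    have "\<Psi> + fps_X * (fps_const \<phi> * \<Psi>) = 1" "\<Psi> + fps_X * (\<Psi> * fps_const \<phi>) = 1"
      by (rule fps_ext; case_tac n; simp add: \<Psi>_def comm)+
    then show "\<Psi> * \<Phi> = 1" "\<Phi> * \<Psi> = 1"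
      by (simp_all add: \<Phi>_def distrib_left distrib_right mult.assoc)
        (metis fps_mult_fps_X_commute mult.assoc)+
  qed
  have \<Phi>_degree: "fps_raises_degree 0 \<Phi>"
    using phi_degree by (auto simp: fps_raises_degree_def \<Phi>_nth) (auto simp: raises_degree_def)
  have \<Psi>_degree: "fps_raises_degree 0 \<Psi>"
  proof -
    have "raises_degree (- 2 * int k) ((- \<phi>) ^ k)" for k
    proof (induction k)
      case (Suc k)
      have "raises_degree (-2) (- \<phi>)" using raises_degree_scaleC[OF phi_degree, of "-1"] by simp
      from raises_degree_mult[OF this Suc] show ?case by (simp add: algebra_simps)
    qed (simp add: raises_degree_def)
    then show ?thesis by (simp add: fps_raises_degree_def \<Psi>_def)
  qed
  have \<Phi>_H_one: "\<Phi> * fps_const (H \<one>) = fps_const (H \<one>) * \<Phi>"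
    by (rule fps_ext) (simp add: \<Phi>_nth phi_H_one)
  define conj where "conj T = \<Psi> * T * \<Phi>" for T
  have conj_mult: "conj S * conj T = conj (S * T)" for S T
  proof -
    have "\<Phi> * (\<Psi> * R) = R" for R by (simp add: mult.assoc[symmetric] \<Psi>\<Phi>)
    then show ?thesis by (simp add: conj_def mult.assoc)
  qed
  have conj_simps: "conj (S + T) = conj S + conj T" "conj (d *\<^sub>C T) = d *\<^sub>C conj T"
    "conj (fps_X * T) = fps_X * conj T" for S T d
    by (simp_all add: conj_def distrib_left distrib_right mult.assoc)
      (metis fps_mult_fps_X_commute mult.assoc)
  have conj_sum: "conj (sum f A) = (\<Sum>x\<in>A. conj (f x))" "conj (sum f' A') = (\<Sum>x\<in>A'. conj (f' x))"
    for f :: "nat \<Rightarrow> _" and A and f' :: "'a \<Rightarrow> _" and A'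
    by (simp_all add: conj_def sum_distrib_left sum_distrib_right)
  have conj_0: "fps_nth (conj T) 0 = fps_nth T 0"
    and conj_1: "fps_nth (conj T) 1 = fps_nth T 1 + fps_nth T 0 * \<phi> - \<phi> * fps_nth T 0" for T
    by (simp_all add: conj_def \<Phi>_nth \<Psi>_def algebra_simps)
  have conj_degree: "fps_raises_degree d (conj T)" if "fps_raises_degree d T" for d T
    using fps_raises_degree_mult[OF fps_raises_degree_mult[OF \<Psi>_degree that] \<Phi>_degree]
    by (simp add: conj_def)
  have conj_H_one: "conj (fps_const (H \<one>)) = fps_const (H \<one>)"
    by (simp add: conj_def mult.assoc \<Phi>_H_one[symmetric]) (simp add: mult.assoc[symmetric] \<Psi>\<Phi>)
  have H_one_Y: "fps_const (H \<one>) * Y i = Y i" if "i \<in> I" for i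
    by (rule lifts_H_one[OF Y that])
  have "star_generators I q G pr a \<mu> (\<lambda>i. conj (Y i)) (\<lambda>h. conj (fps_const (H h))) \<kappa>"
  proof
    fix i assume i: "i \<in> I"
    have Y0: "fps_nth (Y i) 0 = V i" and Y1: "fps_nth (Y i) 1 = L1 i"
      using Y[of 0] i by (auto simp: lifts_def)
    show "fps_nth (conj (Y i)) 0 = V i" by (simp add: conj_0 Y0)
    show "fps_nth (conj (Y i)) 1 = Mu (gen i)"
      unfolding conj_1 Y0 Y1 by (simp add: L1_def)
    show "fps_raises_degree 1 (conj (Y i))"
      by (rule conj_degree) (use Y[of 0] i in \<open>auto simp: lifts_def fps_raises_degree_def\<close>)
    show "conj (fps_const (H h)) * conj (Y i)
        = (\<Sum>j\<in>I. a h i j *\<^sub>C (conj (Y j) * conj (fps_const (H h))))" if "h \<in> carrier G" for h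
      using Y[of 0] i that by (simp add: conj_mult lifts_def conj_sum conj_simps)
    show "conj (Y i) * conj (Y j) = q i j *\<^sub>C (conj (Y j) * conj (Y i))
        + fps_X * (\<Sum>h\<in>carrier G. \<kappa> i j h *\<^sub>C conj (fps_const (H h)))" if j: "j \<in> I" for j
    proof -
      have "q_commutator q Y i j - fps_X * fps_const (K i j) = 0"
      proof (rule fps_ext)
        fix b
        have "\<forall>d<Suc b. fps_nth (q_commutator q Y i j - fps_X * fps_const (K i j)) d = 0"
          using Y[of "Suc b"] i j unfolding lifts_def by blast
        then show "fps_nth (q_commutator q Y i j - fps_X * fps_const (K i j)) b = fps_nth 0 b"
          by simp
      qed
      moreover have "fps_const (K i j) = (\<Sum>h\<in>carrier G. \<kappa> i j h *\<^sub>C fps_const (H h))"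
        by (rule fps_ext) (simp add: K_def fps_sum_nth)
      ultimately have "Y i * Y j = q i j *\<^sub>C (Y j * Y i)
          + fps_X * (\<Sum>h\<in>carrier G. \<kappa> i j h *\<^sub>C fps_const (H h))"
        by (simp add: q_commutator_def algebra_simps)
      then show ?thesis
        by (simp add: conj_mult conj_simps conj_sum)
    qed
    show "conj (fps_const (H \<one>)) * conj (Y i) = conj (Y i)"
      using i by (simp add: conj_mult H_one_Y)
  next
    fix h assume h: "h \<in> carrier G"
    show "fps_nth (conj (fps_const (H h))) 0 = H h" by (simp add: conj_0)
    show "fps_nth (conj (fps_const (H h))) 1 = Mu (grp h)"
      unfolding conj_1 using h by (simp add: Mu_grp)
    show "fps_raises_degree 0 (conj (fps_const (H h)))"
      by (rule conj_degree) (use H_degree[OF h] in \<open>auto simp: fps_raises_degree_def\<close>)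
    show "conj (fps_const (H h)) * conj (fps_const (H k)) = conj (fps_const (H (h \<otimes> k)))"
      if "k \<in> carrier G" for k
      using h that by (simp add: conj_mult H_mult)
  next
    show "conj (fps_const (H \<one>)) = fps_const (H \<one>)" by (rule conj_H_one)
  qed
  then show ?thesis by (rule that)
qed

end


section \<open>Transport of structure to coordinates\<close>

lemma
  assumes inj: "inj_on \<Theta> (carrier R)"
    and add: "\<And>x y. x \<in> carrier R \<Longrightarrow> y \<in> carrier R \<Longrightarrow> x \<oplus>\<^bsub>R\<^esub> y \<in> carrier R \<and> \<Theta> (x \<oplus>\<^bsub>R\<^esub> y) = \<Theta> x + \<Theta> y"
    and zero: "\<zero>\<^bsub>R\<^esub> \<in> carrier R" "\<Theta> \<zero>\<^bsub>R\<^esub> = (0 :: 'v::comm_monoid_add)"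
  shows abelian_monoid_transport: "abelian_monoid R"
    and finsum_transport: "f \<in> A \<rightarrow> carrier R \<Longrightarrow> \<Theta> (finsum R f A) = (\<Sum>x\<in>A. \<Theta> (f x))"
proof -
  show ab: "abelian_monoid R"
  proof (rule abelian_monoidI)
    fix x y z assume "x \<in> carrier R" "y \<in> carrier R" "z \<in> carrier R"
    then show "(x \<oplus>\<^bsub>R\<^esub> y) \<oplus>\<^bsub>R\<^esub> z = x \<oplus>\<^bsub>R\<^esub> (y \<oplus>\<^bsub>R\<^esub> z)"
      using add by (intro inj_onD[OF inj]) (auto simp: add.assoc)
  next
    fix x y assume "x \<in> carrier R" "y \<in> carrier R"
    then show "x \<oplus>\<^bsub>R\<^esub> y = y \<oplus>\<^bsub>R\<^esub> x"
      using add by (intro inj_onD[OF inj]) (auto simp: add.commute)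
  next
    fix x assume "x \<in> carrier R"
    then show "\<zero>\<^bsub>R\<^esub> \<oplus>\<^bsub>R\<^esub> x = x"
      using add zero by (intro inj_onD[OF inj]) auto
  qed (use add zero in auto)
  then interpret abelian_monoid R .
  show "f \<in> A \<rightarrow> carrier R \<Longrightarrow> \<Theta> (finsum R f A) = (\<Sum>x\<in>A. \<Theta> (f x))"
  proof (induction A rule: infinite_finite_induct)
    case (insert x A)
    then have f: "f \<in> A \<rightarrow> carrier R" "f x \<in> carrier R" by auto
    have "finsum R f (insert x A) = f x \<oplus>\<^bsub>R\<^esub> finsum R f A"
      by (rule finsum_insert) (use insert.hyps f in auto)
    then have "\<Theta> (finsum R f (insert x A)) = \<Theta> (f x) + \<Theta> (finsum R f A)"
      using add[OF f(2) finsum_closed[OF f(1)]] by simp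
    then show ?case using insert.hyps insert.IH[OF f(1)] by simp
  qed (use zero in \<open>simp_all add: finsum_infinite\<close>)
qed

subsection \<open>The free algebra\<close>

(* {#} is the zero of the type of multisets, so this rule would turn the empty monomial into 1 *)
declare single_one [simp del]

lemma clinear_eq_on_basis2:
  assumes "\<And>y. clinear (\<lambda>x. f x y)" "\<And>x. clinear (f x)" "\<And>y. clinear (\<lambda>x. g x y)" "\<And>x. clinear (g x)"
    and "\<And>b c. b \<in> keys x \<Longrightarrow> c \<in> keys y \<Longrightarrow>
      f (basis_vec b) (basis_vec c) = g (basis_vec b) (basis_vec c)"
  shows "f x y = g x y"
proof (rule clinear_eq_on_basis[where f = "\<lambda>x. f x y" and g = "\<lambda>x. g x y"])
  fix b assume b: "b \<in> keys x"
  show "f (basis_vec b) y = g (basis_vec b) y"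
    by (rule clinear_eq_on_basis[OF assms(2,4)]) (rule assms(5)[OF b])
qed (use assms in auto)

definition bilin_ext :: "('b \<Rightarrow> 'c \<Rightarrow> 'v) \<Rightarrow> ('b \<Rightarrow>\<^sub>0 complex) \<Rightarrow> ('c \<Rightarrow>\<^sub>0 complex) \<Rightarrow> 'v::cvec" where
  "bilin_ext \<phi> x y = lin_ext (\<lambda>b. lin_ext (\<phi> b) y) x"

lemma bilin_ext_linear_left: "clinear (\<lambda>x. bilin_ext \<phi> x y)"
  unfolding bilin_ext_def by (rule clinear_lin_ext)

lemma bilin_ext_linear_right: "clinear (bilin_ext \<phi> x)"
  by standard (simp_all add: bilin_ext_def lin_ext_def[of _ x] clinear_simps[OF clinear_lin_ext]
      scaleC_add_right sum.distrib scaleC_sum_right mult.commute)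

lemma bilin_ext_basis [simp]: "bilin_ext \<phi> (basis_vec b) (basis_vec c) = \<phi> b c"
  by (simp add: bilin_ext_def)

lemmas bilin_ext_simps = clinear_simps[OF bilin_ext_linear_left] clinear_simps[OF bilin_ext_linear_right]

lemma bilinear_assocI:
  fixes f :: "('b \<Rightarrow>\<^sub>0 complex) \<Rightarrow> ('b \<Rightarrow>\<^sub>0 complex) \<Rightarrow> 'b \<Rightarrow>\<^sub>0 complex"
  assumes left: "\<And>y. clinear (\<lambda>x. f x y)" and right: "\<And>x. clinear (f x)"
    and basis: "\<And>b c d. f (f (basis_vec b) (basis_vec c)) (basis_vec d)
      = f (basis_vec b) (f (basis_vec c) (basis_vec d))"
  shows "f (f x y) z = f x (f y z)"
proof (rule clinear_eq_on_basis[where f = "\<lambda>z. f (f x y) z" and g = "\<lambda>z. f x (f y z)"])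
  note f_simps = clinear_simps[OF left] clinear_simps[OF right]
  show "f (f x y) (basis_vec d) = f x (f y (basis_vec d))" for d
    by (rule clinear_eq_on_basis2[where f = "\<lambda>x y. f (f x y) (basis_vec d)"
          and g = "\<lambda>x y. f x (f y (basis_vec d))"])
      (auto simp: clinear_def f_simps basis)
  show "clinear (\<lambda>z. f (f x y) z)" "clinear (\<lambda>z. f x (f y z))"
    by (auto simp: clinear_def f_simps)
qed

lemma bilin_ext_keys:
  assumes "\<And>b c. b \<in> keys x \<Longrightarrow> c \<in> keys y \<Longrightarrow> keys (\<phi> b c) \<subseteq> S"
  shows "keys (bilin_ext \<phi> x y :: 'c \<Rightarrow>\<^sub>0 complex) \<subseteq> S"
proof (rule clinear_keys[where f = "\<lambda>x. bilin_ext \<phi> x y", OF bilin_ext_linear_left])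
  fix b assume b: "b \<in> keys x"
  show "keys (bilin_ext \<phi> (basis_vec b) y) \<subseteq> S"
    by (rule clinear_keys[where f = "bilin_ext \<phi> (basis_vec b)", OF bilin_ext_linear_right])
      (simp add: assms b)
qed

abbreviation word_prod :: "(nat list \<Rightarrow>\<^sub>0 complex) \<Rightarrow> (nat list \<Rightarrow>\<^sub>0 complex) \<Rightarrow> nat list \<Rightarrow>\<^sub>0 complex" where
  "word_prod \<equiv> bilin_ext (\<lambda>u w. basis_vec (u @ w))"

lemma word_prod_assoc: "word_prod (word_prod x y) z = word_prod x (word_prod y z)"
  by (rule bilinear_assocI[OF bilin_ext_linear_left bilin_ext_linear_right]) simp

lemma word_prod_one [simp]: "word_prod (basis_vec []) x = x" "word_prod x (basis_vec []) = x"
  by (rule clinear_eq_on_basis[where g = "\<lambda>x. x"]; simp add: clinear_def bilin_ext_simps)+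

lemma lookup_word_prod:
  "lookup (word_prod x y) w
    = (\<Sum>k\<le>length w. lookup x (take k w) * lookup y (drop k w))"
proof (rule clinear_eq_on_basis2[where f = "\<lambda>x y. lookup (word_prod x y) w" and
    g = "\<lambda>x y. \<Sum>k\<le>length w. lookup x (take k w) * lookup y (drop k w)"])
  fix u v :: "nat list"
  have "(\<Sum>k\<le>length w. lookup (basis_vec u) (take k w) * lookup (basis_vec v) (drop k w))
      = (\<Sum>k\<le>length w. if k = length u then (if u @ v = w then 1 else 0) else (0::complex))"
  proof (rule sum.cong[OF refl])
    fix k assume "k \<in> {..length w}"
    then have split: "(u = take k w \<and> v = drop k w) \<longleftrightarrow> (k = length u \<and> u @ v = w)"
      by (auto simp: append_eq_conv_conj)
    have "lookup (basis_vec u) (take k w) * lookup (basis_vec v) (drop k w)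
      = (if u = take k w \<and> v = drop k w then 1 else 0)"
      by (simp add: lookup_single when_def)
    also have "\<dots> = (if k = length u \<and> u @ v = w then 1 else 0)"
      by (simp only: split)
    finally show "lookup (basis_vec u) (take k w) * lookup (basis_vec v) (drop k w)
      = (if k = length u then if u @ v = w then 1 else 0 else 0)"
      by simp
  qed
  also have "\<dots> = (if u @ v = w then 1 else 0)" by auto
  finally show "lookup (word_prod (basis_vec u) (basis_vec v)) w
      = (\<Sum>k\<le>length w. lookup (basis_vec u) (take k w) * lookup (basis_vec v) (drop k w))"
    by (simp add: lookup_single when_def)
qed (auto simp: clinear_def bilin_ext_simps lookup_add distrib_left distrib_right sum.distrib
    sum_distrib_left algebra_simps)

definition words :: "nat \<Rightarrow> (nat list \<Rightarrow>\<^sub>0 complex) set" where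
  "words n = {x. keys x \<subseteq> {w. set w \<subseteq> {1..n}}}"

lemma words_closed:
  "0 \<in> words n" "basis_vec w \<in> words n \<longleftrightarrow> set w \<subseteq> {1..n}"
  "x \<in> words n \<Longrightarrow> y \<in> words n \<Longrightarrow> x + y \<in> words n"
  "x \<in> words n \<Longrightarrow> c *\<^sub>C x \<in> words n" "x \<in> words n \<Longrightarrow> - x \<in> words n"
  "x \<in> words n \<Longrightarrow> y \<in> words n \<Longrightarrow> x - y \<in> words n"
  "x \<in> words n \<Longrightarrow> y \<in> words n \<Longrightarrow> word_prod x y \<in> words n"
proof -
  show add: "x \<in> words n \<Longrightarrow> y \<in> words n \<Longrightarrow> x + y \<in> words n" for x y
    by (simp add: words_def keys_add_subset)
  show scale: "x \<in> words n \<Longrightarrow> c *\<^sub>C x \<in> words n" for x c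
    by (auto simp: words_def in_keys_iff)
  show minus: "x \<in> words n \<Longrightarrow> - x \<in> words n" for x
    using scale[of x "-1"] by simp
  show "x \<in> words n \<Longrightarrow> y \<in> words n \<Longrightarrow> x - y \<in> words n"
    using add[of x "- y"] minus[of y] by simp
  show "x \<in> words n \<Longrightarrow> y \<in> words n \<Longrightarrow> word_prod x y \<in> words n"
    unfolding words_def mem_Collect_eq by (rule bilin_ext_keys) auto
qed (auto simp: words_def)

lemma free_algebra_carrier: "carrier (free_algebra n) = lookup ` words n"
proof
  show "carrier (free_algebra n) \<subseteq> lookup ` words n"
  proof
    fix f assume f: "f \<in> carrier (free_algebra n)"
    then have "f = lookup (Abs_poly_mapping f)" by (simp add: free_algebra_def)
    moreover have "Abs_poly_mapping f \<in> words n"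
      using f by (auto simp: free_algebra_def words_def in_keys_iff)
    ultimately show "f \<in> lookup ` words n" by blast
  qed
  show "lookup ` words n \<subseteq> carrier (free_algebra n)"
    by (auto simp: free_algebra_def words_def in_keys_iff)
qed

lemma free_algebra_lookup [simp]:
  "lookup x \<otimes>\<^bsub>free_algebra n\<^esub> lookup y = lookup (word_prod x y)"
  "lookup x \<oplus>\<^bsub>free_algebra n\<^esub> lookup y = lookup (x + y)"
  "c \<odot>\<^bsub>free_algebra n\<^esub> lookup x = lookup (c *\<^sub>C x)"
  "\<one>\<^bsub>free_algebra n\<^esub> = lookup (basis_vec [])"
  "\<zero>\<^bsub>free_algebra n\<^esub> = lookup 0"
  "free_gen i = lookup (basis_vec [i])"
  by (auto simp: free_algebra_def free_gen_def fun_eq_iff lookup_word_prod lookup_add lookup_single when_def)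

lemma ring_free_algebra: "ring (free_algebra n)"
proof (rule ringI)
  show "abelian_group (free_algebra n)"
  proof (rule abelian_groupI)
    fix f assume "f \<in> carrier (free_algebra n)"
    then obtain x where "x \<in> words n" "f = lookup x" by (auto simp: free_algebra_carrier)
    then show "\<exists>y\<in>carrier (free_algebra n). y \<oplus>\<^bsub>free_algebra n\<^esub> f = \<zero>\<^bsub>free_algebra n\<^esub>"
      by (auto simp: free_algebra_carrier words_closed intro!: bexI[of _ "- x"])
  qed (auto simp: free_algebra_carrier words_closed add_ac)
  show "monoid (free_algebra n)"
    by (rule monoidI) (auto simp: free_algebra_carrier words_closed word_prod_assoc)
qed (auto simp: free_algebra_carrier bilin_ext_simps)

lemma free_algebra_a_inv [simp]:
  "x \<in> words n \<Longrightarrow> \<ominus>\<^bsub>free_algebra n\<^esub> lookup x = lookup (- x)"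
proof -
  interpret ring "free_algebra n" by (rule ring_free_algebra)
  assume x: "x \<in> words n"
  then show ?thesis
    by (intro minus_equality) (auto simp: free_algebra_carrier words_closed)
qed

lemma free_algebra_a_minus [simp]:
  "y \<in> words n \<Longrightarrow> lookup x \<ominus>\<^bsub>free_algebra n\<^esub> lookup y = lookup (x - y)"
  by (simp add: a_minus_def)

subsection \<open>Quantum polynomials\<close>

text \<open>
  \<open>monomial_coeff q\<close> is a bicharacter on multisets, and \<open>q_prod q\<close> is the monoid algebra of multisets twisted
  by it.  This makes associativity immediate.
\<close>

definition monomial_coeff :: "(nat \<Rightarrow> nat \<Rightarrow> complex) \<Rightarrow> nat multiset \<Rightarrow> nat multiset \<Rightarrow> complex" where
  "monomial_coeff q A A' = (\<Prod>i\<in>#A. move_coeff q i A')"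

lemma move_coeff_union: "move_coeff q i (A + A') = move_coeff q i A * move_coeff q i A'"
  by (simp add: move_coeff_def)

lemma monomial_coeff_simps [simp]:
  "monomial_coeff q {#} A = 1" "monomial_coeff q A {#} = 1" "monomial_coeff q {#i#} A = move_coeff q i A"
  "monomial_coeff q (A + A') A'' = monomial_coeff q A A'' * monomial_coeff q A' A''"
  "monomial_coeff q A (A' + A'') = monomial_coeff q A A' * monomial_coeff q A A''"
  by (simp_all add: monomial_coeff_def move_coeff_union prod_mset.distrib)

definition q_prod :: "(nat \<Rightarrow> nat \<Rightarrow> complex) \<Rightarrow>
    (nat multiset \<Rightarrow>\<^sub>0 complex) \<Rightarrow> (nat multiset \<Rightarrow>\<^sub>0 complex) \<Rightarrow> nat multiset \<Rightarrow>\<^sub>0 complex" where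
  "q_prod q = bilin_ext (\<lambda>A A'. monomial_coeff q A A' *\<^sub>C basis_vec (A + A'))"

lemma q_prod_basis [simp]:
  "q_prod q (basis_vec A) (basis_vec A') = monomial_coeff q A A' *\<^sub>C basis_vec (A + A')"
  by (simp add: q_prod_def)

lemma q_prod_linear: "clinear (\<lambda>x. q_prod q x y)" "clinear (q_prod q x)"
  by (simp_all add: q_prod_def bilin_ext_linear_left bilin_ext_linear_right)

lemmas q_prod_simps = clinear_simps[OF q_prod_linear(1)] clinear_simps[OF q_prod_linear(2)]

lemma q_prod_assoc: "q_prod q (q_prod q x y) z = q_prod q x (q_prod q y z)"
  by (rule bilinear_assocI[OF q_prod_linear]) (simp add: q_prod_simps add.assoc mult_ac)

lemma q_prod_one [simp]: "q_prod q (basis_vec {#}) x = x" "q_prod q x (basis_vec {#}) = x"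
proof -
  have id: "clinear (\<lambda>x :: nat multiset \<Rightarrow>\<^sub>0 complex. x)" by (simp add: clinear_def)
  show "q_prod q (basis_vec {#}) x = x"
    by (rule clinear_eq_on_basis[OF q_prod_linear(2) id]) simp
  show "q_prod q x (basis_vec {#}) = x"
    by (rule clinear_eq_on_basis[OF q_prod_linear(1) id]) simp
qed

definition word_poly :: "(nat \<Rightarrow> nat \<Rightarrow> complex) \<Rightarrow> nat list \<Rightarrow> nat multiset \<Rightarrow>\<^sub>0 complex" where
  "word_poly q w = foldr (\<lambda>i x. q_prod q (basis_vec {#i#}) x) w (basis_vec {#})"

lemma word_poly_simps [simp]:
  "word_poly q [] = basis_vec {#}"
  "word_poly q (i # w) = q_prod q (basis_vec {#i#}) (word_poly q w)"
  by (simp_all add: word_poly_def)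

lemma word_poly_append: "word_poly q (u @ w) = q_prod q (word_poly q u) (word_poly q w)"
  by (induction u) (simp_all add: q_prod_assoc)

lemma word_poly_sorted: "sorted w \<Longrightarrow> word_poly q w = basis_vec (mset w)"
proof (induction w)
  case (Cons i w)
  then have "move_coeff q i (mset w) = 1" by (intro move_coeff_le) auto
  then show ?case using Cons by simp
qed simp

lemma word_poly_basis: "\<exists>c. word_poly q w = c *\<^sub>C basis_vec (mset w)"
proof (induction w)
  case Nil
  show ?case by (rule exI[of _ 1]) simp
next
  case (Cons i w)
  then show ?case by (auto simp: q_prod_simps)
qed

text \<open>
  Rewriting words as multiples of sorted monomials.
\<close>

definition q_poly :: "(nat \<Rightarrow> nat \<Rightarrow> complex) \<Rightarrow> (nat list \<Rightarrow>\<^sub>0 complex) \<Rightarrow> nat multiset \<Rightarrow>\<^sub>0 complex" where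
  "q_poly q = lin_ext (word_poly q)"

lemma q_poly_linear: "clinear (q_poly q)"
  by (simp add: q_poly_def clinear_lin_ext)

lemmas q_poly_simps = clinear_simps[OF q_poly_linear]

lemma q_poly_basis [simp]: "q_poly q (basis_vec w) = word_poly q w"
  by (simp add: q_poly_def)

lemma q_poly_prod: "q_poly q (word_prod x y) = q_prod q (q_poly q x) (q_poly q y)"
  by (rule clinear_eq_on_basis2[where f = "\<lambda>x y. q_poly q (word_prod x y)" and
        g = "\<lambda>x y. q_prod q (q_poly q x) (q_poly q y)"])
    (auto simp: clinear_def q_poly_simps bilin_ext_simps q_prod_simps word_poly_append)

definition monomials :: "nat \<Rightarrow> (nat multiset \<Rightarrow>\<^sub>0 complex) set" where
  "monomials n = {x. keys x \<subseteq> {A. set_mset A \<subseteq> {1..n}}}"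

lemma q_poly_monomials: "x \<in> words n \<Longrightarrow> q_poly q x \<in> monomials n"
  unfolding monomials_def mem_Collect_eq
proof (rule clinear_keys[OF q_poly_linear])
  fix w assume "x \<in> words n" "w \<in> keys x"
  then have w: "set_mset (mset w) \<subseteq> {1..n}" by (auto simp: words_def)
  obtain c where "word_poly q w = c *\<^sub>C basis_vec (mset w)" using word_poly_basis by blast
  then have keys: "keys (word_poly q w) \<subseteq> {mset w}"
    by (auto simp: in_keys_iff lookup_single when_def split: if_splits)
  have "{mset w} \<subseteq> {A. set_mset A \<subseteq> {1..n}}" using w by simp
  with keys show "keys (q_poly q (basis_vec w)) \<subseteq> {A. set_mset A \<subseteq> {1..n}}"
    by (simp only: q_poly_basis)
qed

definition sorted_word :: "(nat multiset \<Rightarrow>\<^sub>0 complex) \<Rightarrow> nat list \<Rightarrow>\<^sub>0 complex" where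
  "sorted_word = lin_ext (\<lambda>A. basis_vec (sorted_list_of_multiset A))"

lemma sorted_word_linear: "clinear sorted_word"
  by (simp add: sorted_word_def clinear_lin_ext)

lemmas sorted_word_simps = clinear_simps[OF sorted_word_linear]

lemma sorted_word_basis [simp]: "sorted_word (basis_vec A) = basis_vec (sorted_list_of_multiset A)"
  by (simp add: sorted_word_def)

lemma sorted_word_words: "x \<in> monomials n \<Longrightarrow> sorted_word x \<in> words n"
  unfolding words_def mem_Collect_eq
  by (rule clinear_keys[OF sorted_word_linear]) (auto simp: monomials_def)

lemma q_poly_sorted_word [simp]: "q_poly q (sorted_word x) = x"
  by (rule clinear_eq_on_basis[where g = "\<lambda>x. x"])
    (auto simp: clinear_def q_poly_simps sorted_word_simps word_poly_sorted)


subsection \<open>The quotient by the commutation relations\<close>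

lemma ideal_generators_carrier:
  "{(free_gen i \<otimes>\<^bsub>free_algebra n\<^esub> free_gen j) \<ominus>\<^bsub>free_algebra n\<^esub>
      (q i j \<odot>\<^bsub>free_algebra n\<^esub> (free_gen j \<otimes>\<^bsub>free_algebra n\<^esub> free_gen i)) | i j.
        i \<in> {1..n} \<and> j \<in> {1..n}} \<subseteq> carrier (free_algebra n)"
  by (auto simp: free_algebra_carrier words_closed)

lemma ideal_commutation_ideal: "ideal (commutation_ideal n q) (free_algebra n)"
proof -
  interpret ring "free_algebra n" by (rule ring_free_algebra)
  show ?thesis
    unfolding commutation_ideal_def Let_def by (rule genideal_ideal) (rule ideal_generators_carrier)
qed

definition relations :: "nat \<Rightarrow> (nat \<Rightarrow> nat \<Rightarrow> complex) \<Rightarrow> (nat list \<Rightarrow>\<^sub>0 complex) set" where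
  "relations n q = {x \<in> words n. lookup x \<in> commutation_ideal n q}"

lemma commutation_ideal_eq: "commutation_ideal n q = lookup ` relations n q"
proof -
  interpret ideal "commutation_ideal n q" "free_algebra n" by (rule ideal_commutation_ideal)
  show ?thesis using a_subset by (auto simp: relations_def free_algebra_carrier)
qed

lemma relations_words: "x \<in> relations n q \<Longrightarrow> x \<in> words n"
  by (simp add: relations_def)

lemma relations_closed:
  shows relations_zero: "0 \<in> relations n q"
    and relations_add: "x \<in> relations n q \<Longrightarrow> y \<in> relations n q \<Longrightarrow> x + y \<in> relations n q"
    and relations_left: "x \<in> words n \<Longrightarrow> y \<in> relations n q \<Longrightarrow> word_prod x y \<in> relations n q"
    and relations_right: "x \<in> relations n q \<Longrightarrow> y \<in> words n \<Longrightarrow> word_prod x y \<in> relations n q"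
    and relations_scaleC: "x \<in> relations n q \<Longrightarrow> c *\<^sub>C x \<in> relations n q"
    and relations_commute: "i \<in> {1..n} \<Longrightarrow> j \<in> {1..n} \<Longrightarrow>
      basis_vec [i, j] - q i j *\<^sub>C basis_vec [j, i] \<in> relations n q"
proof -
  interpret ideal "commutation_ideal n q" "free_algebra n" by (rule ideal_commutation_ideal)
  show "0 \<in> relations n q"
    using zero_closed additive_subgroup.zero_closed[OF is_additive_subgroup]
    by (simp add: relations_def words_closed)
  show "x \<in> relations n q \<Longrightarrow> y \<in> relations n q \<Longrightarrow> x + y \<in> relations n q"
    using additive_subgroup.a_closed[OF is_additive_subgroup, of "lookup x" "lookup y"]
    by (simp add: relations_def words_closed)
  show left: "x \<in> words n \<Longrightarrow> y \<in> relations n q \<Longrightarrow> word_prod x y \<in> relations n q" for x y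
    using I_l_closed[of "lookup y" "lookup x"]
    by (simp add: relations_def words_closed free_algebra_carrier)
  show "x \<in> relations n q \<Longrightarrow> y \<in> words n \<Longrightarrow> word_prod x y \<in> relations n q"
    using I_r_closed[of "lookup x" "lookup y"]
    by (simp add: relations_def words_closed free_algebra_carrier)
  show "x \<in> relations n q \<Longrightarrow> c *\<^sub>C x \<in> relations n q"
    using left[of "c *\<^sub>C basis_vec []" x] by (simp add: words_closed bilin_ext_simps)
  assume ij: "i \<in> {1..n}" "j \<in> {1..n}"
  then have "(free_gen i \<otimes>\<^bsub>free_algebra n\<^esub> free_gen j) \<ominus>\<^bsub>free_algebra n\<^esub>
      (q i j \<odot>\<^bsub>free_algebra n\<^esub> (free_gen j \<otimes>\<^bsub>free_algebra n\<^esub> free_gen i)) \<in> commutation_ideal n q"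
    unfolding commutation_ideal_def Let_def
    using ring.genideal_self[OF ring_free_algebra ideal_generators_carrier[of n q]] by blast
  then show "basis_vec [i, j] - q i j *\<^sub>C basis_vec [j, i] \<in> relations n q"
    using ij by (simp add: relations_def words_closed)
qed

lemma relations_diff: "x \<in> relations n q \<Longrightarrow> y \<in> relations n q \<Longrightarrow> x - y \<in> relations n q"
  using relations_add[of x n q "(-1) *\<^sub>C y"] relations_scaleC[of y n q "-1"] by simp

context
  fixes n q
  assumes q: "quantum_coefficients {1..n} q"
begin

interpretation quantum_coefficients "{1..n}" q by (rule q)

text \<open>
  The elements that rewrite to 0 form an ideal which contains the defining relations.
\<close>

lemma relations_q_poly:
  assumes "x \<in> relations n q"
  shows "q_poly q x = 0"
proof -
  interpret ring "free_algebra n" by (rule ring_free_algebra)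
  let ?K = "lookup ` {x \<in> words n. q_poly q x = 0}"
  have "ideal ?K (free_algebra n)"
  proof (rule idealI[OF ring_free_algebra])
    show "subgroup ?K (add_monoid (free_algebra n))"
    proof (rule subgroup.intro)
      show "inv\<^bsub>add_monoid (free_algebra n)\<^esub> f \<in> ?K" if f: "f \<in> ?K" for f
      proof -
        obtain x where x: "x \<in> words n" "q_poly q x = 0" "f = lookup x" using f by auto
        then have "inv\<^bsub>add_monoid (free_algebra n)\<^esub> f = lookup (- x)"
          using free_algebra_a_inv[OF x(1)] unfolding a_inv_def by simp
        moreover have "- x \<in> {x \<in> words n. q_poly q x = 0}"
          using x by (simp add: words_closed q_poly_simps)
        ultimately show ?thesis by blast
      qed
    qed (auto simp: free_algebra_carrier words_closed q_poly_simps)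
  qed (auto simp: free_algebra_carrier words_closed q_poly_simps q_poly_prod q_prod_simps)
  moreover have "basis_vec [i, j] - q i j *\<^sub>C basis_vec [j, i] \<in> {x \<in> words n. q_poly q x = 0}"
    if "i \<in> {1..n}" "j \<in> {1..n}" for i j
  proof -
    have "(if j < i then q i j else 1) = q i j * (if i < j then q j i else 1)"
      using that q_cancel[of i j] by (cases i j rule: linorder_cases) auto
    then show ?thesis
      using that by (simp add: words_closed q_poly_simps add_mset_commute)
  qed
  ultimately have "commutation_ideal n q \<subseteq> ?K"
    unfolding commutation_ideal_def Let_def
    by (intro genideal_minimal) (auto simp: words_closed)
  then have "lookup x \<in> ?K"
    using assms by (auto simp: relations_def)
  then show ?thesis by (auto simp: lookup_inject)
qed

lemma insert_sorted:
  assumes "i \<in> {1..n}" "set w \<subseteq> {1..n}" "sorted w"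
  shows "basis_vec (i # w) - move_coeff q i (mset w) *\<^sub>C basis_vec (insort i w) \<in> relations n q"
  using assms(2,3)
proof (induction w)
  case Nil
  then show ?case by (simp add: relations_zero)
next
  case (Cons j w)
  show ?case
  proof (cases "i \<le> j")
    case True
    then have "move_coeff q i (mset (j # w)) = 1" using Cons.prems by (intro move_coeff_le) auto
    then show ?thesis using True by (simp add: relations_zero)
  next
    case False
    have "word_prod (basis_vec [i, j] - q i j *\<^sub>C basis_vec [j, i]) (basis_vec w) \<in> relations n q"
      by (rule relations_right) (use assms Cons.prems in \<open>auto simp: relations_commute words_closed\<close>)
    moreover have "q i j *\<^sub>C word_prod (basis_vec [j])
        (basis_vec (i # w) - move_coeff q i (mset w) *\<^sub>C basis_vec (insort i w)) \<in> relations n q"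
      by (intro relations_scaleC relations_left) (use Cons in \<open>auto simp: words_closed\<close>)
    ultimately have "word_prod (basis_vec [i, j] - q i j *\<^sub>C basis_vec [j, i]) (basis_vec w)
      + q i j *\<^sub>C word_prod (basis_vec [j])
        (basis_vec (i # w) - move_coeff q i (mset w) *\<^sub>C basis_vec (insort i w)) \<in> relations n q"
      by (rule relations_add)
    then show ?thesis using False by (simp add: bilin_ext_simps scaleC_diff_right)
  qed
qed

lemma word_sorted:
  "set w \<subseteq> {1..n} \<Longrightarrow> basis_vec w - sorted_word (word_poly q w) \<in> relations n q"
proof (induction w)
  case Nil
  show ?case by (simp add: relations_zero)
next
  case (Cons i w)
  obtain c where c: "word_poly q w = c *\<^sub>C basis_vec (mset w)" using word_poly_basis by blast
  let ?s = "sorted_list_of_multiset (mset w)"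
  have "basis_vec (i # ?s) - move_coeff q i (mset ?s) *\<^sub>C basis_vec (insort i ?s) \<in> relations n q"
    by (rule insert_sorted) (use Cons.prems in auto)
  then have "c *\<^sub>C (basis_vec (i # ?s) - move_coeff q i (mset ?s) *\<^sub>C basis_vec (insort i ?s))
      \<in> relations n q" by (rule relations_scaleC)
  moreover have "word_prod (basis_vec [i]) (basis_vec w - sorted_word (word_poly q w)) \<in> relations n q"
    by (rule relations_left) (use Cons in \<open>auto simp: words_closed\<close>)
  ultimately have "word_prod (basis_vec [i]) (basis_vec w - sorted_word (word_poly q w))
      + c *\<^sub>C (basis_vec (i # ?s) - move_coeff q i (mset ?s) *\<^sub>C basis_vec (insort i ?s))
      \<in> relations n q" by (intro relations_add)
  then show ?case
    by (simp add: c q_prod_simps sorted_word_simps bilin_ext_simps scaleC_diff_right)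
qed

text \<open>
  Sorting a word letter by letter changes it only by relations.  Together with \<open>relations_q_poly\<close> this
  shows that the sorted monomials are a basis of \<open>S\<^sub>q(V)\<close>.
\<close>

lemma words_sorted: "x \<in> words n \<Longrightarrow> x - sorted_word (q_poly q x) \<in> relations n q"
proof -
  assume x: "x \<in> words n"
  have "x - sorted_word (q_poly q x) = (\<Sum>w\<in>keys x. lookup x w *\<^sub>C
      (basis_vec w - sorted_word (q_poly q (basis_vec w))))"
    by (rule clinear_expand[where f = "\<lambda>x. x - sorted_word (q_poly q x)"])
      (simp add: clinear_def q_poly_simps sorted_word_simps scaleC_diff_right)
  also have "\<dots> \<in> relations n q"
  proof -
    have "(\<Sum>w\<in>S. lookup x w *\<^sub>C (basis_vec w - sorted_word (q_poly q (basis_vec w))))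
        \<in> relations n q" if "S \<subseteq> keys x" for S
      using finite_subset[OF that finite_keys] that
    proof (induction S rule: finite_induct)
      case (insert w S)
      then have "set w \<subseteq> {1..n}" using x by (auto simp: words_def)
      then show ?case using insert
        by (simp add: relations_add relations_scaleC word_sorted)
    qed (simp add: relations_zero)
    then show ?thesis by simp
  qed
  finally show ?thesis .
qed

lemma relations_iff: "x \<in> words n \<Longrightarrow> x \<in> relations n q \<longleftrightarrow> q_poly q x = 0"
  using relations_q_poly words_sorted[of x] by (auto simp: sorted_word_simps)

end

subsection \<open>Coordinates on the quantum symmetric algebra\<close>

abbreviation symalg :: "nat \<Rightarrow> (nat \<Rightarrow> nat \<Rightarrow> complex) \<Rightarrow> (complex, (nat list \<Rightarrow> complex) set) module" where
  "symalg n q \<equiv> quantum_symmetric_algebra n q"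

definition word_class :: "nat \<Rightarrow> (nat \<Rightarrow> nat \<Rightarrow> complex) \<Rightarrow> (nat list \<Rightarrow>\<^sub>0 complex) \<Rightarrow> (nat list \<Rightarrow> complex) set" where
  "word_class n q x = commutation_ideal n q +>\<^bsub>free_algebra n\<^esub> lookup x"

text \<open>
  The choice of a representative does not matter, by \<open>word_class_eq_iff\<close>.
\<close>

definition coord :: "nat \<Rightarrow> (nat \<Rightarrow> nat \<Rightarrow> complex) \<Rightarrow> (nat list \<Rightarrow> complex) set \<Rightarrow> nat multiset \<Rightarrow>\<^sub>0 complex" where
  "coord n q X = q_poly q (SOME x. x \<in> words n \<and> word_class n q x = X)"

lemma word_class_eq: "word_class n q x = (\<lambda>r. lookup (r + x)) ` relations n q"
  by (auto simp: word_class_def a_r_coset_def' commutation_ideal_eq)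

lemma sym_carrier: "carrier (symalg n q) = word_class n q ` words n"
  by (auto simp: quantum_symmetric_algebra_def commutation_algebra_def quotient_algebra_def
      FactRing_def A_RCOSETS_def' free_algebra_carrier word_class_def)

context
  fixes n q
  assumes q: "quantum_coefficients {1..n} q"
begin

lemma word_class_eq_iff:
  assumes "x \<in> words n" "y \<in> words n"
  shows "word_class n q x = word_class n q y \<longleftrightarrow> q_poly q x = q_poly q y"
proof
  assume "word_class n q x = word_class n q y"
  moreover have "lookup x \<in> word_class n q x"
    using relations_zero[of n q] by (force simp: word_class_eq)
  ultimately obtain r where "r \<in> relations n q" "x = r + y"
    by (auto simp: word_class_eq lookup_inject)
  then show "q_poly q x = q_poly q y"
    using relations_q_poly[OF q] by (simp add: q_poly_simps)
next
  assume "q_poly q x = q_poly q y"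
  then have xy: "x - y \<in> relations n q"
    using relations_iff[OF q, of "x - y"] assms by (simp add: words_closed q_poly_simps)
  show "word_class n q x = word_class n q y"
  proof (intro equalityI subsetI)
    fix f assume "f \<in> word_class n q x"
    then obtain r where r: "r \<in> relations n q" "f = lookup (r + x)"
      by (auto simp: word_class_eq)
    then have "f = lookup ((r + (x - y)) + y)" by simp
    then show "f \<in> word_class n q y"
      unfolding word_class_eq using relations_add[OF r(1) xy] by (rule image_eqI)
  next
    fix f assume "f \<in> word_class n q y"
    then obtain r where r: "r \<in> relations n q" "f = lookup (r + y)"
      by (auto simp: word_class_eq)
    then have "f = lookup ((r - (x - y)) + x)" by simp
    then show "f \<in> word_class n q x"
      unfolding word_class_eq using relations_diff[OF r(1) xy] by (rule image_eqI)
  qed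
qed

lemma coord_word_class: "x \<in> words n \<Longrightarrow> coord n q (word_class n q x) = q_poly q x"
  unfolding coord_def
  by (rule someI2[of _ x]) (auto simp: word_class_eq_iff)

lemma sym_simps:
  assumes "x \<in> words n" "y \<in> words n"
  shows "word_class n q x \<oplus>\<^bsub>symalg n q\<^esub> word_class n q y = word_class n q (x + y)"
    and "word_class n q x \<otimes>\<^bsub>symalg n q\<^esub> word_class n q y = word_class n q (word_prod x y)"
    and "c \<odot>\<^bsub>symalg n q\<^esub> word_class n q x = word_class n q (c *\<^sub>C x)"
    and "\<one>\<^bsub>symalg n q\<^esub> = word_class n q (basis_vec [])"
    and "\<zero>\<^bsub>symalg n q\<^esub> = word_class n q 0"
proof -
  interpret ideal "commutation_ideal n q" "free_algebra n" by (rule ideal_commutation_ideal)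
  have xy: "lookup x \<in> carrier (free_algebra n)"
    "lookup y \<in> carrier (free_algebra n)"
    using assms by (auto simp: free_algebra_carrier)
  show "word_class n q x \<oplus>\<^bsub>symalg n q\<^esub> word_class n q y = word_class n q (x + y)"
    using a_rcos_sum[OF xy]
    by (simp add: quantum_symmetric_algebra_def commutation_algebra_def quotient_algebra_def
        FactRing_def word_class_def)
  show "word_class n q x \<otimes>\<^bsub>symalg n q\<^esub> word_class n q y = word_class n q (word_prod x y)"
    using rcoset_mult_add[OF xy]
    by (simp add: quantum_symmetric_algebra_def commutation_algebra_def quotient_algebra_def
        FactRing_def word_class_def)
  show "\<one>\<^bsub>symalg n q\<^esub> = word_class n q (basis_vec [])"
    by (simp add: quantum_symmetric_algebra_def commutation_algebra_def quotient_algebra_def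
        FactRing_def word_class_def)
  show "\<zero>\<^bsub>symalg n q\<^esub> = word_class n q 0"
    by (simp add: quantum_symmetric_algebra_def commutation_algebra_def quotient_algebra_def
        FactRing_def word_class_eq commutation_ideal_eq)
  have "c \<odot>\<^bsub>symalg n q\<^esub> word_class n q x
      = (\<Union>r\<in>relations n q. word_class n q (c *\<^sub>C (r + x)))"
    by (simp add: quantum_symmetric_algebra_def commutation_algebra_def quotient_algebra_def
        word_class_eq) (simp add: word_class_def[symmetric] word_class_eq[symmetric])
  also have "\<dots> = (\<Union>r\<in>relations n q. word_class n q (c *\<^sub>C x))"
  proof (rule SUP_cong[OF refl])
    fix r assume r: "r \<in> relations n q"
    show "word_class n q (c *\<^sub>C (r + x)) = word_class n q (c *\<^sub>C x)"
      using assms relations_words[OF r] relations_q_poly[OF q r]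
      by (subst word_class_eq_iff) (auto simp: words_closed q_poly_simps)
  qed
  also have "\<dots> = word_class n q (c *\<^sub>C x)" using relations_zero by auto
  finally show "c \<odot>\<^bsub>symalg n q\<^esub> word_class n q x = word_class n q (c *\<^sub>C x)" .
qed

lemma coord_bij: "bij_betw (coord n q) (carrier (symalg n q)) (monomials n)"
proof (rule bij_betw_imageI)
  show "inj_on (coord n q) (carrier (symalg n q))"
    by (auto simp: inj_on_def sym_carrier coord_word_class word_class_eq_iff)
  show "coord n q ` carrier (symalg n q) = monomials n"
  proof (intro equalityI subsetI)
    fix s assume "s \<in> monomials n"
    then have "s = coord n q (word_class n q (sorted_word s))" "sorted_word s \<in> words n"
      by (simp_all add: sorted_word_words coord_word_class)
    then show "s \<in> coord n q ` carrier (symalg n q)" by (auto simp: sym_carrier)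
  qed (auto simp: sym_carrier coord_word_class q_poly_monomials)
qed

lemma sym_closed:
  assumes "X \<in> carrier (symalg n q)" "Y \<in> carrier (symalg n q)"
  shows "X \<oplus>\<^bsub>symalg n q\<^esub> Y \<in> carrier (symalg n q)" "X \<otimes>\<^bsub>symalg n q\<^esub> Y \<in> carrier (symalg n q)"
    "c \<odot>\<^bsub>symalg n q\<^esub> X \<in> carrier (symalg n q)"
    "\<one>\<^bsub>symalg n q\<^esub> \<in> carrier (symalg n q)" "\<zero>\<^bsub>symalg n q\<^esub> \<in> carrier (symalg n q)"
  using assms by (auto simp: sym_carrier sym_simps words_closed)

lemma coord_simps:
  assumes "X \<in> carrier (symalg n q)" "Y \<in> carrier (symalg n q)"
  shows "coord n q (X \<oplus>\<^bsub>symalg n q\<^esub> Y) = coord n q X + coord n q Y"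
    and "coord n q (X \<otimes>\<^bsub>symalg n q\<^esub> Y) = q_prod q (coord n q X) (coord n q Y)"
    and "coord n q (c \<odot>\<^bsub>symalg n q\<^esub> X) = c *\<^sub>C coord n q X"
    and "coord n q \<one>\<^bsub>symalg n q\<^esub> = basis_vec {#}"
    and "coord n q \<zero>\<^bsub>symalg n q\<^esub> = 0"
  using assms
  by (auto simp: sym_carrier sym_simps words_closed coord_word_class q_poly_simps q_poly_prod)

lemma coord_sym_component:
  assumes "X \<in> sym_component n q d" "A \<in> keys (coord n q X)"
  shows "int (size A) = d"
proof -
  obtain f where f: "X = commutation_ideal n q +>\<^bsub>free_algebra n\<^esub> f" "f \<in> carrier (free_algebra n)"
    "\<And>w. f w \<noteq> 0 \<Longrightarrow> int (length w) = d" using assms(1) by (auto simp: sym_component_def)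
  then obtain x where x: "x \<in> words n" "f = lookup x" by (auto simp: free_algebra_carrier)
  then have X: "coord n q X = q_poly q x" using f coord_word_class by (simp add: word_class_def)
  have "keys (q_poly q x) \<subseteq> {A. int (size A) = d}"
  proof (rule clinear_keys[OF q_poly_linear])
    fix w assume "w \<in> keys x"
    then have "int (length w) = d" using f x by (auto simp: in_keys_iff)
    moreover obtain c where "word_poly q w = c *\<^sub>C basis_vec (mset w)" using word_poly_basis by blast
    ultimately show "keys (q_poly q (basis_vec w)) \<subseteq> {A. int (size A) = d}"
      by (auto simp: in_keys_iff lookup_single when_def split: if_splits)
  qed
  then show ?thesis using assms(2) X by auto
qed

lemma word_class_sym_component:
  assumes "x \<in> words n" "\<And>w. w \<in> keys x \<Longrightarrow> int (length w) = d"
  shows "word_class n q x \<in> sym_component n q d"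
  unfolding sym_component_def word_class_def
  using assms by (auto simp: free_algebra_carrier in_keys_iff)

end


section \<open>Deformations from coordinates\<close>

abbreviation triples :: "nat \<Rightarrow> (nat \<times> nat \<times> nat) set" where
  "triples k \<equiv> {(l, i, j). l + i + j = k}"

lemma finite_triples [simp]: "finite (triples k)"
  by (rule finite_subset[of _ "{..k} \<times> {..k} \<times> {..k}"]) auto

definition series_prod :: "(nat \<Rightarrow> 'v \<Rightarrow> 'v \<Rightarrow> 'v) \<Rightarrow> (nat \<Rightarrow> 'v) \<Rightarrow> (nat \<Rightarrow> 'v) \<Rightarrow> nat \<Rightarrow> 'v::cvec" where
  "series_prod m f g k = (\<Sum>(l, i, j)\<in>triples k. m l (f i) (g j))"

text \<open>
  Both sides are sums over quintuples of exponents with sum \<open>k\<close>.  For fixed exponents in the three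
  factors, \<open>assoc\<close> compares the sums over the remaining two.
\<close>

lemma series_prod_assoc:
  assumes left: "\<And>l y. clinear (\<lambda>x. m l x y)" and right: "\<And>l x. clinear (m l x)"
    and assoc: "\<And>l x y z. (\<Sum>k\<le>l. m (l - k) (m k x y) z) = (\<Sum>k\<le>l. m k x (m (l - k) y z))"
  shows "series_prod m (series_prod m f g) h k = series_prod m f (series_prod m g h) k"
proof -
  let ?Q = "{(N, b, c, j). N + b + c + j = k}"
  have finite_Q: "finite ?Q"
    by (rule finite_subset[of _ "{..k} \<times> {..k} \<times> {..k} \<times> {..k}"]) auto
  have "series_prod m (series_prod m f g) h k
      = (\<Sum>t\<in>triples k. \<Sum>u\<in>triples (fst (snd t)).
          m (fst t) (m (fst u) (f (fst (snd u))) (g (snd (snd u)))) (h (snd (snd t))))"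
    unfolding series_prod_def split_def by (simp add: clinear_sum[OF left])
  also have "\<dots> = (\<Sum>(t, u)\<in>Sigma (triples k) (\<lambda>t. triples (fst (snd t))).
          m (fst t) (m (fst u) (f (fst (snd u))) (g (snd (snd u)))) (h (snd (snd t))))"
    by (rule sum.Sigma) auto
  also have "\<dots> = (\<Sum>(s, a)\<in>Sigma ?Q (\<lambda>s. {..fst s}).
          m (fst s - a) (m a (f (fst (snd s))) (g (fst (snd (snd s))))) (h (snd (snd (snd s)))))"
    by (rule sum.reindex_bij_witness[of _
          "\<lambda>((N, b, c, j), a). ((N - a, a + b + c, j), (a, b, c))"
          "\<lambda>((l, i, j), (a, b, c)). ((l + a, b, c, j), a)"]) auto
  also have "\<dots> = (\<Sum>s\<in>?Q. \<Sum>a\<le>fst s.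
          m (fst s - a) (m a (f (fst (snd s))) (g (fst (snd (snd s))))) (h (snd (snd (snd s)))))"
    by (rule sum.Sigma[symmetric]) (use finite_Q in auto)
  also have "\<dots> = (\<Sum>s\<in>?Q. \<Sum>a\<le>fst s.
          m a (f (fst (snd s))) (m (fst s - a) (g (fst (snd (snd s)))) (h (snd (snd (snd s))))))"
    by (simp only: assoc)
  also have "\<dots> = (\<Sum>(s, a)\<in>Sigma ?Q (\<lambda>s. {..fst s}).
          m a (f (fst (snd s))) (m (fst s - a) (g (fst (snd (snd s)))) (h (snd (snd (snd s))))))"
    by (rule sum.Sigma) (use finite_Q in auto)
  also have "\<dots> = (\<Sum>(t, u)\<in>Sigma (triples k) (\<lambda>t. triples (snd (snd t))).
          m (fst t) (f (fst (snd t))) (m (fst u) (g (fst (snd u))) (h (snd (snd u)))))"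
    by (rule sum.reindex_bij_witness[of _
          "\<lambda>((l, i, j), (a, b, c)). ((l + a, i, b, c), l)"
          "\<lambda>((N, i, b, c), l). ((l, i, N - l + b + c), (N - l, b, c))"]) auto
  also have "\<dots> = (\<Sum>t\<in>triples k. \<Sum>u\<in>triples (snd (snd t)).
          m (fst t) (f (fst (snd t))) (m (fst u) (g (fst (snd u))) (h (snd (snd u)))))"
    by (rule sum.Sigma[symmetric]) auto
  also have "\<dots> = series_prod m f (series_prod m g h) k"
    unfolding series_prod_def split_def by (simp add: clinear_sum[OF right])
  finally show ?thesis .
qed

lemma series_prod_unit:
  assumes left: "\<And>l y. clinear (\<lambda>x. m l x y)" and right: "\<And>l x. clinear (m l x)"
  shows "(\<And>l j. m l u (f j) = (if l = 0 then f j else 0)) \<Longrightarrow>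
      series_prod m (\<lambda>i. if i = 0 then u else 0) f k = f k"
    and "(\<And>l i. m l (f i) u = (if l = 0 then f i else 0)) \<Longrightarrow>
      series_prod m f (\<lambda>i. if i = 0 then u else 0) k = f k"
proof -
  assume u: "\<And>l j. m l u (f j) = (if l = 0 then f j else 0)"
  have "series_prod m (\<lambda>i. if i = 0 then u else 0) f k
      = (\<Sum>t\<in>triples k. if t = (0, 0, k) then f k else 0)"
    unfolding series_prod_def by (rule sum.cong) (auto simp: u clinear_zero[OF left] split: if_splits)
  then show "series_prod m (\<lambda>i. if i = 0 then u else 0) f k = f k" by simp
next
  assume u: "\<And>l i. m l (f i) u = (if l = 0 then f i else 0)"
  have "series_prod m f (\<lambda>i. if i = 0 then u else 0) k
      = (\<Sum>t\<in>triples k. if t = (0, k, 0) then f k else 0)"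
    unfolding series_prod_def by (rule sum.cong) (auto simp: u clinear_zero[OF right] split: if_splits)
  then show "series_prod m f (\<lambda>i. if i = 0 then u else 0) k = f k" by simp
qed

text \<open>
  It suffices to construct the coefficients of a deformation in coordinates, because sums over
  \<open>carrier R\<close> become sums in a vector space.
\<close>

lemma deformation_transport:
  fixes R :: "(complex, 'a) module" and \<Theta> :: "'a \<Rightarrow> 'v::cvec" and \<Theta>' :: "'v \<Rightarrow> 'a"
  assumes inverse: "\<And>r. r \<in> carrier R \<Longrightarrow> \<Theta>' (\<Theta> r) = r" "\<And>r. r \<in> carrier R \<Longrightarrow> \<Theta> r \<in> W"
      "\<And>x. x \<in> W \<Longrightarrow> \<Theta> (\<Theta>' x) = x" "\<And>x. x \<in> W \<Longrightarrow> \<Theta>' x \<in> carrier R"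
    and add: "\<And>r s. r \<in> carrier R \<Longrightarrow> s \<in> carrier R \<Longrightarrow>
      r \<oplus>\<^bsub>R\<^esub> s \<in> carrier R \<and> \<Theta> (r \<oplus>\<^bsub>R\<^esub> s) = \<Theta> r + \<Theta> s"
    and scale: "\<And>c r. r \<in> carrier R \<Longrightarrow> c \<odot>\<^bsub>R\<^esub> r \<in> carrier R \<and> \<Theta> (c \<odot>\<^bsub>R\<^esub> r) = c *\<^sub>C \<Theta> r"
    and mult: "\<And>r s. r \<in> carrier R \<Longrightarrow> s \<in> carrier R \<Longrightarrow>
      r \<otimes>\<^bsub>R\<^esub> s \<in> carrier R \<and> \<Theta> (r \<otimes>\<^bsub>R\<^esub> s) = m 0 (\<Theta> r) (\<Theta> s)"
    and zero: "\<zero>\<^bsub>R\<^esub> \<in> carrier R" "\<Theta> \<zero>\<^bsub>R\<^esub> = 0"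
    and left: "\<And>l y. clinear (\<lambda>x. m l x y)" and right: "\<And>l x. clinear (m l x)"
    and closed: "\<And>l x y. m l x y \<in> W"
    and fin: "\<And>x y. \<exists>K. \<forall>l>K. m l x y = 0"
    and assoc: "\<And>l x y z. (\<Sum>k\<le>l. m (l - k) (m k x y) z) = (\<Sum>k\<le>l. m k x (m (l - k) y z))"
    and unit: "u \<in> W" "\<And>l y. y \<in> W \<Longrightarrow> m l u y = (if l = 0 then y else 0)"
      "\<And>l x. x \<in> W \<Longrightarrow> m l x u = (if l = 0 then x else 0)"
  shows "deformation R (\<lambda>l r s. \<Theta>' (m l (\<Theta> r) (\<Theta> s)))"
proof -
  define M where "M l r s = \<Theta>' (m l (\<Theta> r) (\<Theta> s))" for l r s
  have inj: "inj_on \<Theta> (carrier R)" by (rule inj_on_inverseI[of _ \<Theta>']) (rule inverse)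
  have eqI: "r = s" if "\<Theta> r = \<Theta> s" "r \<in> carrier R" "s \<in> carrier R" for r s
    using inj_onD[OF inj] that by blast
  have m_closed: "M l r s \<in> carrier R" and \<Theta>_m: "\<Theta> (M l r s) = m l (\<Theta> r) (\<Theta> s)" for l r s
    using closed inverse by (auto simp: M_def)
  interpret abelian_monoid R
    by (rule abelian_monoid_transport[OF inj add zero])
  have finsum: "\<Theta> (finsum R f A) = (\<Sum>x\<in>A. \<Theta> (f x))" if "f \<in> A \<rightarrow> carrier R" for f and A :: "(nat \<times> nat \<times> nat) set"
    by (rule finsum_transport[OF inj add zero that])
  have "bilinear_map R (M l)" for l
    unfolding bilinear_map_def
    by (intro conjI ballI allI m_closed; rule eqI)
      (use add scale m_closed \<Theta>_m in \<open>simp_all add: clinear_simps[OF left] clinear_simps[OF right]\<close>)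
  moreover have "M 0 r s = r \<otimes>\<^bsub>R\<^esub> s" if "r \<in> carrier R" "s \<in> carrier R" for r s
    by (rule eqI) (use mult that m_closed \<Theta>_m in auto)
  moreover have "finite {l. M l r s \<noteq> \<zero>\<^bsub>R\<^esub>}" if "r \<in> carrier R" "s \<in> carrier R" for r s
  proof -
    obtain K where K: "\<And>l. l > K \<Longrightarrow> m l (\<Theta> r) (\<Theta> s) = 0" using fin by blast
    have "M l r s = \<zero>\<^bsub>R\<^esub>" if "l > K" for l
      by (rule eqI) (use K[OF that] m_closed \<Theta>_m zero in auto)
    then have "{l. M l r s \<noteq> \<zero>\<^bsub>R\<^esub>} \<subseteq> {..K}" by (auto simp: not_less[symmetric])
    then show ?thesis by (rule finite_subset) simp
  qed
  moreover have "\<exists>e. monoid \<lparr>carrier = up R, monoid.mult = deformed_mult R M, one = e\<rparr>"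
  proof -
    have dm_closed: "deformed_mult R M f g k \<in> carrier R" for f g k
      unfolding deformed_mult_def by (rule finsum_closed) (use m_closed in auto)
    have \<Theta>_dm: "\<Theta> (deformed_mult R M f g k) = series_prod m (\<lambda>i. \<Theta> (f i)) (\<lambda>j. \<Theta> (g j)) k" for f g k
    proof -
      have "\<Theta> (deformed_mult R M f g k) = (\<Sum>p\<in>triples k. \<Theta> (case p of (l, i, j) \<Rightarrow> M l (f i) (g j)))"
        unfolding deformed_mult_def by (rule finsum) (use m_closed in auto)
      also have "\<dots> = series_prod m (\<lambda>i. \<Theta> (f i)) (\<lambda>j. \<Theta> (g j)) k"
        unfolding series_prod_def by (rule sum.cong) (auto simp: \<Theta>_m)
      finally show ?thesis .
    qed
    have up_iff: "f \<in> up R \<longleftrightarrow> (\<forall>k. f k \<in> carrier R) \<and> (\<exists>N. \<forall>k>N. f k = \<zero>\<^bsub>R\<^esub>)" for f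
      by (auto simp: up_def bound_def Pi_def)
    have up_eqI: "f = g" if "f \<in> up R" "g \<in> up R" "\<And>k. \<Theta> (f k) = \<Theta> (g k)" for f g
      by (rule ext, rule eqI) (use that in \<open>simp_all add: up_iff\<close>)
    have up_closed: "deformed_mult R M f g \<in> up R" if f: "f \<in> up R" and g: "g \<in> up R" for f g
    proof -
      obtain N1 N where N1: "\<And>i. i > N1 \<Longrightarrow> f i = \<zero>\<^bsub>R\<^esub>" and N: "\<And>j. j > N \<Longrightarrow> g j = \<zero>\<^bsub>R\<^esub>"
        using f g by (auto simp: up_iff)
      (* K bounds the powers of t in each of the finitely many products of coefficients *)
      define K where "K i j = (SOME K. \<forall>l>K. m l (\<Theta> (f i)) (\<Theta> (g j)) = 0)" for i j
      have K: "m l (\<Theta> (f i)) (\<Theta> (g j)) = 0" if "l > K i j" for i j l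
        using someI_ex[OF fin, of "\<Theta> (f i)" "\<Theta> (g j)"] that unfolding K_def by blast
      define K' where "K' = (\<Sum>(i, j)\<in>{..N1} \<times> {..N}. K i j)"
      have K': "K i j \<le> K'" if "i \<le> N1" "j \<le> N" for i j
        unfolding K'_def using member_le_sum[of "(i, j)" "{..N1} \<times> {..N}" "\<lambda>(i, j). K i j"] that by auto
      have "deformed_mult R M f g k = \<zero>\<^bsub>R\<^esub>" if k: "k > K' + N1 + N" for k
      proof (rule eqI)
        have "m l (\<Theta> (f i)) (\<Theta> (g j)) = 0" if lij: "l + i + j = k" for l i j
        proof -
          consider "i > N1" | "j > N" | "i \<le> N1" "j \<le> N" "l > K'" using lij k by linarith
          then show ?thesis
          proof cases
            case 3
            then show ?thesis using K' K by (meson le_less_trans)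
          qed (simp_all add: N1 N zero clinear_zero[OF left] clinear_zero[OF right])
        qed
        then show "\<Theta> (deformed_mult R M f g k) = \<Theta> \<zero>\<^bsub>R\<^esub>"
          by (auto simp: \<Theta>_dm series_prod_def zero intro!: sum.neutral)
      qed (use dm_closed zero in auto)
      then show ?thesis using dm_closed by (auto simp: up_iff)
    qed
    define e where "e k = (if k = 0 then \<Theta>' u else \<zero>\<^bsub>R\<^esub>)" for k :: nat
    have e: "e \<in> up R" using unit inverse zero by (auto simp: up_iff e_def)
    have \<Theta>_e: "(\<lambda>i. \<Theta> (e i)) = (\<lambda>i. if i = 0 then u else 0)"
      using unit inverse zero by (auto simp: e_def)
    let ?A = "\<lparr>carrier = up R, monoid.mult = deformed_mult R M, one = e\<rparr>"
    have "monoid ?A"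
    proof (rule monoidI)
      fix f g h
      assume "f \<in> carrier ?A"
        "g \<in> carrier ?A"
        "h \<in> carrier ?A"
      then have fgh: "f \<in> up R" "g \<in> up R" "h \<in> up R" by auto
      have "deformed_mult R M (deformed_mult R M f g) h = deformed_mult R M f (deformed_mult R M g h)"
        by (rule up_eqI) (auto simp: up_closed fgh \<Theta>_dm series_prod_assoc[OF left right assoc])
      then show "f \<otimes>\<^bsub>?A\<^esub> g \<otimes>\<^bsub>?A\<^esub> h = f \<otimes>\<^bsub>?A\<^esub> (g \<otimes>\<^bsub>?A\<^esub> h)" by simp
    next
      fix f assume "f \<in> carrier ?A"
      then have f: "f \<in> up R" by simp
      then have fW: "\<Theta> (f i) \<in> W" for i using inverse by (auto simp: up_iff)
      have "deformed_mult R M e f = f"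
        by (rule up_eqI[OF up_closed[OF e f] f])
          (simp add: \<Theta>_dm \<Theta>_e series_prod_unit(1)[OF left right] unit fW)
      then show "\<one>\<^bsub>?A\<^esub> \<otimes>\<^bsub>?A\<^esub> f = f" by simp
      have "deformed_mult R M f e = f"
        by (rule up_eqI[OF up_closed[OF f e] f])
          (simp add: \<Theta>_dm \<Theta>_e series_prod_unit(2)[OF left right] unit fW)
      then show "f \<otimes>\<^bsub>?A\<^esub> \<one>\<^bsub>?A\<^esub> = f" by simp
    qed (use up_closed e in auto)
    then show ?thesis by blast
  qed
  ultimately have "deformation R M" unfolding deformation_def by blast
  then show ?thesis by (simp add: M_def[abs_def])
qed


section \<open>Coordinates on the skew group algebra\<close>

text \<open>
  \<open>place g s\<close> is \<open>s g\<close>, and \<open>slice n g x\<close> is the coefficient of \<open>g\<close> in \<open>x\<close> without the monomials that involve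
  letters outside \<open>{1..n}\<close>.
\<close>

definition place :: "'g \<Rightarrow> (nat multiset \<Rightarrow>\<^sub>0 complex) \<Rightarrow> nat multiset \<times> 'g \<Rightarrow>\<^sub>0 complex" where
  "place g = lin_ext (\<lambda>A. basis_vec (A, g))"

definition slice :: "nat \<Rightarrow> 'g \<Rightarrow> (nat multiset \<times> 'g \<Rightarrow>\<^sub>0 complex) \<Rightarrow> nat multiset \<Rightarrow>\<^sub>0 complex" where
  "slice n g = lin_ext (\<lambda>b. if snd b = g \<and> set_mset (fst b) \<subseteq> {1..n} then basis_vec (fst b) else 0)"

lemma place_linear: "clinear (place g)" and slice_linear: "clinear (slice n g)"
  by (simp_all add: place_def slice_def clinear_lin_ext)

lemmas place_simps = clinear_simps[OF place_linear]
lemmas slice_simps = clinear_simps[OF slice_linear]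

lemma place_basis [simp]: "place g (basis_vec A) = basis_vec (A, g)"
  by (simp add: place_def)

lemma slice_basis: "slice n g (basis_vec (A, h)) = (if h = g \<and> set_mset A \<subseteq> {1..n} then basis_vec A else 0)"
  by (simp add: slice_def)

lemma monomials_closed:
  "0 \<in> monomials n" "basis_vec A \<in> monomials n \<longleftrightarrow> set_mset A \<subseteq> {1..n}"
  "x \<in> monomials n \<Longrightarrow> y \<in> monomials n \<Longrightarrow> x + y \<in> monomials n"
  "x \<in> monomials n \<Longrightarrow> c *\<^sub>C x \<in> monomials n"
proof -
  show "x \<in> monomials n \<Longrightarrow> y \<in> monomials n \<Longrightarrow> x + y \<in> monomials n"
    by (simp add: monomials_def keys_add_subset)
qed (auto simp: monomials_def in_keys_iff)

lemma q_prod_monomials: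
  assumes "x \<in> monomials n" "y \<in> monomials n"
  shows "q_prod q x y \<in> monomials n"
  unfolding q_prod_def monomials_def mem_Collect_eq
proof (rule bilin_ext_keys)
  fix A A' assume "A \<in> keys x" "A' \<in> keys y"
  then have "set_mset (A + A') \<subseteq> {1..n}" using assms by (auto simp: monomials_def)
  then have "{A + A'} \<subseteq> {A. set_mset A \<subseteq> {1..n}}" by simp
  moreover have "keys (monomial_coeff q A A' *\<^sub>C basis_vec (A + A')) \<subseteq> {A + A'}"
    by (auto simp: in_keys_iff lookup_single when_def split: if_splits)
  ultimately show "keys (monomial_coeff q A A' *\<^sub>C basis_vec (A + A')) \<subseteq> {A. set_mset A \<subseteq> {1..n}}"
    by (rule subset_trans[rotated])
qed

lemma slice_monomials: "slice n g x \<in> monomials n"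
  unfolding monomials_def mem_Collect_eq by (rule clinear_keys[OF slice_linear]) (auto simp: slice_def)

lemma slice_place: "s \<in> monomials n \<Longrightarrow> slice n g (place h s) = (if h = g then s else 0)"
proof -
  assume s: "s \<in> monomials n"
  show ?thesis
    by (rule clinear_eq_on_basis[where f = "\<lambda>s. slice n g (place h s)" and
          g = "\<lambda>s. if h = g then s else 0"])
      (use s in \<open>auto simp: clinear_def slice_simps place_simps slice_basis monomials_def\<close>)
qed

lemma place_keys: "s \<in> monomials n \<Longrightarrow> g \<in> S \<Longrightarrow>
    keys (place g s) \<subseteq> {A. set_mset A \<subseteq> {1..n}} \<times> S"
  by (rule clinear_keys[OF place_linear]) (auto simp: monomials_def)

locale quantum_action = quantum_coefficients "{1..n}" q + group G
  for n q and G :: "('g, 'm) monoid_scheme" (structure) +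
  fixes \<alpha> :: "'g \<Rightarrow> (nat list \<Rightarrow> complex) set \<Rightarrow> (nat list \<Rightarrow> complex) set"
    and a :: "'g \<Rightarrow> nat \<Rightarrow> nat \<Rightarrow> complex"
  assumes finite_G: "finite (carrier G)"
    and automorphisms: "acts_by_automorphisms G (symalg n q) \<alpha>"
    and linear_action: "g \<in> carrier G \<Longrightarrow> i \<in> {1..n} \<Longrightarrow>
      coord n q (\<alpha> g (word_class n q (basis_vec [i]))) = (\<Sum>j\<in>{1..n}. a g i j *\<^sub>C basis_vec {#j#})"
begin

abbreviation R :: "(complex, 'g \<Rightarrow> (nat list \<Rightarrow> complex) set) module" where
  "R \<equiv> skew_group_algebra (symalg n q) G \<alpha>"

abbreviation S :: "(complex, (nat list \<Rightarrow> complex) set) module" where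
  "S \<equiv> symalg n q"

lemma q: "quantum_coefficients {1..n} q" by (rule quantum_coefficients_axioms)

lemma coord_monomials: "X \<in> carrier S \<Longrightarrow> coord n q X \<in> monomials n"
  using coord_bij[OF q] by (auto simp: bij_betw_def)

lemma coord_inj: "X \<in> carrier S \<Longrightarrow> Y \<in> carrier S \<Longrightarrow> coord n q X = coord n q Y \<Longrightarrow> X = Y"
  using coord_bij[OF q] by (auto simp: bij_betw_def dest: inj_onD)

text \<open>
  The inverse of \<open>coord\<close> on \<open>monomials n\<close>; outside that set its values carry no meaning.
\<close>

definition of_coord :: "(nat multiset \<Rightarrow>\<^sub>0 complex) \<Rightarrow> (nat list \<Rightarrow> complex) set" where
  "of_coord s = word_class n q (sorted_word s)"

lemma of_coord_carrier: "s \<in> monomials n \<Longrightarrow> of_coord s \<in> carrier S"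
  by (simp add: of_coord_def sym_carrier sorted_word_words)

lemma coord_of_coord: "s \<in> monomials n \<Longrightarrow> coord n q (of_coord s) = s"
  by (simp add: of_coord_def coord_word_class[OF q] sorted_word_words)

lemma of_coord_coord: "X \<in> carrier S \<Longrightarrow> of_coord (coord n q X) = X"
  by (rule coord_inj) (simp_all add: of_coord_carrier coord_of_coord coord_monomials)

definition act :: "'g \<Rightarrow> (nat multiset \<Rightarrow>\<^sub>0 complex) \<Rightarrow> nat multiset \<Rightarrow>\<^sub>0 complex" where
  "act g s = coord n q (\<alpha> g (of_coord s))"

lemma action: "group_action G (carrier S) \<alpha>"
  and action_hom: "g \<in> carrier G \<Longrightarrow> \<alpha> g \<in> ring_hom S S"
  and action_scale: "g \<in> carrier G \<Longrightarrow> X \<in> carrier S \<Longrightarrow> \<alpha> g (c \<odot>\<^bsub>S\<^esub> X) = c \<odot>\<^bsub>S\<^esub> \<alpha> g X"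
  using automorphisms by (auto simp: acts_by_automorphisms_def)

lemma action_closed: "g \<in> carrier G \<Longrightarrow> X \<in> carrier S \<Longrightarrow> \<alpha> g X \<in> carrier S"
  using action_hom[of g] by (rule ring_hom_closed)

lemma coord_action: "X \<in> carrier S \<Longrightarrow> coord n q (\<alpha> g X) = act g (coord n q X)"
  by (simp add: act_def of_coord_coord)

lemma act_monomials: "g \<in> carrier G \<Longrightarrow> s \<in> monomials n \<Longrightarrow> act g s \<in> monomials n"
  by (simp add: act_def coord_monomials action_closed of_coord_carrier)

lemma act_simps:
  assumes "g \<in> carrier G" "s \<in> monomials n" "t \<in> monomials n"
  shows act_add: "act g (s + t) = act g s + act g t"
    and act_prod: "act g (q_prod q s t) = q_prod q (act g s) (act g t)"
    and act_scaleC: "act g (c *\<^sub>C s) = c *\<^sub>C act g s"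
    and act_unit: "act g (basis_vec {#}) = basis_vec {#}"
    and act_zero: "act g 0 = 0"
    and act_mult: "h \<in> carrier G \<Longrightarrow> act (g \<otimes> h) s = act g (act h s)"
    and act_one: "act \<one> s = s"
proof -
  let ?X = "of_coord s" and ?Y = "of_coord t"
  have XY: "?X \<in> carrier S" "?Y \<in> carrier S" using assms of_coord_carrier by auto
  note hom = action_hom[OF assms(1)]
  have "coord n q (\<alpha> g (?X \<oplus>\<^bsub>S\<^esub> ?Y)) = act g (s + t)"
    using XY assms by (simp add: coord_action sym_closed[OF q] coord_simps[OF q] coord_of_coord)
  then show "act g (s + t) = act g s + act g t"
    using XY assms
    by (simp add: ring_hom_add[OF hom] coord_simps[OF q] action_closed coord_action coord_of_coord)
  have "coord n q (\<alpha> g (?X \<otimes>\<^bsub>S\<^esub> ?Y)) = act g (q_prod q s t)"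
    using XY assms by (simp add: coord_action sym_closed[OF q] coord_simps[OF q] coord_of_coord)
  then show "act g (q_prod q s t) = q_prod q (act g s) (act g t)"
    using XY assms
    by (simp add: ring_hom_mult[OF hom] coord_simps[OF q] action_closed coord_action coord_of_coord)
  have scale: "coord n q (\<alpha> g (c \<odot>\<^bsub>S\<^esub> ?X)) = act g (c *\<^sub>C s)" for c
    using XY assms
    by (simp add: coord_action sym_closed[OF q] coord_simps[OF q XY(1) XY(1)] coord_of_coord)
  then show scale: "act g (c *\<^sub>C s) = c *\<^sub>C act g s" for c
    using XY assms
    by (simp add: action_scale coord_simps[OF q action_closed[OF assms(1) XY(1)] XY(1)] coord_action coord_of_coord)
  show "act g 0 = 0" using scale[of 0] by simp
  have "coord n q (\<alpha> g \<one>\<^bsub>S\<^esub>) = act g (basis_vec {#})"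
    using XY by (simp add: coord_action sym_closed[OF q XY] coord_simps[OF q XY])
  then show "act g (basis_vec {#}) = basis_vec {#}"
    using ring_hom_one[OF hom] coord_simps(4)[OF q XY] by simp
  show "act \<one> s = s"
    using group_action.id_eq_one[OF action] XY assms
    by (simp add: act_def coord_of_coord) (metis coord_of_coord restrict_apply')
  assume h: "h \<in> carrier G"
  show "act (g \<otimes> h) s = act g (act h s)"
    using group_action.composition_rule[OF action XY(1) assms(1) h] XY h
    by (simp add: act_def[of "g \<otimes> h"] act_def[of h] coord_action action_closed)
qed

lemma act_gen: "g \<in> carrier G \<Longrightarrow> i \<in> {1..n} \<Longrightarrow> act g (basis_vec {#i#}) = (\<Sum>j\<in>{1..n}. a g i j *\<^sub>C basis_vec {#j#})"
  using linear_action[of g i] by (simp add: act_def of_coord_def)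

definition pr :: "(nat multiset \<times> 'g \<Rightarrow>\<^sub>0 complex) \<Rightarrow> (nat multiset \<times> 'g \<Rightarrow>\<^sub>0 complex) \<Rightarrow>
    nat multiset \<times> 'g \<Rightarrow>\<^sub>0 complex" where
  "pr x y = (\<Sum>g\<in>carrier G. \<Sum>h\<in>carrier G. place (g \<otimes> h) (q_prod q (slice n g x) (act g (slice n h y))))"

lemma pr_linear_left: "clinear (\<lambda>x. pr x y)"
  by standard (simp_all add: pr_def slice_simps q_prod_simps place_simps sum.distrib scaleC_sum_right)

lemma pr_linear_right: "clinear (pr x)"
  by standard (simp_all add: pr_def slice_simps q_prod_simps place_simps sum.distrib scaleC_sum_right
      act_simps[OF _ slice_monomials slice_monomials] cong: sum.cong)

lemmas pr_simps = clinear_simps[OF pr_linear_left] clinear_simps[OF pr_linear_right]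

lemma act_zero': "g \<in> carrier G \<Longrightarrow> act g 0 = 0"
  by (rule act_zero[of g 0 0]) (auto simp: monomials_closed)

lemma pr_place:
  assumes "g \<in> carrier G" "h \<in> carrier G" "s \<in> monomials n" "t \<in> monomials n"
  shows "pr (place g s) (place h t) = place (g \<otimes> h) (q_prod q s (act g t))"
proof -
  have "pr (place g s) (place h t) = (\<Sum>g'\<in>carrier G. \<Sum>h'\<in>carrier G.
      if h' = h then if g' = g then place (g \<otimes> h) (q_prod q s (act g t)) else 0 else 0)"
    unfolding pr_def
    by (intro sum.cong refl)
      (use assms in \<open>auto simp: slice_place act_zero' q_prod_simps place_simps\<close>)
  then show ?thesis using assms finite_G by simp
qed

abbreviation index_set :: "(nat multiset \<times> 'g) set" where
  "index_set \<equiv> {A. set_mset A \<subseteq> {1..n}} \<times> carrier G"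

lemma slice_outside: "g \<in> carrier G \<Longrightarrow> b \<notin> index_set \<Longrightarrow> slice n g (basis_vec b) = 0"
  by (cases b) (auto simp: slice_basis)

lemma pr_outside: "b \<notin> index_set \<Longrightarrow> pr (basis_vec b) y = 0" "b \<notin> index_set \<Longrightarrow> pr x (basis_vec b) = 0"
  by (auto simp: pr_def slice_outside q_prod_simps place_simps act_zero' intro!: sum.neutral)

lemma pr_keys: "keys (pr x y) \<subseteq> index_set"
  unfolding pr_def
  by (intro keys_sum_subset place_keys q_prod_monomials act_monomials slice_monomials) auto

sublocale skew_model "{1..n}" q G pr a
proof
  show "finite (carrier G)" by (rule finite_G)
  show "clinear (\<lambda>x. pr x y)" for y by (rule pr_linear_left)
  show "clinear (pr x)" for x by (rule pr_linear_right)
  show "pr (pr x y) z = pr x (pr y z)" for x y z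
  proof (rule bilinear_assocI[OF pr_linear_left pr_linear_right])
    fix b c d
    show "pr (pr (basis_vec b) (basis_vec c)) (basis_vec d) = pr (basis_vec b) (pr (basis_vec c) (basis_vec d))"
    proof (cases "b \<in> index_set \<and> c \<in> index_set \<and> d \<in> index_set")
      case False
      then show ?thesis by (auto simp: pr_outside pr_simps)
    next
      case True
      then obtain A g A' h A'' k where bcd: "b = (A, g)" "c = (A', h)" "d = (A'', k)"
        and G: "g \<in> carrier G" "h \<in> carrier G" "k \<in> carrier G"
        and A: "basis_vec A \<in> monomials n" "basis_vec A' \<in> monomials n" "basis_vec A'' \<in> monomials n"
        by (auto simp: monomials_closed)
      have "pr (pr (place g (basis_vec A)) (place h (basis_vec A'))) (place k (basis_vec A''))
          = pr (place g (basis_vec A)) (pr (place h (basis_vec A')) (place k (basis_vec A'')))"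
        using G A
        by (simp only: pr_place m_closed q_prod_monomials act_monomials)
          (simp add: act_prod act_monomials act_mult q_prod_assoc m_assoc del: q_prod_basis)
      then show ?thesis by (simp add: bcd)
    qed
  qed
  show "pr x (basis_vec b) = 0" if "b \<notin> index_set" for b x
    using that by (rule pr_outside)
  show "keys (pr x y) \<subseteq> index_set" for x y by (rule pr_keys)
  show "pr (basis_vec ({#}, \<one>)) (basis_vec b) = basis_vec b"
    "pr (basis_vec b) (basis_vec ({#}, \<one>)) = basis_vec b" if "b \<in> index_set" for b
    using that pr_place[of \<one> "snd b" "basis_vec {#}" "basis_vec (fst b)"]
      pr_place[of "snd b" \<one> "basis_vec (fst b)" "basis_vec {#}"]
    by (auto simp: monomials_closed act_simps[of _ "basis_vec (fst b)" "basis_vec (fst b)"])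
  show "pr (basis_vec ({#i#}, \<one>)) (basis_vec (A, g)) = move_coeff q i A *\<^sub>C basis_vec (add_mset i A, g)"
    if "i \<in> {1..n}" "set_mset A \<subseteq> {1..n}" "g \<in> carrier G" for i A g
    using that pr_place[of \<one> g "basis_vec {#i#}" "basis_vec A"]
    by (simp add: monomials_closed act_one[of g "basis_vec A" "basis_vec A"] place_simps)
  show "pr (basis_vec ({#}, h)) (basis_vec ({#}, g)) = basis_vec ({#}, h \<otimes> g)"
    if "h \<in> carrier G" "g \<in> carrier G" for h g
    using that pr_place[of h g "basis_vec {#}" "basis_vec {#}"]
    by (simp add: monomials_closed act_unit[of h "basis_vec {#}" "basis_vec {#}"])
  show "pr (basis_vec ({#}, h)) (basis_vec ({#i#}, \<one>)) = (\<Sum>j\<in>{1..n}. a h i j *\<^sub>C basis_vec ({#j#}, h))"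
    if "h \<in> carrier G" "i \<in> {1..n}" for h i
    using that pr_place[of h \<one> "basis_vec {#}" "basis_vec {#i#}"]
    by (simp add: monomials_closed act_gen place_simps)
qed

definition to_coord :: "('g \<Rightarrow> (nat list \<Rightarrow> complex) set) \<Rightarrow> nat multiset \<times> 'g \<Rightarrow>\<^sub>0 complex" where
  "to_coord r = (\<Sum>g\<in>carrier G. place g (coord n q (r g)))"

text \<open>
  The inverse of \<open>to_coord\<close>.  Superfluous basis vectors are sent to 0, so that \<open>trunc\<close> is the projection
  onto the span of the index set.
\<close>

definition from_coord :: "(nat multiset \<times> 'g \<Rightarrow>\<^sub>0 complex) \<Rightarrow> 'g \<Rightarrow> (nat list \<Rightarrow> complex) set" where
  "from_coord x = (\<lambda>g\<in>carrier G. of_coord (slice n g x))"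

abbreviation trunc :: "(nat multiset \<times> 'g \<Rightarrow>\<^sub>0 complex) \<Rightarrow> nat multiset \<times> 'g \<Rightarrow>\<^sub>0 complex" where
  "trunc x \<equiv> to_coord (from_coord x)"

lemma R_carrier: "r \<in> carrier R \<longleftrightarrow> r \<in> carrier G \<rightarrow>\<^sub>E carrier S"
  by (simp add: skew_group_algebra_def)

lemma R_apply: "r \<in> carrier R \<Longrightarrow> g \<in> carrier G \<Longrightarrow> r g \<in> carrier S"
  by (auto simp: R_carrier)

lemma from_coord_carrier: "from_coord x \<in> carrier R"
  by (simp add: R_carrier from_coord_def of_coord_carrier slice_monomials)

lemma slice_to_coord:
  assumes "r \<in> carrier R" "g \<in> carrier G"
  shows "slice n g (to_coord r) = coord n q (r g)"
proof -
  have "slice n g (to_coord r) = (\<Sum>h\<in>carrier G. if h = g then coord n q (r g) else 0)"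
    unfolding to_coord_def slice_simps
    by (intro sum.cong refl) (use assms in \<open>auto simp: slice_place coord_monomials R_apply\<close>)
  then show ?thesis using assms finite_G by simp
qed

lemma from_coord_to_coord: "r \<in> carrier R \<Longrightarrow> from_coord (to_coord r) = r"
  by (rule extensionalityI[of _ "carrier G"])
    (auto simp: from_coord_def slice_to_coord of_coord_coord R_apply R_carrier PiE_def)

lemma to_coord_keys: "r \<in> carrier R \<Longrightarrow> keys (to_coord r) \<subseteq> index_set"
  unfolding to_coord_def
  by (intro keys_sum_subset place_keys coord_monomials R_apply)

lemma trunc_eq: "trunc x = (\<Sum>g\<in>carrier G. place g (slice n g x))"
  unfolding to_coord_def
  by (intro sum.cong refl) (simp add: from_coord_def coord_of_coord slice_monomials)

lemma trunc_id:
  assumes "keys x \<subseteq> index_set"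
  shows "trunc x = x"
  unfolding trunc_eq
proof (rule clinear_eq_on_basis[where f = "\<lambda>x. \<Sum>g\<in>carrier G. place g (slice n g x)" and g = "\<lambda>x. x"])
  fix b assume "b \<in> keys x"
  then obtain A h where b: "b = (A, h)" "set_mset A \<subseteq> {1..n}" "h \<in> carrier G" using assms by auto
  have "(\<Sum>g\<in>carrier G. place g (slice n g (basis_vec b)))
      = (\<Sum>g\<in>carrier G. if h = g then basis_vec b else 0)"
    by (intro sum.cong refl) (use b in \<open>auto simp: slice_basis place_simps\<close>)
  then show "(\<Sum>g\<in>carrier G. place g (slice n g (basis_vec b))) = basis_vec b"
    using b finite_G by simp
qed (auto simp: clinear_def slice_simps place_simps sum.distrib scaleC_sum_right)

lemma slice_trunc: "g \<in> carrier G \<Longrightarrow> slice n g (trunc x) = slice n g x"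
  by (simp add: slice_to_coord[OF from_coord_carrier]) (simp add: from_coord_def coord_of_coord slice_monomials)

lemma pr_trunc: "pr (trunc x) y = pr x y" "pr x (trunc y) = pr x y"
  by (simp_all add: pr_def slice_trunc)

lemma to_coord_inj: "r \<in> carrier R \<Longrightarrow> s \<in> carrier R \<Longrightarrow> to_coord r = to_coord s \<Longrightarrow> r = s"
  by (metis from_coord_to_coord)

lemma to_coord_simps:
  assumes "r \<in> carrier R" "s \<in> carrier R"
  shows "r \<oplus>\<^bsub>R\<^esub> s \<in> carrier R \<and> to_coord (r \<oplus>\<^bsub>R\<^esub> s) = to_coord r + to_coord s"
    and "c \<odot>\<^bsub>R\<^esub> r \<in> carrier R \<and> to_coord (c \<odot>\<^bsub>R\<^esub> r) = c *\<^sub>C to_coord r"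
    and "r \<otimes>\<^bsub>R\<^esub> s \<in> carrier R \<and> to_coord (r \<otimes>\<^bsub>R\<^esub> s) = pr (to_coord r) (to_coord s)"
    and "\<zero>\<^bsub>R\<^esub> \<in> carrier R \<and> to_coord \<zero>\<^bsub>R\<^esub> = 0"
proof -
  note rs = R_apply[OF assms(1)] R_apply[OF assms(2)]
  show "r \<oplus>\<^bsub>R\<^esub> s \<in> carrier R \<and> to_coord (r \<oplus>\<^bsub>R\<^esub> s) = to_coord r + to_coord s"
    using rs by (auto simp: R_carrier to_coord_def sum.distrib[symmetric] intro!: sum.cong)
      (auto simp: skew_group_algebra_def sym_closed[OF q] coord_simps[OF q] place_simps)
  have "c \<odot>\<^bsub>S\<^esub> X \<in> carrier S" "coord n q (c \<odot>\<^bsub>S\<^esub> X) = c *\<^sub>C coord n q X" if "X \<in> carrier S" for X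
    using sym_closed(3)[OF q that that] coord_simps(3)[OF q that that] by simp_all
  then show "c \<odot>\<^bsub>R\<^esub> r \<in> carrier R \<and> to_coord (c \<odot>\<^bsub>R\<^esub> r) = c *\<^sub>C to_coord r"
    using rs by (auto simp: R_carrier to_coord_def scaleC_sum_right intro!: sum.cong)
      (auto simp: skew_group_algebra_def place_simps)
  have z: "\<zero>\<^bsub>S\<^esub> \<in> carrier S" "coord n q \<zero>\<^bsub>S\<^esub> = 0"
    using sym_closed(5)[OF q] coord_simps(5)[OF q] of_coord_carrier[OF monomials_closed(1)] by auto
  then show "\<zero>\<^bsub>R\<^esub> \<in> carrier R \<and> to_coord \<zero>\<^bsub>R\<^esub> = 0"
    by (auto simp: R_carrier to_coord_def intro!: sum.neutral)
      (auto simp: skew_group_algebra_def place_simps)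
  have inj: "inj_on (coord n q) (carrier S)" using coord_bij[OF q] by (simp add: bij_betw_def)
  have S_add: "X \<oplus>\<^bsub>S\<^esub> Y \<in> carrier S \<and> coord n q (X \<oplus>\<^bsub>S\<^esub> Y) = coord n q X + coord n q Y"
    if "X \<in> carrier S" "Y \<in> carrier S" for X Y
    using sym_closed(1)[OF q that] coord_simps(1)[OF q that] by simp
  interpret S: abelian_monoid S by (rule abelian_monoid_transport[OF inj S_add z])
  have summand: "r g \<otimes>\<^bsub>S\<^esub> \<alpha> g (s (inv g \<otimes> k)) \<in> carrier S"
    "coord n q (r g \<otimes>\<^bsub>S\<^esub> \<alpha> g (s (inv g \<otimes> k))) = q_prod q (coord n q (r g)) (act g (coord n q (s (inv g \<otimes> k))))"
    if "g \<in> carrier G" "k \<in> carrier G" for g k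
    using that rs by (auto simp: sym_closed[OF q] coord_simps[OF q] action_closed coord_action)
  have mult: "(r \<otimes>\<^bsub>R\<^esub> s) k = (\<Oplus>\<^bsub>S\<^esub>g\<in>carrier G. r g \<otimes>\<^bsub>S\<^esub> \<alpha> g (s (inv g \<otimes> k)))" if "k \<in> carrier G" for k
    using that by (simp add: skew_group_algebra_def)
  have coord_mult: "coord n q ((r \<otimes>\<^bsub>R\<^esub> s) k)
      = (\<Sum>g\<in>carrier G. q_prod q (coord n q (r g)) (act g (coord n q (s (inv g \<otimes> k)))))" if "k \<in> carrier G" for k
    unfolding mult[OF that]
    by (subst finsum_transport[OF inj S_add z]) (use summand that in auto)
  have "r \<otimes>\<^bsub>R\<^esub> s \<in> carrier R"
  proof -
    have "(r \<otimes>\<^bsub>R\<^esub> s) k \<in> carrier S" if "k \<in> carrier G" for k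
      unfolding mult[OF that] by (rule S.finsum_closed) (use summand that in auto)
    moreover have "r \<otimes>\<^bsub>R\<^esub> s \<in> extensional (carrier G)" by (simp add: skew_group_algebra_def)
    ultimately show ?thesis by (simp add: R_carrier PiE_def)
  qed
  moreover have "to_coord (r \<otimes>\<^bsub>R\<^esub> s) = pr (to_coord r) (to_coord s)"
  proof -
    have "to_coord (r \<otimes>\<^bsub>R\<^esub> s) = (\<Sum>k\<in>carrier G. \<Sum>g\<in>carrier G.
        place k (q_prod q (coord n q (r g)) (act g (coord n q (s (inv g \<otimes> k))))))"
      unfolding to_coord_def by (intro sum.cong refl) (simp add: coord_mult place_simps)
    also have "\<dots> = (\<Sum>g\<in>carrier G. \<Sum>k\<in>carrier G.
        place k (q_prod q (coord n q (r g)) (act g (coord n q (s (inv g \<otimes> k))))))"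
      by (rule sum.swap)
    also have "\<dots> = (\<Sum>g\<in>carrier G. \<Sum>h\<in>carrier G.
        place (g \<otimes> h) (q_prod q (coord n q (r g)) (act g (coord n q (s h)))))"
    proof (rule sum.cong[OF refl])
      fix g assume g: "g \<in> carrier G"
      show "(\<Sum>k\<in>carrier G. place k (q_prod q (coord n q (r g)) (act g (coord n q (s (inv g \<otimes> k))))))
        = (\<Sum>h\<in>carrier G. place (g \<otimes> h) (q_prod q (coord n q (r g)) (act g (coord n q (s h)))))"
        by (rule sum.reindex_bij_witness[of _ "\<lambda>h. g \<otimes> h" "\<lambda>k. inv g \<otimes> k"])
          (use g in \<open>auto simp: m_assoc[symmetric]\<close>)
    qed
    also have "\<dots> = pr (to_coord r) (to_coord s)"
      unfolding pr_def
      by (intro sum.cong refl) (simp add: slice_to_coord[OF assms(1)] slice_to_coord[OF assms(2)])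
    finally show ?thesis .
  qed
  ultimately show "r \<otimes>\<^bsub>R\<^esub> s \<in> carrier R \<and> to_coord (r \<otimes>\<^bsub>R\<^esub> s) = pr (to_coord r) (to_coord s)" ..
qed

lemma from_coord_simps:
  "from_coord (x + y) = from_coord x \<oplus>\<^bsub>R\<^esub> from_coord y"
  "from_coord (c *\<^sub>C x) = c \<odot>\<^bsub>R\<^esub> from_coord x"
  "from_coord (pr x y) = from_coord x \<otimes>\<^bsub>R\<^esub> from_coord y"
proof -
  note F = from_coord_carrier
  show "from_coord (x + y) = from_coord x \<oplus>\<^bsub>R\<^esub> from_coord y"
    by (rule to_coord_inj) (use to_coord_simps(1)[OF F F] F in
        \<open>auto simp: trunc_eq slice_simps place_simps sum.distrib\<close>)
  show "from_coord (c *\<^sub>C x) = c \<odot>\<^bsub>R\<^esub> from_coord x"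
    by (rule to_coord_inj) (use to_coord_simps(2)[OF F F] F in
        \<open>auto simp: trunc_eq slice_simps place_simps scaleC_sum_right\<close>)
  show "from_coord (pr x y) = from_coord x \<otimes>\<^bsub>R\<^esub> from_coord y"
    by (rule to_coord_inj) (use to_coord_simps(3)[OF F F] F in \<open>auto simp: trunc_id[OF pr_keys] pr_trunc\<close>)
qed

text \<open>
  In coordinates the cocycle satisfies the assumptions of \<^locale>\<open>skew_cocycle\<close>; the product on \<open>R[t]\<close>
  obtained there is carried back to the skew group algebra.
\<close>

theorem constant_cocycle_lifts:
  assumes \<mu>: "constant_hochschild_2_cocycle n q G \<alpha> \<mu>"
  shows "\<exists>m. deformation R m \<and> (\<forall>r\<in>carrier R. \<forall>s\<in>carrier R. m 1 r s = \<mu> r s)"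
proof -
  have cocycle: "hochschild_2_cocycle R \<mu>"
    and degree: "\<And>i j r s. r \<in> skew_component n q G i \<Longrightarrow> s \<in> skew_component n q G j \<Longrightarrow>
      \<mu> r s \<in> skew_component n q G (i + j - 2)"
    using \<mu> by (auto simp: constant_hochschild_2_cocycle_def)
  have bil: "bilinear_map R \<mu>" using cocycle by (simp add: hochschild_2_cocycle_def)
  define \<mu>' where "\<mu>' x y = to_coord (\<mu> (from_coord x) (from_coord y))" for x y
  note F = from_coord_carrier
  have \<mu>_closed: "\<mu> (from_coord x) (from_coord y) \<in> carrier R" for x y
    using bil F by (simp add: bilinear_map_def)
  have from_\<mu>': "from_coord (\<mu>' x y) = \<mu> (from_coord x) (from_coord y)" for x y
    by (simp add: \<mu>'_def from_coord_to_coord \<mu>_closed)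
  have left: "clinear (\<lambda>x. \<mu>' x y)" for y
    by standard (use bil F to_coord_simps[OF \<mu>_closed \<mu>_closed] in
        \<open>auto simp: \<mu>'_def from_coord_simps bilinear_map_def\<close>)
  have right: "clinear (\<mu>' x)" for x
    by standard (use bil F to_coord_simps[OF \<mu>_closed \<mu>_closed] in
        \<open>auto simp: \<mu>'_def from_coord_simps bilinear_map_def\<close>)
  have outside: "from_coord (basis_vec b) = from_coord 0" if "b \<notin> index_set" for b
    by (rule ext) (simp add: from_coord_def slice_outside[OF _ that] slice_simps)
  have keys: "keys (\<mu>' x y) \<subseteq> index_set" for x y
    unfolding \<mu>'_def by (rule to_coord_keys) (rule \<mu>_closed)
  have component: "from_coord (basis_vec b) \<in> skew_component n q G (int (size (fst b)))" for b
  proof -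
    have "of_coord (slice n g (basis_vec b)) \<in> sym_component n q (int (size (fst b)))" for g
      unfolding of_coord_def
    proof (rule word_class_sym_component[OF q])
      show "sorted_word (slice n g (basis_vec b)) \<in> words n"
        by (rule sorted_word_words) (rule slice_monomials)
      have "length (sorted_list_of_multiset (fst b)) = size (fst b)"
        by (metis mset_sorted_list_of_multiset size_mset)
      then show "int (length w) = int (size (fst b))"
        if "w \<in> keys (sorted_word (slice n g (basis_vec b)))" for w
        using that by (cases b) (auto simp: slice_basis sorted_word_simps split: if_splits)
    qed
    then show ?thesis by (auto simp: from_coord_def skew_component_def)
  qed
  interpret skew_cocycle "{1..n}" q G pr a \<mu>'
  proof
    show "clinear (\<lambda>x. \<mu>' x y)" for y by (rule left)
    show "clinear (\<mu>' x)" for x by (rule right)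
    show "\<mu>' x (basis_vec b) = 0" if "b \<notin> index_set" for b x
    proof -
      have "\<mu>' x (basis_vec b) = \<mu>' x 0" using outside[OF that] by (simp add: \<mu>'_def)
      then show ?thesis by (simp add: clinear_zero[OF right])
    qed
    show "keys (\<mu>' x y) \<subseteq> index_set" for x y by (rule keys)
    show "pr (\<mu>' x y) z + \<mu>' (pr x y) z = \<mu>' x (pr y z) + pr x (\<mu>' y z)" for x y z
    proof -
      let ?r = "from_coord x" and ?s = "from_coord y" and ?u = "from_coord z"
      have "\<mu> ?r ?s \<otimes>\<^bsub>R\<^esub> ?u \<oplus>\<^bsub>R\<^esub> \<mu> (?r \<otimes>\<^bsub>R\<^esub> ?s) ?u
          = \<mu> ?r (?s \<otimes>\<^bsub>R\<^esub> ?u) \<oplus>\<^bsub>R\<^esub> ?r \<otimes>\<^bsub>R\<^esub> \<mu> ?s ?u"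
        using cocycle F by (simp add: hochschild_2_cocycle_def)
      then have "from_coord (pr (\<mu>' x y) z + \<mu>' (pr x y) z) = from_coord (\<mu>' x (pr y z) + pr x (\<mu>' y z))"
        by (simp add: from_coord_simps from_\<mu>')
      then have "trunc (pr (\<mu>' x y) z + \<mu>' (pr x y) z) = trunc (\<mu>' x (pr y z) + pr x (\<mu>' y z))"
        by simp
      then show ?thesis
        by (simp only: trunc_id keys_add_subset keys pr_keys)
    qed
    show "\<mu>' (basis_vec b) (basis_vec b') \<in> degree_le (int (size (fst b)) + int (size (fst b')) - 2)" for b b'
    proof -
      let ?d = "int (size (fst b)) + int (size (fst b')) - 2"
      let ?r = "\<mu> (from_coord (basis_vec b)) (from_coord (basis_vec b'))"
      have r: "?r \<in> skew_component n q G ?d" by (rule degree) (rule component)+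
      have "keys (place g (coord n q (?r g))) \<subseteq> {c. int (size (fst c)) \<le> ?d}"
        if "g \<in> carrier G" for g
      proof (rule clinear_keys[OF place_linear])
        fix A assume "A \<in> keys (coord n q (?r g))"
        moreover have "?r g \<in> sym_component n q ?d" using r that by (auto simp: skew_component_def)
        ultimately have "int (size A) = ?d" using coord_sym_component[OF q] by blast
        then show "keys (place g (basis_vec A)) \<subseteq> {c. int (size (fst c)) \<le> ?d}" by simp
      qed
      then have "keys (to_coord ?r) \<subseteq> {c. int (size (fst c)) \<le> ?d}"
        unfolding to_coord_def by (rule keys_sum_subset)
      then show ?thesis by (auto simp: \<mu>'_def degree_le_def)
    qed
  qed
  obtain X U c where "star_generators {1..n} q G pr a \<mu>' X U c" by (rule star_generators_exist)
  then interpret star_generators "{1..n}" q G pr a \<mu>' X U c .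
  have "deformation R (\<lambda>l r s. from_coord (star l (to_coord r) (to_coord s)))"
  proof (rule deformation_transport[where W = "{x. keys x \<subseteq> index_set}" and u = "grp \<one>"])
    show "from_coord (to_coord r) = r" "to_coord r \<in> {x. keys x \<subseteq> index_set}" if "r \<in> carrier R" for r
      using that from_coord_to_coord to_coord_keys by auto
    show "to_coord (from_coord x) = x" "from_coord x \<in> carrier R" if "x \<in> {x. keys x \<subseteq> index_set}" for x
      using that trunc_id F by auto
    show "r \<oplus>\<^bsub>R\<^esub> s \<in> carrier R \<and> to_coord (r \<oplus>\<^bsub>R\<^esub> s) = to_coord r + to_coord s"
      "r \<otimes>\<^bsub>R\<^esub> s \<in> carrier R \<and> to_coord (r \<otimes>\<^bsub>R\<^esub> s) = star 0 (to_coord r) (to_coord s)"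
      if "r \<in> carrier R" "s \<in> carrier R" for r s
      using to_coord_simps(1,3)[OF that] by (simp_all only: star_0_1)
    show "c \<odot>\<^bsub>R\<^esub> r \<in> carrier R \<and> to_coord (c \<odot>\<^bsub>R\<^esub> r) = c *\<^sub>C to_coord r" if "r \<in> carrier R" for c r
      by (rule to_coord_simps(2)[OF that that])
    show "\<zero>\<^bsub>R\<^esub> \<in> carrier R" "to_coord \<zero>\<^bsub>R\<^esub> = 0"
      using to_coord_simps(4)[OF F F] by auto
    show "grp \<one> \<in> {x. keys x \<subseteq> index_set}" by simp
  qed (simp_all only: star_linear_left star_linear_right star_keys star_finite star_assoc
      star_one_left star_one_right unit_left mem_Collect_eq)
  moreover have "from_coord (star 1 (to_coord r) (to_coord s)) = \<mu> r s"
    if "r \<in> carrier R" "s \<in> carrier R" for r s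
    using that by (simp only: star_0_1 unit_left to_coord_keys from_\<mu>' from_coord_to_coord)
  ultimately show ?thesis by blast
qed

end

lemma coord_generator_map:
  assumes q: "quantum_coefficients {1..n} q"
  shows "generator_map scale n v q x \<in> carrier (symalg n q)"
    and "coord n q (generator_map scale n v q x)
      = (\<Sum>i\<in>{1..n}. Modules.module.representation scale (v ` {1..n}) x (v i) *\<^sub>C basis_vec {#i#})"
proof -
  let ?S = "symalg n q" and ?c = "\<lambda>i. Modules.module.representation scale (v ` {1..n}) x (v i)"
  let ?f = "\<lambda>i. ?c i \<odot>\<^bsub>?S\<^esub> algebra_gen n q i"
  have gen: "algebra_gen n q i = word_class n q (basis_vec [i])" for i
    by (simp add: algebra_gen_def word_class_def)
  have f: "?f i \<in> carrier ?S" "coord n q (?f i) = ?c i *\<^sub>C basis_vec {#i#}" if "i \<in> {1..n}" for i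
  proof -
    have w: "basis_vec [i] \<in> words n" using that by (simp add: words_closed)
    then show "?f i \<in> carrier ?S"
      by (simp add: gen sym_simps(3)[OF q w w] sym_carrier words_closed)
    show "coord n q (?f i) = ?c i *\<^sub>C basis_vec {#i#}"
      using w by (simp add: gen sym_simps(3)[OF q w w] coord_word_class[OF q] words_closed q_poly_simps)
  qed
  have inj: "inj_on (coord n q) (carrier ?S)" using coord_bij[OF q] by (simp add: bij_betw_def)
  have S_add: "X \<oplus>\<^bsub>?S\<^esub> Y \<in> carrier ?S \<and> coord n q (X \<oplus>\<^bsub>?S\<^esub> Y) = coord n q X + coord n q Y"
    if "X \<in> carrier ?S" "Y \<in> carrier ?S" for X Y
    using sym_closed(1)[OF q that] coord_simps(1)[OF q that] by simp
  have w: "word_class n q 0 \<in> carrier ?S" by (auto simp: sym_carrier words_closed)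
  have z: "\<zero>\<^bsub>?S\<^esub> \<in> carrier ?S" "coord n q \<zero>\<^bsub>?S\<^esub> = 0"
    using sym_closed(5)[OF q w w] coord_simps(5)[OF q w w] by auto
  interpret S: abelian_monoid ?S by (rule abelian_monoid_transport[OF inj S_add z])
  have gm: "generator_map scale n v q x = (\<Oplus>\<^bsub>?S\<^esub>i\<in>{1..n}. ?f i)"
    by (simp add: generator_map_def quantum_symmetric_algebra_def)
  show "generator_map scale n v q x \<in> carrier ?S"
    unfolding gm by (rule S.finsum_closed) (use f in auto)
  show "coord n q (generator_map scale n v q x) = (\<Sum>i\<in>{1..n}. ?c i *\<^sub>C basis_vec {#i#})"
    unfolding gm by (subst finsum_transport[OF inj S_add z]) (use f in auto)
qed

theorem theorem4p6:
  fixes G :: "('g, 'm) monoid_scheme"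
    and scale :: "complex \<Rightarrow> 'v::ab_group_add \<Rightarrow> 'v"
    and n :: nat
    and v :: "nat \<Rightarrow> 'v"
    and \<rho> :: "'g \<Rightarrow> 'v \<Rightarrow> 'v"
    and q :: "nat \<Rightarrow> nat \<Rightarrow> complex"
    and \<alpha> :: "'g \<Rightarrow> (nat list \<Rightarrow> complex) set \<Rightarrow> (nat list \<Rightarrow> complex) set"
    and \<mu> :: "('g \<Rightarrow> (nat list \<Rightarrow> complex) set) \<Rightarrow> ('g \<Rightarrow> (nat list \<Rightarrow> complex) set) \<Rightarrow>
              ('g \<Rightarrow> (nat list \<Rightarrow> complex) set)"
  assumes "group G" and "finite (carrier G)"
    and "Vector_Spaces.vector_space scale"
    and "inj_on v {1..n}"
    and "\<not> Modules.module.dependent scale (v ` {1..n})"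
    and "Modules.module.span scale (v ` {1..n}) = UNIV"
    and "group_action G UNIV \<rho>"
    and "\<And>g. g \<in> carrier G \<Longrightarrow> Vector_Spaces.linear scale scale (\<rho> g)"
    and "\<And>i j. i \<in> {1..n} \<Longrightarrow> j \<in> {1..n} \<Longrightarrow> q i j \<noteq> 0"
    and "\<And>i. i \<in> {1..n} \<Longrightarrow> q i i = 1"
    and "\<And>i j. i \<in> {1..n} \<Longrightarrow> j \<in> {1..n} \<Longrightarrow> q j i = inverse (q i j)"
    and "extends_to_sym G scale n v \<rho> q \<alpha>"
    and "\<exists>\<beta>. extends_to_ext G scale n v \<rho> q \<beta>"
    and "constant_hochschild_2_cocycle n q G \<alpha> \<mu>"
  shows "\<exists>m. deformation (skew_group_algebra (quantum_symmetric_algebra n q) G \<alpha>) m \<and>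
             (\<forall>r\<in>carrier (skew_group_algebra (quantum_symmetric_algebra n q) G \<alpha>).
              \<forall>s\<in>carrier (skew_group_algebra (quantum_symmetric_algebra n q) G \<alpha>).
                m 1 r s = \<mu> r s)"
proof -
  have q: "quantum_coefficients {1..n} q"
    by (rule quantum_coefficients.intro) (rule finite_atLeastAtMost assms(9-11); assumption?)+
  interpret V: vector_space scale by (rule assms(3))
  have action: "acts_by_automorphisms G (symalg n q) \<alpha>"
    "\<And>g x. g \<in> carrier G \<Longrightarrow> \<alpha> g (generator_map scale n v q x) = generator_map scale n v q (\<rho> g x)"
    using assms(12) by (auto simp: extends_to_sym_def)
  define a where "a g i j = V.representation (v ` {1..n}) (\<rho> g (v i)) (v j)" for g i j
  have gen: "generator_map scale n v q (v i) = word_class n q (basis_vec [i])" if i: "i \<in> {1..n}" for i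
  proof -
    have w: "basis_vec [i] \<in> words n" using i by (simp add: words_closed)
    have "coord n q (generator_map scale n v q (v i)) = (\<Sum>j\<in>{1..n}. (if v j = v i then 1 else 0) *\<^sub>C basis_vec {#j#})"
      using i assms(5) by (simp add: coord_generator_map(2)[OF q] V.representation_basis)
    also have "\<dots> = (\<Sum>j\<in>{1..n}. if j = i then basis_vec {#i#} else 0)"
      by (intro sum.cong refl) (use i assms(4) in \<open>auto dest: inj_onD\<close>)
    also have "\<dots> = coord n q (word_class n q (basis_vec [i]))"
      using i w by (simp add: coord_word_class[OF q])
    finally have "coord n q (generator_map scale n v q (v i)) = coord n q (word_class n q (basis_vec [i]))" .
    moreover have "word_class n q (basis_vec [i]) \<in> carrier (symalg n q)"
      using w by (simp add: sym_carrier)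
    ultimately show ?thesis
      using bij_betw_imp_inj_on[OF coord_bij[OF q]] coord_generator_map(1)[OF q]
      by (meson inj_onD)
  qed
  have "quantum_action n q G \<alpha> a"
  proof (intro quantum_action.intro quantum_action_axioms.intro q assms(1,2) action(1))
    fix g i assume "g \<in> carrier G" "i \<in> {1..n}"
    then show "coord n q (\<alpha> g (word_class n q (basis_vec [i]))) = (\<Sum>j\<in>{1..n}. a g i j *\<^sub>C basis_vec {#j#})"
      using action(2)[of g "v i"] by (simp add: gen coord_generator_map(2)[OF q] a_def)
  qed
  then show ?thesis by (rule quantum_action.constant_cocycle_lifts) (rule assms(14))
qed

end
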